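(* The process $X^\infty=\lim_{N\to\infty}X^N$ is equal in law to the Gauss–Markov process $X$ solving $dX_t=\alpha(t)X_t\,dt+\sqrt{\Gamma(t)}\,dW_t$, $X_0=0$, on $[0,1]$.
   Context: Let $d,m\geq 1$. Let $\alpha:[0,1]\to\mathbb{R}^{d\times d}$, $\sqrt{\Gamma}:[0,1]\to\mathbb{R}^{d\times m}$ be continuous, $\Gamma=\sqrt{\Gamma}\sqrt{\Gamma}^{T}$, and $W$ an $m$-dimensional standard Wiener process. Let $F(s,t)$ be the flow ($\partial_tF(s,t)=\alpha(t)F(s,t)$, $F(s,s)=I_d$), $h_u(s,t)=\int_s^t F(w,u)\Gamma(w)F(w,u)^Tdw$, $h=h_0$, $g(t)=F(0,t)$. Non-degeneracy: $F(u,v)h_u(u,v)F(u,v)^T$ (the conditional covariance of $X_v$ given $X_u$) is positive definite for all $0\le u<v\le1$. $\mathcal{I}=\{(0,0)\}\cup\{(n,k):n\ge1,\ 0\le k<2^{n-1}\}$, $\mathcal{I}_N=\{(0,0)\}\cup\{(n,k)\in\mathcal{I}:1\le n\le N\}$. Partition: fix $\rho\in(0,1)$ and reals $l_{n,k}<m_{n,k}<r_{n,k}$ ($n\ge1$) with $l_{1,0}=0$, $r_{1,0}=1$, $l_{n+1,2k}=l_{n,k}$, $r_{n+1,2k}=l_{n+1,2k+1}=m_{n,k}$, $r_{n+1,2k+1}=r_{n,k}$, $\max(r_{n,k}-m_{n,k},m_{n,k}-l_{n,k})<\rho(r_{n,k}-l_{n,k})$. Basis: for $n\ge1$ (writing $l,m,r$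 for $l_{n,k},m_{n,k},r_{n,k}$), $\Sigma_{n,k}=h_m(l,m)h_m(l,r)^{-1}h_m(m,r)$, $\sigma_{n,k}$ its lower-triangular Cholesky factor with positive diagonal, $L_{n,k}=h(l,m)^{-1}g(m)^{-1}\sigma_{n,k}$, $R_{n,k}=h(m,r)^{-1}g(m)^{-1}\sigma_{n,k}$, $\psi_{n,k}(t)=g(t)h(l,t)L_{n,k}$ on $[l,m]$, $g(t)h(t,r)R_{n,k}$ on $[m,r]$, $0$ elsewhere; $\sigma_{0,0}$ is the lower-triangular Cholesky factor of $g(1)h(0,1)g(1)^T$, $L_{0,0}=h(0,1)^{-1}g(1)^{-1}\sigma_{0,0}$, $\psi_{0,0}(t)=g(t)h(0,t)L_{0,0}$. $(\Xi_{n,k})_{(n,k)\in\mathcal{I}}$ are independent $\mathcal{N}(0,I_d)$ random vectors, $X^N_t=\sum_{(n,k)\in\mathcal{I}_N}\psi_{n,k}(t)\Xi_{n,k}$, and $X^\infty$ is the almost sure limit of $X^N$. *)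

theory Defs
  imports "HOL-Analysis.Analysis" "HOL-Probability.Probability"
begin

text \<open>Matrices are real^'c^'r (rows indexed by 'r, columns by 'c). The state dimension d
is the cardinality of the finite type 'd, the noise dimension m that of 'm.\<close>

definition Gam :: "(real \<Rightarrow> ((real,'m::finite) vec,'d::{finite,linorder}) vec) \<Rightarrow> real \<Rightarrow> ((real,'d) vec,'d) vec" where
  "Gam sG t = sG t ** transpose (sG t)"

definition hu :: "(real \<Rightarrow> real \<Rightarrow> ((real,'d::{finite,linorder}) vec,'d) vec) \<Rightarrow> (real \<Rightarrow> ((real,'m::finite) vec,'d) vec)
    \<Rightarrow> real \<Rightarrow> real \<Rightarrow> real \<Rightarrow> ((real,'d) vec,'d) vec" where
  "hu F sG u s t = integral {s..t} (\<lambda>w. F w u ** Gam sG w ** transpose (F w u))"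

definition gfl :: "(real \<Rightarrow> real \<Rightarrow> ((real,'d::{finite,linorder}) vec,'d) vec) \<Rightarrow> real \<Rightarrow> ((real,'d) vec,'d) vec" where
  "gfl F t = F 0 t"

definition posdef :: "((real,'d::{finite,linorder}) vec,'d) vec \<Rightarrow> bool" where
  "posdef A \<longleftrightarrow> transpose A = A \<and> (\<forall>x. x \<noteq> 0 \<longrightarrow> x \<bullet> (A *v x) > 0)"

definition chol :: "((real, 'd::{finite,linorder}) vec, 'd) vec \<Rightarrow> ((real, 'd) vec, 'd) vec" where
  "chol A = (THE L. (\<forall>i j. i < j \<longrightarrow> L $ i $ j = 0) \<and> (\<forall>i. L $ i $ i > 0)
                    \<and> L ** transpose L = A)"

definition Iset :: "(nat \<times> nat) set" where
  "Iset = {(0,0)} \<union> {(n,k). 1 \<le> n \<and> k < 2^(n-1)}"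

definition IsetN :: "nat \<Rightarrow> (nat \<times> nat) set" where
  "IsetN N = {(0,0)} \<union> {(n,k). (n,k) \<in> Iset \<and> 1 \<le> n \<and> n \<le> N}"

definition Sig :: "(real \<Rightarrow> real \<Rightarrow> ((real,'d::{finite,linorder}) vec,'d) vec) \<Rightarrow> (real \<Rightarrow> ((real,'m::finite) vec,'d) vec)
    \<Rightarrow> real \<Rightarrow> real \<Rightarrow> real \<Rightarrow> ((real,'d) vec,'d) vec" where
  "Sig F sG l m r = hu F sG m l m ** matrix_inv (hu F sG m l r) ** hu F sG m m r"

definition psi :: "(real \<Rightarrow> real \<Rightarrow> ((real, 'd::{finite,linorder}) vec, 'd) vec) \<Rightarrow> (real \<Rightarrow> ((real,'m::finite) vec,'d) vec)
    \<Rightarrow> (nat \<Rightarrow> nat \<Rightarrow> real) \<Rightarrow> (nat \<Rightarrow> nat \<Rightarrow> real) \<Rightarrow> (nat \<Rightarrow> nat \<Rightarrow> real)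
    \<Rightarrow> nat \<Rightarrow> nat \<Rightarrow> real \<Rightarrow> ((real,'d) vec,'d) vec" where
  "psi F sG lp mp rp n k t =
     (let h = hu F sG 0; g = gfl F in
      if n = 0 then
        (let s0 = chol (g 1 ** h 0 1 ** transpose (g 1));
             L0 = matrix_inv (h 0 1) ** matrix_inv (g 1) ** s0
         in g t ** h 0 t ** L0)
      else
        (let l = lp n k; m = mp n k; r = rp n k;
             s = chol (Sig F sG l m r);
             L = matrix_inv (h l m) ** matrix_inv (g m) ** s;
             R = matrix_inv (h m r) ** matrix_inv (g m) ** s
         in if l \<le> t \<and> t \<le> m then g t ** h l t ** L
            else if m \<le> t \<and> t \<le> r then g t ** h t r ** R
            else 0))"

definition XN :: "(real \<Rightarrow> real \<Rightarrow> ((real, 'd::{finite,linorder}) vec, 'd) vec) \<Rightarrow> (real \<Rightarrow> ((real,'m::finite) vec,'d) vec)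
    \<Rightarrow> (nat \<Rightarrow> nat \<Rightarrow> real) \<Rightarrow> (nat \<Rightarrow> nat \<Rightarrow> real) \<Rightarrow> (nat \<Rightarrow> nat \<Rightarrow> real)
    \<Rightarrow> (nat \<times> nat \<Rightarrow> 'b \<Rightarrow> (real,'d) vec) \<Rightarrow> nat \<Rightarrow> real \<Rightarrow> 'b \<Rightarrow> (real,'d) vec" where
  "XN F sG lp mp rp Xi N t \<omega> = (\<Sum>(n,k)\<in>IsetN N. psi F sG lp mp rp n k t *v Xi (n,k) \<omega>)"

definition std_wiener :: "'a measure \<Rightarrow> (real \<Rightarrow> 'a \<Rightarrow> (real,'m::finite) vec) \<Rightarrow> bool" where
  "std_wiener M W \<longleftrightarrow> prob_space M
     \<and> (\<forall>t\<in>{0..1}. W t \<in> borel_measurable M)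
     \<and> (AE \<omega> in M. W 0 \<omega> = 0)
     \<and> (AE \<omega> in M. continuous_on {0..1} (\<lambda>t. W t \<omega>))
     \<and> (\<forall>ts::real list. sorted_wrt (<) ts \<longrightarrow> set ts \<subseteq> {0..1} \<longrightarrow>
          prob_space.indep_vars M (\<lambda>_. borel)
             (\<lambda>(i,j) \<omega>. W (ts!(Suc i)) \<omega> $ j - W (ts!i) \<omega> $ j)
             ({..<length ts - 1} \<times> (UNIV :: 'm set))
        \<and> (\<forall>i < length ts - 1. \<forall>j.
             distributed M lborel (\<lambda>\<omega>. W (ts!(Suc i)) \<omega> $ j - W (ts!i) \<omega> $ j)
               (normal_density 0 (sqrt (ts!(Suc i) - ts!i)))))"

definition ito_sum :: "(real \<Rightarrow> ((real,'m::finite) vec,'d::{finite,linorder}) vec) \<Rightarrow> (real \<Rightarrow> 'a \<Rightarrow> (real,'m) vec) \<Rightarrow> real \<Rightarrow> nat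
    \<Rightarrow> 'a \<Rightarrow> (real,'d) vec" where
  "ito_sum G W t n \<omega> = (\<Sum>i<2^n. G (real i * t / 2^n) *v
       (W (real (Suc i) * t / 2^n) \<omega> - W (real i * t / 2^n) \<omega>))"

definition is_ito_integral :: "'a measure \<Rightarrow> (real \<Rightarrow> ((real,'m::finite) vec,'d::{finite,linorder}) vec) \<Rightarrow> (real \<Rightarrow> 'a \<Rightarrow> (real,'m) vec)
    \<Rightarrow> real \<Rightarrow> ('a \<Rightarrow> (real,'d) vec) \<Rightarrow> bool" where
  "is_ito_integral M G W t I \<longleftrightarrow> I \<in> borel_measurable M \<and>
     (\<forall>e>0. ((\<lambda>n. measure M {\<omega>\<in>space M. e < norm (ito_sum G W t n \<omega> - I \<omega>)}) \<longlonglongrightarrow> 0))"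

definition sde_solution :: "'a measure \<Rightarrow> (real \<Rightarrow> ((real,'d::{finite,linorder}) vec,'d) vec) \<Rightarrow> (real \<Rightarrow> ((real,'m::finite) vec,'d) vec)
    \<Rightarrow> (real \<Rightarrow> 'a \<Rightarrow> (real,'m) vec) \<Rightarrow> (real \<Rightarrow> 'a \<Rightarrow> (real,'d) vec) \<Rightarrow> bool" where
  "sde_solution M \<alpha> sG W X \<longleftrightarrow>
     (\<forall>t\<in>{0..1}. X t \<in> borel_measurable M)
     \<and> (AE \<omega> in M. X 0 \<omega> = 0)
     \<and> (AE \<omega> in M. continuous_on {0..1} (\<lambda>t. X t \<omega>))
     \<and> (\<forall>t\<in>{0..1}. \<exists>I. is_ito_integral M sG W t I \<and>
          (AE \<omega> in M. X t \<omega> = integral {0..t} (\<lambda>s. \<alpha> s *v X s \<omega>) + I \<omega>))"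

definition proc_law :: "'a measure \<Rightarrow> (real \<Rightarrow> 'a \<Rightarrow> 'v::topological_space)
    \<Rightarrow> (real \<Rightarrow> 'v) measure" where
  "proc_law M X = distr M (PiM {0..1} (\<lambda>_. borel)) (\<lambda>\<omega>. \<lambda>t\<in>{0..1}. X t \<omega>)"

end

theory Submission
  imports Defs
begin

text \<open>
A process law on \<open>[0,1]\<close> is determined by the characteristic functions of the finite linear
combinations \<open>\<Sum> u\<^sub>t \<bullet> X\<^sub>t\<close>, so it suffices that for both processes these equal
\<open>exp (- V / 2)\<close> with the same variance \<open>V\<close>.

For the solution of the equation, \<open>X\<^sub>t\<close> is the limit of \<open>\<Sum> F(p\<^sub>i\<^sub>+\<^sub>1, t) (I(p\<^sub>i\<^sub>+\<^sub>1) - I(p\<^sub>i))\<close>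
along dyadic grids of \<open>[0,t]\<close>, where \<open>I(p)\<close> is the stochastic integral of the noise
coefficient; hence it is a limit of Wiener integrals of step functions, and \<open>V\<close> is the squared
\<open>L\<^sup>2\<close> norm of the limiting integrand.

For the series, the partial sum of \<open>\<psi>(s) \<psi>(t)\<^sup>T\<close> up to level \<open>N\<close> falls short of the covariance
\<open>g(s) h(0, s) g(t)\<^sup>T\<close>, \<open>s \<le> t\<close>, exactly by the covariance of the bridges pinned at the end points
of the cells of level \<open>N + 1\<close>. This remainder vanishes as soon as \<open>s < t\<close> lie in no common cell,
and for \<open>s = t\<close> it is bounded by a multiple of the cell length.
\<close>

section \<open>Cholesky factors of positive definite matrices\<close>

text \<open>\<open>is_ito_integral\<close> speaks of one time at a time, as a limit in probability
  of left-tagged sums, so there is no integral process on which to perform variation of constants.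
  It is done path by path instead: almost surely the integrals at all dyadic grid points equal
  \<open>X\<close> minus its drift integral, and continuity of the path alone makes the sums against
  the flow converge.

  For the series, \<open>F t 0\<close> transports every value to time 0, where the covariance over
  \<open>[a, b]\<close> is \<open>h a b\<close>, additive in the interval. With
  \<open>A = h l m\<close> and \<open>B = h m r\<close>, the conditional covariance of the value at
  \<open>m\<close> given those at \<open>l\<close> and \<open>r\<close> becomes
  \<open>A (A + B)^-1 B\<close>, the parallel sum, and the flow disappears from the algebra.
  \<open>Sig\<close> is this matrix transported to time \<open>m\<close>, and \<open>psi\<close> is
  the regression on the value at \<open>m\<close> times a square root of \<open>Sig\<close>.
  Refining by \<open>m\<close> therefore splits a bridge into \<open>psi(s) psi(t)^T\<close> plus
  the bridges on the two halves, and these identities telescope over the levels. On the diagonal the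
  remainder never becomes zero for free, since every \<open>t\<close> stays in some cell; there the
  parallel sum is compared with \<open>A\<close> alone, whose size is linear in the length.\<close>

lemma matrix_inv_eq:
  fixes A B :: "real^'n^'n"
  assumes "A ** B = mat 1"
  shows "matrix_inv A = B"
proof -
  have BA: "B ** A = mat 1"
    using assms matrix_left_right_inverse by blast
  have "A ** matrix_inv A = mat 1 \<and> matrix_inv A ** A = mat 1"
    unfolding matrix_inv_def by (rule someI[of _ B]) (simp add: assms BA)
  then have "B ** (A ** matrix_inv A) = B" by simp
  then show ?thesis by (simp add: matrix_mul_assoc BA)
qed

lemma posdef_matrix_inv:
  assumes "posdef A"
  shows "A ** matrix_inv A = mat 1" "matrix_inv A ** A = mat 1"
    "transpose (matrix_inv A) = matrix_inv A"
proof -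
  have "\<forall>x. A *v x = 0 \<longrightarrow> x = 0"
    using assms unfolding posdef_def by (metis inner_zero_right less_irrefl)
  then obtain B where BA: "B ** A = mat 1"
    using matrix_left_invertible_ker by blast
  then have AB: "A ** B = mat 1" using matrix_left_right_inverse by blast
  have inv: "matrix_inv A = B" using AB by (rule matrix_inv_eq)
  show "A ** matrix_inv A = mat 1" "matrix_inv A ** A = mat 1" by (simp_all add: inv AB BA)
  have "transpose (A ** B) = mat 1" by (simp add: AB transpose_mat)
  then have "transpose B ** A = mat 1"
    using assms by (simp add: matrix_transpose_mul posdef_def)
  then have "matrix_inv A = transpose B"
    using matrix_left_right_inverse matrix_inv_eq by blast
  then show "transpose (matrix_inv A) = matrix_inv A" by (simp add: inv)
qed

text \<open>Peeling off the least index leaves the Schur complement, which is again positive definite.\<close>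
lemma cholesky_on_finite:
  fixes A :: "'n::linorder \<Rightarrow> 'n \<Rightarrow> real"
  assumes "finite S"
    and "\<And>i j. A i j = A j i"
    and "\<And>x. (\<exists>i\<in>S. x i \<noteq> 0) \<Longrightarrow> (\<Sum>i\<in>S. \<Sum>j\<in>S. x i * A i j * x j) > 0"
  shows "\<exists>L. (\<forall>i\<in>S. \<forall>j\<in>S. i < j \<longrightarrow> L i j = 0) \<and> (\<forall>i\<in>S. L i i > 0)
           \<and> (\<forall>i\<in>S. \<forall>j\<in>S. (\<Sum>k\<in>S. L i k * L j k) = A i j)"
  using assms
proof (induction S arbitrary: A rule: finite_linorder_min_induct)
  case empty
  then show ?case by simp
next
  case (insert b S A)
  have bS: "b \<notin> S" using insert.hyps by auto
  note sym = insert.prems(1)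
  have quad: "(\<Sum>i\<in>insert b S. \<Sum>j\<in>insert b S. x i * A i j * x j)
      = A b b * (x b)\<^sup>2 + 2 * x b * (\<Sum>j\<in>S. A b j * x j) + (\<Sum>i\<in>S. \<Sum>j\<in>S. x i * A i j * x j)" for x
  proof -
    have "(\<Sum>i\<in>S. x i * A i b * x b) = x b * (\<Sum>j\<in>S. A b j * x j)"
      by (simp add: sum_distrib_left sym[of _ b] mult_ac)
    moreover have "(\<Sum>j\<in>S. x b * A b j * x j) = x b * (\<Sum>j\<in>S. A b j * x j)"
      by (simp add: sum_distrib_left mult_ac)
    ultimately show ?thesis
      using insert.hyps(1) bS by (simp add: sum.distrib power2_eq_square algebra_simps)
  qed
  have bb: "A b b > 0"
  proof -
    have "(\<Sum>j\<in>S. A b j * (if j = b then 1 else 0)) = 0"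
      "(\<Sum>i\<in>S. \<Sum>j\<in>S. (if i = b then 1 else 0) * A i j * (if j = b then 1 else 0)) = 0"
      using bS by (auto intro!: sum.neutral)
    with insert.prems(2)[of "\<lambda>i. if i = b then 1 else 0"] quad[of "\<lambda>i. if i = b then 1 else 0"]
    show ?thesis by auto
  qed
  define A' where "A' i j = A i j - A b i * A b j / A b b" for i j
  have pos': "(\<Sum>i\<in>S. \<Sum>j\<in>S. x i * A' i j * x j) > 0" if "\<exists>i\<in>S. x i \<noteq> 0" for x
  proof -
    define c where "c = (\<Sum>j\<in>S. A b j * x j)"
    \<comment> \<open>For fixed \<open>x\<close> on \<open>S\<close>, this value at \<open>b\<close>
      minimises the quadratic form of \<open>A\<close>; the minimum is the form of the Schur
      complement \<open>A'\<close>.\<close>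
    define y where "y = x(b := - c / A b b)"
    have yb: "y b = - c / A b b" by (simp add: y_def)
    have yS: "y j = x j" if "j \<in> S" for j using that bS by (auto simp: y_def)
    have "0 < (\<Sum>i\<in>insert b S. \<Sum>j\<in>insert b S. y i * A i j * y j)"
      using that bS by (intro insert.prems(2)) (auto simp: y_def)
    also have "\<dots> = A b b * (c / A b b)\<^sup>2 + 2 * (- c / A b b) * c + (\<Sum>i\<in>S. \<Sum>j\<in>S. x i * A i j * x j)"
      unfolding quad yb by (simp add: yS c_def cong: sum.cong)
    also have "\<dots> = (\<Sum>i\<in>S. \<Sum>j\<in>S. x i * A i j * x j) - c * c / A b b"
      using bb by (simp add: power2_eq_square field_simps)
    also have "c * c / A b b = (\<Sum>i\<in>S. \<Sum>j\<in>S. x i * (A b i * A b j / A b b) * x j)"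
      by (simp add: c_def sum_product sum_divide_distrib mult_ac)
    finally show ?thesis
      by (simp add: A'_def algebra_simps sum_subtractf)
  qed
  have "A' i j = A' j i" for i j by (simp add: A'_def sym[of i j])
  from insert.IH[OF this pos'] obtain L where
    L: "\<forall>i\<in>S. \<forall>j\<in>S. i < j \<longrightarrow> L i j = 0" "\<forall>i\<in>S. L i i > 0"
       "\<forall>i\<in>S. \<forall>j\<in>S. (\<Sum>k\<in>S. L i k * L j k) = A' i j"
    by blast
  \<comment> \<open>Column \<open>b\<close> is forced by the products with row \<open>b\<close>. Row
    \<open>b\<close> is zero elsewhere, which is lower triangular because \<open>b\<close> is below
    all of \<open>S\<close>.\<close>
  define K where "K i j = (if j = b then A b i / sqrt (A b b) else if i = b then 0 else L i j)" for i j
  have rS: "(\<Sum>k\<in>S. K i k * K j k) = (if i = b \<or> j = b then 0 else A' i j)"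
    if "i \<in> insert b S" "j \<in> insert b S" for i j
  proof (cases "i = b \<or> j = b")
    case True
    then show ?thesis using bS by (auto simp: K_def intro!: sum.neutral)
  next
    case False
    then have "(\<Sum>k\<in>S. K i k * K j k) = (\<Sum>k\<in>S. L i k * L j k)"
      using bS by (intro sum.cong) (auto simp: K_def)
    then show ?thesis using L(3) False that by auto
  qed
  have "(\<Sum>k\<in>insert b S. K i k * K j k) = A i j" if "i \<in> insert b S" "j \<in> insert b S" for i j
  proof -
    have "(\<Sum>k\<in>insert b S. K i k * K j k) = A b i * A b j / A b b + (\<Sum>k\<in>S. K i k * K j k)"
      using insert.hyps(1) bS bb by (simp add: K_def)
    also have "\<dots> = A i j"
      using bb by (auto simp: rS[OF that] A'_def sym[of i b])
    finally show ?thesis .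
  qed
  moreover have "\<forall>i\<in>insert b S. K i i > 0"
    using L(2) bb bS by (auto simp: K_def)
  moreover have "\<forall>i\<in>insert b S. \<forall>j\<in>insert b S. i < j \<longrightarrow> K i j = 0"
    using L(1) insert.hyps by (auto simp: K_def)
  ultimately show ?case by blast
qed

text \<open>Row \<open>j\<close> of a lower triangular matrix stops at column \<open>j\<close>, so
  entry \<open>(i, j)\<close> of the product involves columns up to \<open>j\<close> only. Once the
  earlier columns agree, the diagonal entry is determined up to sign, hence by positivity, and then
  the rest of column \<open>j\<close> by division.\<close>

lemma cholesky_unique:
  fixes L K :: "((real, 'n::{finite,linorder}) vec, 'n) vec"
  assumes L: "\<forall>i j. i < j \<longrightarrow> L $ i $ j = 0" "\<forall>i. L $ i $ i > 0"
    and K: "\<forall>i j. i < j \<longrightarrow> K $ i $ j = 0" "\<forall>i. K $ i $ i > 0"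
    and eq: "L ** transpose L = K ** transpose K"
  shows "L = K"
proof -
  have entry: "(\<Sum>k\<in>UNIV. L $ i $ k * L $ j $ k) = (\<Sum>k\<in>UNIV. K $ i $ k * K $ j $ k)" for i j
    using arg_cong[OF eq, of "\<lambda>A. A $ i $ j"] by (simp add: matrix_matrix_mult_def transpose_def)
  have "\<forall>i. L $ i $ j = K $ i $ j" for j
  \<comment> \<open>The index type is merely a finite linear order, so the position of
    \<open>j\<close> serves as the induction measure.\<close>
  proof (induction "card {..<j}" arbitrary: j rule: less_induct)
    case less
    have prev: "L $ i $ k = K $ i $ k" if "k < j" for i k
    proof -
      have "{..<k} \<subset> {..<j}" using that by auto
      then show ?thesis using less by (meson finite psubset_card_mono)
    qed
    have split: "(\<Sum>k\<in>UNIV. B $ i $ k * B $ j $ k) = (\<Sum>k\<in>{..<j}. B $ i $ k * B $ j $ k) + B $ i $ j * B $ j $ j"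
      if "\<forall>i j. i < j \<longrightarrow> B $ i $ j = 0" for B :: "((real, 'n) vec, 'n) vec" and i
    proof -
      have "(\<Sum>k\<in>UNIV. B $ i $ k * B $ j $ k) = (\<Sum>k\<in>{..j}. B $ i $ k * B $ j $ k)"
        using that by (intro sum.mono_neutral_right) (auto simp: not_le)
      also have "{..j} = insert j {..<j}" by auto
      finally show ?thesis by simp
    qed
    have *: "L $ i $ j * L $ j $ j = K $ i $ j * K $ j $ j" for i
    proof -
      have "(\<Sum>k<j. L $ i $ k * L $ j $ k) = (\<Sum>k<j. K $ i $ k * K $ j $ k)"
        by (intro sum.cong) (auto simp: prev)
      then show ?thesis
        using entry[of i j] by (simp add: split[OF L(1)] split[OF K(1)])
    qed
    have "L $ j $ j = K $ j $ j"
      using *[of j] L(2)[rule_format, of j] K(2)[rule_format, of j]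
      by (metis less_imp_le power2_eq_square power2_eq_imp_eq)
    then show ?case using * L(2)[rule_format, of j] by (metis less_irrefl mult_right_cancel)
  qed
  then show ?thesis by (simp add: vec_eq_iff)
qed

lemma inner_matrix_vector_sum:
  fixes A :: "real^'n^'m"
  shows "x \<bullet> (A *v y) = (\<Sum>i\<in>UNIV. \<Sum>j\<in>UNIV. x $ i * A $ i $ j * y $ j)"
  by (simp add: inner_vec_def matrix_vector_mult_def sum_distrib_left mult_ac)

text \<open>Existence and uniqueness of the factor are what give the description operator in
  \<open>chol\<close> a meaning.\<close>

lemma chol_mult_transpose:
  assumes "posdef A"
  shows "chol A ** transpose (chol A) = A"
proof -
  have sym: "A $ i $ j = A $ j $ i" for i j
  proof -
    have "A $ i $ j = transpose A $ j $ i" by (simp add: transpose_def)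
    then show ?thesis using assms by (simp add: posdef_def)
  qed
  have pos: "(\<Sum>i\<in>UNIV. \<Sum>j\<in>UNIV. x i * A $ i $ j * x j) > 0" if "\<exists>i\<in>UNIV. x i \<noteq> 0" for x
  proof -
    have "(\<chi> i. x i) \<noteq> 0" using that by (auto simp: vec_eq_iff)
    then have "(\<chi> i. x i) \<bullet> (A *v (\<chi> i. x i)) > 0" using assms by (simp add: posdef_def)
    then show ?thesis by (simp add: inner_matrix_vector_sum)
  qed
  obtain L where L: "\<forall>i\<in>UNIV. \<forall>j\<in>UNIV. i < j \<longrightarrow> L i j = 0" "\<forall>i\<in>UNIV. L i i > 0"
       "\<forall>i\<in>UNIV. \<forall>j\<in>UNIV. (\<Sum>k\<in>UNIV. L i k * L j k) = A $ i $ j"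
    using cholesky_on_finite[OF finite sym pos] by blast
  let ?P = "\<lambda>L. (\<forall>i j. i < j \<longrightarrow> L $ i $ j = 0) \<and> (\<forall>i. L $ i $ i > 0) \<and> L ** transpose L = A"
  have "\<exists>!L. ?P L"
  proof (rule ex_ex1I)
    show "\<exists>L. ?P L"
      by (rule exI[of _ "\<chi> i j. L i j"])
        (use L in \<open>auto simp: vec_eq_iff matrix_matrix_mult_def transpose_def\<close>)
  qed (metis cholesky_unique)
  then have "?P (THE L. ?P L)" by (rule theI')
  then show ?thesis by (simp add: chol_def)
qed

section \<open>Characteristic functions and finite-dimensional laws\<close>

lemma norm_iexp [simp]: "cmod (iexp x) = 1"
  by (simp add: norm_exp_i_times)

lemma iexp_add: "iexp (x + y) = iexp x * iexp y"
  by (simp add: distrib_left exp_add)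

lemma iexp_eq_cos_sin: "iexp x = complex_of_real (cos x) + \<i> * complex_of_real (sin x)"
  by (simp add: exp_Euler cos_of_real sin_of_real)

lemma (in prob_space) integrable_bounded:
  fixes f :: "'a \<Rightarrow> 'c::{banach, second_countable_topology}"
  assumes "f \<in> borel_measurable M" "\<And>x. norm (f x) \<le> B"
  shows "integrable M f"
  using assms by (intro integrable_const_bound[of _ B]) auto

text \<open>The case \<open>s = 0\<close> of \<open>eq\<close> says that both weights have the same
  mass \<open>c\<close>. Dividing by \<open>c\<close> turns them into probability densities under
  which \<open>X\<close> and \<open>Y\<close> have equal characteristic functions, so Levy's
  uniqueness theorem applies.\<close>

lemma weighted_charfun_eq_imp_integral_eq:
  fixes X w :: "'a \<Rightarrow> real" and Y v :: "'b \<Rightarrow> real"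
  assumes [measurable]: "X \<in> borel_measurable M" "Y \<in> borel_measurable N"
    and w: "integrable M w" "\<And>\<omega>. 0 \<le> w \<omega>"
    and v: "integrable N v" "\<And>\<omega>. 0 \<le> v \<omega>"
    and eq: "\<And>s. (CLINT \<omega>|M. w \<omega> * iexp (s * X \<omega>)) = (CLINT \<omega>|N. v \<omega> * iexp (s * Y \<omega>))"
    and B [measurable]: "B \<in> sets borel"
  shows "(\<integral>\<omega>. w \<omega> * indicator B (X \<omega>) \<partial>M) = (\<integral>\<omega>. v \<omega> * indicator B (Y \<omega>) \<partial>N)"
proof -
  define c where "c = (\<integral>\<omega>. w \<omega> \<partial>M)"
  have wm [measurable]: "w \<in> borel_measurable M" and vm [measurable]: "v \<in> borel_measurable N"
    using w(1) v(1) by auto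
  have c': "c = (\<integral>\<omega>. v \<omega> \<partial>N)"
    using eq[of 0] by (simp add: c_def)
  have c0: "c \<ge> 0" unfolding c_def using w(2) by (intro integral_nonneg_AE) auto
  show ?thesis
  \<comment> \<open>Without mass there is nothing to normalise, but then both weights vanish almost
    everywhere.\<close>
  proof (cases "c = 0")
    case True
    have "AE \<omega> in M. w \<omega> = 0"
      using integral_nonneg_eq_0_iff_AE[OF w(1)] w(2) True c_def by auto
    then have "(\<integral>\<omega>. w \<omega> * indicator B (X \<omega>) \<partial>M) = 0" by (intro integral_eq_zero_AE) auto
    moreover have "AE \<omega> in N. v \<omega> = 0"
      using integral_nonneg_eq_0_iff_AE[OF v(1)] v(2) True c' by auto
    then have "(\<integral>\<omega>. v \<omega> * indicator B (Y \<omega>) \<partial>N) = 0" by (intro integral_eq_zero_AE) auto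
    ultimately show ?thesis by simp
  next
    case False
    with c0 have cpos: "c > 0" by simp
    \<comment> \<open>Stated for an arbitrary measure \<open>K\<close>, to be used once for
      \<open>M\<close> and once for \<open>N\<close>.\<close>
    have D: "real_distribution (distr (density K (\<lambda>\<omega>. ennreal (w \<omega> / c))) borel X) \<and>
       (\<forall>s. char (distr (density K (\<lambda>\<omega>. ennreal (w \<omega> / c))) borel X) s = (CLINT \<omega>|K. w \<omega> * iexp (s * X \<omega>)) / c) \<and>
       measure (distr (density K (\<lambda>\<omega>. ennreal (w \<omega> / c))) borel X) B = (\<integral>\<omega>. w \<omega> * indicator B (X \<omega>) \<partial>K) / c"
      if [measurable]: "X \<in> borel_measurable K" and w: "integrable K w" "\<And>\<omega>. 0 \<le> w \<omega>" "(\<integral>\<omega>. w \<omega> \<partial>K) = c"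
      for K :: "'c measure" and X w :: "'c \<Rightarrow> real"
    proof -
      have [measurable]: "w \<in> borel_measurable K" using w(1) by auto
      have "emeasure (density K (\<lambda>\<omega>. ennreal (w \<omega> / c))) (space K) = (\<integral>\<^sup>+\<omega>. ennreal (w \<omega> / c) \<partial>K)"
        by (simp add: emeasure_density)
      also have "\<dots> = ennreal (\<integral>\<omega>. w \<omega> / c \<partial>K)"
        using w cpos by (intro nn_integral_eq_integral) auto
      also have "\<dots> = 1" using w(3) cpos by simp
      finally interpret D: prob_space "density K (\<lambda>\<omega>. ennreal (w \<omega> / c))"
        by (intro prob_spaceI) simp
      have RD: "real_distribution (distr (density K (\<lambda>\<omega>. ennreal (w \<omega> / c))) borel X)"
        by (intro D.real_distribution_distr) simp
      then interpret RD: real_distribution "distr (density K (\<lambda>\<omega>. ennreal (w \<omega> / c))) borel X" .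
      have "char (distr (density K (\<lambda>\<omega>. ennreal (w \<omega> / c))) borel X) s = (CLINT \<omega>|K. w \<omega> * iexp (s * X \<omega>)) / c" for s
      proof -
        have "char (distr (density K (\<lambda>\<omega>. ennreal (w \<omega> / c))) borel X) s
          = (CLINT \<omega>|density K (\<lambda>\<omega>. ennreal (w \<omega> / c)). iexp (s * X \<omega>))"
          unfolding char_def by (subst integral_distr) auto
        also have "\<dots> = (CLINT \<omega>|K. (w \<omega> / c) *\<^sub>R iexp (s * X \<omega>))"
          using w(2) cpos by (subst integral_density) auto
        also have "\<dots> = (CLINT \<omega>|K. w \<omega> * iexp (s * X \<omega>) / c)"
          by (simp add: scaleR_conv_of_real)
        also have "\<dots> = (CLINT \<omega>|K. w \<omega> * iexp (s * X \<omega>)) / c" by simp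
        finally show ?thesis .
      qed
      moreover have "measure (distr (density K (\<lambda>\<omega>. ennreal (w \<omega> / c))) borel X) B = (\<integral>\<omega>. w \<omega> * indicator B (X \<omega>) \<partial>K) / c"
      proof -
        have "measure (distr (density K (\<lambda>\<omega>. ennreal (w \<omega> / c))) borel X) B
          = (\<integral>x. indicator B x \<partial>distr (density K (\<lambda>\<omega>. ennreal (w \<omega> / c))) borel X)"
          by simp
        also have "\<dots> = (\<integral>\<omega>. indicator B (X \<omega>) \<partial>density K (\<lambda>\<omega>. ennreal (w \<omega> / c)))"
          by (subst integral_distr) auto
        also have "\<dots> = (\<integral>\<omega>. (w \<omega> / c) *\<^sub>R indicator B (X \<omega>) \<partial>K)"
          using w(2) cpos by (subst integral_density) auto
        also have "\<dots> = (\<integral>\<omega>. w \<omega> * indicator B (X \<omega>) / c \<partial>K)" by simp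
        also have "\<dots> = (\<integral>\<omega>. w \<omega> * indicator B (X \<omega>) \<partial>K) / c" by (subst integral_divide_zero) simp
        finally show ?thesis .
      qed
      ultimately show ?thesis using RD by simp
    qed
    note DM = D[OF assms(1) w c_def[symmetric]]
    note DN = D[OF assms(2) v c'[symmetric]]
    have "distr (density M (\<lambda>\<omega>. ennreal (w \<omega> / c))) borel X = distr (density N (\<lambda>\<omega>. ennreal (v \<omega> / c))) borel Y"
      using DM DN eq by (intro Levy_uniqueness) (auto simp: fun_eq_iff)
    then show ?thesis using DM DN cpos by simp
  qed
qed

text \<open>The coordinates are moved one at a time from the exponential into indicators; the
weights \<open>1 + cos \<theta>\<close> and \<open>1 + sin \<theta>\<close> are nonnegative, so only the uniqueness theorem on the
real line is needed.\<close>
lemma joint_charfun_eq_imp_prob_eq: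
  fixes X :: "'i \<Rightarrow> 'a \<Rightarrow> real" and Y :: "'i \<Rightarrow> 'b \<Rightarrow> real"
  assumes "prob_space M" "prob_space N" and J: "finite J"
    and X: "\<And>j. j \<in> J \<Longrightarrow> X j \<in> borel_measurable M"
    and Y: "\<And>j. j \<in> J \<Longrightarrow> Y j \<in> borel_measurable N"
    and A: "\<And>j. j \<in> J \<Longrightarrow> A j \<in> sets borel"
    and eq: "\<And>u. (CLINT \<omega>|M. iexp (\<Sum>j\<in>J. u j * X j \<omega>)) = (CLINT \<omega>|N. iexp (\<Sum>j\<in>J. u j * Y j \<omega>))"
  shows "measure M {\<omega>\<in>space M. \<forall>j\<in>J. X j \<omega> \<in> A j} = measure N {\<omega>\<in>space N. \<forall>j\<in>J. Y j \<omega> \<in> A j}"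
proof -
  interpret M: prob_space M by fact
  interpret N: prob_space N by fact
  \<comment> \<open>Interpolates between the hypothesis at \<open>K = {}\<close> and the
    probabilities of boxes at \<open>K = J\<close>.\<close>
  have "(CLINT \<omega>|M. (\<Prod>j\<in>K. indicator (A j) (X j \<omega>) :: real) * iexp (\<Sum>j\<in>J-K. u j * X j \<omega>))
      = (CLINT \<omega>|N. (\<Prod>j\<in>K. indicator (A j) (Y j \<omega>) :: real) * iexp (\<Sum>j\<in>J-K. u j * Y j \<omega>))"
    if "finite K" "K \<subseteq> J" for K u
    using that
  proof (induction K arbitrary: u rule: finite_induct)
    case empty
    then show ?case using eq by simp
  next
    case (insert b K)
    then have b: "b \<in> J" "b \<notin> K" "K \<subseteq> J" by auto
    let ?J = "J - insert b K"
    have Jb: "J - K = insert b ?J" and finJ: "finite ?J" using b J by auto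
    \<comment> \<open>With \<open>p\<close> the product of the earlier indicators and
      \<open>q\<close> the new one, Euler's formulas express the weights \<open>p (1 + cos)\<close>
      and \<open>p (1 + sin)\<close> through exponentials. The third identity goes back: it recovers
      \<open>p q iexp\<close> by subtracting the unweighted integral of \<open>p q\<close>.\<close>
    have expand: "(CLINT \<omega>|L. (p \<omega> * (1 + cos (\<theta> \<omega>))) * iexp (s * Z \<omega>))
            = (CLINT \<omega>|L. p \<omega> * iexp (s * Z \<omega>))
              + ((CLINT \<omega>|L. p \<omega> * iexp (s * Z \<omega> + \<theta> \<omega>)) + (CLINT \<omega>|L. p \<omega> * iexp (s * Z \<omega> - \<theta> \<omega>))) / 2"
          "(CLINT \<omega>|L. (p \<omega> * (1 + sin (\<theta> \<omega>))) * iexp (s * Z \<omega>))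
            = (CLINT \<omega>|L. p \<omega> * iexp (s * Z \<omega>))
              + ((CLINT \<omega>|L. p \<omega> * iexp (s * Z \<omega> + \<theta> \<omega>)) - (CLINT \<omega>|L. p \<omega> * iexp (s * Z \<omega> - \<theta> \<omega>))) / (2 * \<i>)"
          "(CLINT \<omega>|L. (p \<omega> * q \<omega>) * iexp (\<theta> \<omega>))
            = complex_of_real ((\<integral>\<omega>. (p \<omega> * (1 + cos (\<theta> \<omega>))) * q \<omega> \<partial>L) - (\<integral>\<omega>. p \<omega> * q \<omega> \<partial>L))
              + \<i> * complex_of_real ((\<integral>\<omega>. (p \<omega> * (1 + sin (\<theta> \<omega>))) * q \<omega> \<partial>L) - (\<integral>\<omega>. p \<omega> * q \<omega> \<partial>L))"
          "integrable L p" "integrable L (\<lambda>\<omega>. p \<omega> * (1 + cos (\<theta> \<omega>)))" "integrable L (\<lambda>\<omega>. p \<omega> * (1 + sin (\<theta> \<omega>)))"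
      if "prob_space L" and [measurable]: "p \<in> borel_measurable L" "q \<in> borel_measurable L" "\<theta> \<in> borel_measurable L" "Z \<in> borel_measurable L"
        and p: "\<And>\<omega>. 0 \<le> p \<omega> \<and> p \<omega> \<le> 1" and q: "\<And>\<omega>. 0 \<le> q \<omega> \<and> q \<omega> \<le> 1"
      for L :: "'c measure" and p q \<theta> Z :: "'c \<Rightarrow> real" and s :: real
    proof -
      interpret L: prob_space L by fact
      have pq: "\<bar>p \<omega> * q \<omega>\<bar> \<le> 1" for \<omega> using p q by (simp add: abs_mult mult_le_one)
      have int: "integrable L (\<lambda>\<omega>. p \<omega> * iexp (\<zeta> \<omega>))" if [measurable]: "\<zeta> \<in> borel_measurable L" for \<zeta> :: "'c \<Rightarrow> real"
        using p by (intro L.integrable_bounded[of _ 1]) (auto simp: norm_mult)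
      have intr: "integrable L (\<lambda>\<omega>. p \<omega> * q \<omega> * r \<omega>)" "integrable L (\<lambda>\<omega>. p \<omega> * r \<omega>)"
        if [measurable]: "r \<in> borel_measurable L" and "\<And>\<omega>. \<bar>r \<omega>\<bar> \<le> 1" for r :: "'c \<Rightarrow> real"
      proof -
        show "integrable L (\<lambda>\<omega>. p \<omega> * q \<omega> * r \<omega>)"
          by (rule L.integrable_bounded[of _ 1])
            (simp, metis abs_ge_zero abs_mult mult_le_one pq real_norm_def that(2))
        show "integrable L (\<lambda>\<omega>. p \<omega> * r \<omega>)"
          by (rule L.integrable_bounded[of _ 1])
            (simp, metis abs_ge_zero abs_mult mult_le_one abs_of_nonneg p real_norm_def that(2))
      qed
      have intp: "integrable L (\<lambda>\<omega>. p \<omega> * q \<omega>)" "integrable L p"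
        using intr(1)[of "\<lambda>_. 1"] intr(2)[of "\<lambda>_. 1"] by simp_all
      then show "integrable L p" by simp
      note cs = intr[of "\<lambda>\<omega>. cos (\<theta> \<omega>)"] intr[of "\<lambda>\<omega>. sin (\<theta> \<omega>)"]
      show "integrable L (\<lambda>\<omega>. p \<omega> * (1 + cos (\<theta> \<omega>)))" "integrable L (\<lambda>\<omega>. p \<omega> * (1 + sin (\<theta> \<omega>)))"
        using cs intp by (simp_all add: distrib_left)
      have lin: "(CLINT \<omega>|L. f \<omega> + (g \<omega> + h \<omega>) / c) = (CLINT \<omega>|L. f \<omega>) + ((CLINT \<omega>|L. g \<omega>) + (CLINT \<omega>|L. h \<omega>)) / c"
          "(CLINT \<omega>|L. f \<omega> + (g \<omega> - h \<omega>) / c) = (CLINT \<omega>|L. f \<omega>) + ((CLINT \<omega>|L. g \<omega>) - (CLINT \<omega>|L. h \<omega>)) / c"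
        if "integrable L f" "integrable L g" "integrable L h" for f g h :: "'c \<Rightarrow> complex" and c
        using that by simp_all
      have ints: "integrable L (\<lambda>\<omega>. p \<omega> * iexp (s * Z \<omega>))" "integrable L (\<lambda>\<omega>. p \<omega> * iexp (s * Z \<omega> + \<theta> \<omega>))"
          "integrable L (\<lambda>\<omega>. p \<omega> * iexp (s * Z \<omega> - \<theta> \<omega>))"
        by (intro int; measurable)+
      have neg: "iexp (s * Z \<omega> - \<theta> \<omega>) = iexp (s * Z \<omega>) * (cos (\<theta> \<omega>) - \<i> * sin (\<theta> \<omega>))" for \<omega>
      proof -
        have "iexp (- \<theta> \<omega>) = cos (\<theta> \<omega>) - \<i> * sin (\<theta> \<omega>)"
          using iexp_eq_cos_sin[of "- \<theta> \<omega>"] by simp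
        then show ?thesis
          using iexp_add[of "s * Z \<omega>" "- \<theta> \<omega>"] by simp
      qed
      have pos: "iexp (s * Z \<omega> + \<theta> \<omega>) = iexp (s * Z \<omega>) * (cos (\<theta> \<omega>) + \<i> * sin (\<theta> \<omega>))" for \<omega>
        unfolding iexp_add by (simp only: iexp_eq_cos_sin[of "\<theta> \<omega>"])
      have "(p \<omega> * (1 + cos (\<theta> \<omega>))) * iexp (s * Z \<omega>) = p \<omega> * iexp (s * Z \<omega>)
          + (p \<omega> * iexp (s * Z \<omega> + \<theta> \<omega>) + p \<omega> * iexp (s * Z \<omega> - \<theta> \<omega>)) / 2" for \<omega>
        unfolding neg pos by (simp add: algebra_simps)
      then show "(CLINT \<omega>|L. (p \<omega> * (1 + cos (\<theta> \<omega>))) * iexp (s * Z \<omega>))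
            = (CLINT \<omega>|L. p \<omega> * iexp (s * Z \<omega>))
              + ((CLINT \<omega>|L. p \<omega> * iexp (s * Z \<omega> + \<theta> \<omega>)) + (CLINT \<omega>|L. p \<omega> * iexp (s * Z \<omega> - \<theta> \<omega>))) / 2"
        by (simp only: lin(1)[OF ints])
      have "(p \<omega> * (1 + sin (\<theta> \<omega>))) * iexp (s * Z \<omega>) = p \<omega> * iexp (s * Z \<omega>)
          + (p \<omega> * iexp (s * Z \<omega> + \<theta> \<omega>) - p \<omega> * iexp (s * Z \<omega> - \<theta> \<omega>)) / (2 * \<i>)" for \<omega>
        unfolding neg pos by (simp add: algebra_simps)
      then show "(CLINT \<omega>|L. (p \<omega> * (1 + sin (\<theta> \<omega>))) * iexp (s * Z \<omega>))
            = (CLINT \<omega>|L. p \<omega> * iexp (s * Z \<omega>))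
              + ((CLINT \<omega>|L. p \<omega> * iexp (s * Z \<omega> + \<theta> \<omega>)) - (CLINT \<omega>|L. p \<omega> * iexp (s * Z \<omega> - \<theta> \<omega>))) / (2 * \<i>)"
        by (simp only: lin(2)[OF ints])
      have "(CLINT \<omega>|L. (p \<omega> * q \<omega>) * iexp (\<theta> \<omega>))
          = (CLINT \<omega>|L. complex_of_real (p \<omega> * q \<omega> * cos (\<theta> \<omega>)) + \<i> * complex_of_real (p \<omega> * q \<omega> * sin (\<theta> \<omega>)))"
        by (rule Bochner_Integration.integral_cong) (simp_all add: iexp_eq_cos_sin algebra_simps)
      also have "\<dots> = complex_of_real (\<integral>\<omega>. p \<omega> * q \<omega> * cos (\<theta> \<omega>) \<partial>L) + \<i> * complex_of_real (\<integral>\<omega>. p \<omega> * q \<omega> * sin (\<theta> \<omega>) \<partial>L)"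
        using cs by (subst Bochner_Integration.integral_add) (auto simp del: of_real_mult)
      also have "(\<integral>\<omega>. p \<omega> * q \<omega> * cos (\<theta> \<omega>) \<partial>L) = (\<integral>\<omega>. (p \<omega> * (1 + cos (\<theta> \<omega>))) * q \<omega> \<partial>L) - (\<integral>\<omega>. p \<omega> * q \<omega> \<partial>L)"
      proof -
        have "(\<integral>\<omega>. (p \<omega> * (1 + cos (\<theta> \<omega>))) * q \<omega> \<partial>L) = (\<integral>\<omega>. p \<omega> * q \<omega> + p \<omega> * q \<omega> * cos (\<theta> \<omega>) \<partial>L)"
          by (rule Bochner_Integration.integral_cong) (simp_all add: algebra_simps)
        also have "\<dots> = (\<integral>\<omega>. p \<omega> * q \<omega> \<partial>L) + (\<integral>\<omega>. p \<omega> * q \<omega> * cos (\<theta> \<omega>) \<partial>L)"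
          using cs intp by (intro Bochner_Integration.integral_add) auto
        finally show ?thesis by simp
      qed
      also have "(\<integral>\<omega>. p \<omega> * q \<omega> * sin (\<theta> \<omega>) \<partial>L) = (\<integral>\<omega>. (p \<omega> * (1 + sin (\<theta> \<omega>))) * q \<omega> \<partial>L) - (\<integral>\<omega>. p \<omega> * q \<omega> \<partial>L)"
      proof -
        have "(\<integral>\<omega>. (p \<omega> * (1 + sin (\<theta> \<omega>))) * q \<omega> \<partial>L) = (\<integral>\<omega>. p \<omega> * q \<omega> + p \<omega> * q \<omega> * sin (\<theta> \<omega>) \<partial>L)"
          by (rule Bochner_Integration.integral_cong) (simp_all add: algebra_simps)
        also have "\<dots> = (\<integral>\<omega>. p \<omega> * q \<omega> \<partial>L) + (\<integral>\<omega>. p \<omega> * q \<omega> * sin (\<theta> \<omega>) \<partial>L)"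
          using cs intp by (intro Bochner_Integration.integral_add) auto
        finally show ?thesis by simp
      qed
      finally show "(CLINT \<omega>|L. (p \<omega> * q \<omega>) * iexp (\<theta> \<omega>))
            = complex_of_real ((\<integral>\<omega>. (p \<omega> * (1 + cos (\<theta> \<omega>))) * q \<omega> \<partial>L) - (\<integral>\<omega>. p \<omega> * q \<omega> \<partial>L))
              + \<i> * complex_of_real ((\<integral>\<omega>. (p \<omega> * (1 + sin (\<theta> \<omega>))) * q \<omega> \<partial>L) - (\<integral>\<omega>. p \<omega> * q \<omega> \<partial>L))" .
    qed
    define pX \<theta>X where "pX \<omega> = (\<Prod>j\<in>K. indicator (A j) (X j \<omega>) :: real)"
      and "\<theta>X \<omega> = (\<Sum>j\<in>?J. u j * X j \<omega>)" for \<omega>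
    define pY \<theta>Y where "pY \<omega> = (\<Prod>j\<in>K. indicator (A j) (Y j \<omega>) :: real)"
      and "\<theta>Y \<omega> = (\<Sum>j\<in>?J. u j * Y j \<omega>)" for \<omega>
    have Xb: "X b \<in> borel_measurable M" and Yb: "Y b \<in> borel_measurable N" and Ab: "A b \<in> sets borel"
      using b X Y A by auto
    have mX [measurable]: "pX \<in> borel_measurable M" "\<theta>X \<in> borel_measurable M"
      "(\<lambda>\<omega>. indicator (A b) (X b \<omega>) :: real) \<in> borel_measurable M"
    proof -
      have "(\<lambda>\<omega>. indicator (A j) (X j \<omega>) :: real) \<in> borel_measurable M" if "j \<in> J" for j
        using measurable_compose[OF X[OF that] borel_measurable_indicator[OF A[OF that]]] .
      then show "pX \<in> borel_measurable M" "(\<lambda>\<omega>. indicator (A b) (X b \<omega>) :: real) \<in> borel_measurable M"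
        using b unfolding pX_def by (auto intro!: borel_measurable_prod)
      show "\<theta>X \<in> borel_measurable M" unfolding \<theta>X_def
        using X by (intro borel_measurable_sum borel_measurable_times) auto
    qed
    have mY [measurable]: "pY \<in> borel_measurable N" "\<theta>Y \<in> borel_measurable N"
      "(\<lambda>\<omega>. indicator (A b) (Y b \<omega>) :: real) \<in> borel_measurable N"
    proof -
      have "(\<lambda>\<omega>. indicator (A j) (Y j \<omega>) :: real) \<in> borel_measurable N" if "j \<in> J" for j
        using measurable_compose[OF Y[OF that] borel_measurable_indicator[OF A[OF that]]] .
      then show "pY \<in> borel_measurable N" "(\<lambda>\<omega>. indicator (A b) (Y b \<omega>) :: real) \<in> borel_measurable N"
        using b unfolding pY_def by (auto intro!: borel_measurable_prod)
      show "\<theta>Y \<in> borel_measurable N" unfolding \<theta>Y_def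
        using Y by (intro borel_measurable_sum borel_measurable_times) auto
    qed
    have pX01: "0 \<le> pX \<omega> \<and> pX \<omega> \<le> 1" for \<omega>
      by (auto simp: pX_def indicator_def intro!: prod_nonneg prod_le_1)
    have pY01: "0 \<le> pY \<omega> \<and> pY \<omega> \<le> 1" for \<omega>
      by (auto simp: pY_def indicator_def intro!: prod_nonneg prod_le_1)
    have ind01: "0 \<le> (indicator B x :: real) \<and> (indicator B x :: real) \<le> 1" for B and x :: real
      by (simp add: indicator_def)
    \<comment> \<open>The induction hypothesis holds for all coefficients, so the coefficient at
      \<open>b\<close> can be freed as \<open>s\<close> and the others scaled by \<open>c\<close>.
      The values \<open>c = 0, 1, -1\<close> supply the three integrals on the right of
      \<open>expand\<close>.\<close>
    have base: "(CLINT \<omega>|M. pX \<omega> * iexp (s * X b \<omega> + c * \<theta>X \<omega>)) = (CLINT \<omega>|N. pY \<omega> * iexp (s * Y b \<omega> + c * \<theta>Y \<omega>))" for s c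
    proof -
      have *: "(\<Sum>j\<in>J-K. (if j = b then s else c * u j) * Z j) = s * Z b + c * (\<Sum>j\<in>?J. u j * Z j)" for Z :: "'i \<Rightarrow> real"
      proof -
        have "(\<Sum>j\<in>?J. (if j = b then s else c * u j) * Z j) = (\<Sum>j\<in>?J. c * (u j * Z j))"
          by (intro sum.cong) auto
        then show ?thesis
          unfolding Jb using finJ by (simp add: sum_distrib_left)
      qed
      show ?thesis
        using insert.IH[OF b(3), of "\<lambda>j. if j = b then s else c * u j"]
        unfolding * pX_def pY_def \<theta>X_def \<theta>Y_def .
    qed
    have base0: "(CLINT \<omega>|M. pX \<omega> * iexp (s * X b \<omega>)) = (CLINT \<omega>|N. pY \<omega> * iexp (s * Y b \<omega>))"
        "(CLINT \<omega>|M. pX \<omega> * iexp (s * X b \<omega> + \<theta>X \<omega>)) = (CLINT \<omega>|N. pY \<omega> * iexp (s * Y b \<omega> + \<theta>Y \<omega>))"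
        "(CLINT \<omega>|M. pX \<omega> * iexp (s * X b \<omega> - \<theta>X \<omega>)) = (CLINT \<omega>|N. pY \<omega> * iexp (s * Y b \<omega> - \<theta>Y \<omega>))" for s
      using base[of s 0] base[of s 1] base[of s "-1"] by simp_all
    note eX = expand[OF \<open>prob_space M\<close> mX(1,3,2) Xb pX01 ind01]
    note eY = expand[OF \<open>prob_space N\<close> mY(1,3,2) Yb pY01 ind01]
    have cosnn: "0 \<le> 1 + cos (y::real)" "0 \<le> 1 + sin (y::real)" for y
      using cos_ge_minus_one[of y] sin_ge_minus_one[of y] by linarith+
    have nn: "0 \<le> pX \<omega> * (1 + cos (\<theta>X \<omega>))" "0 \<le> pX \<omega> * (1 + sin (\<theta>X \<omega>))" for \<omega>
      using pX01 cosnn by (auto intro!: mult_nonneg_nonneg)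
    have nn': "0 \<le> pY \<omega> * (1 + cos (\<theta>Y \<omega>))" "0 \<le> pY \<omega> * (1 + sin (\<theta>Y \<omega>))" for \<omega>
      using pY01 cosnn by (auto intro!: mult_nonneg_nonneg)
    note weq = weighted_charfun_eq_imp_integral_eq[OF Xb Yb _ _ _ _ _ Ab]
    have "(\<integral>\<omega>. pX \<omega> * indicator (A b) (X b \<omega>) \<partial>M) = (\<integral>\<omega>. pY \<omega> * indicator (A b) (Y b \<omega>) \<partial>N)"
      by (rule weq[OF eX(4) _ eY(4) _ base0(1)]) (simp_all add: pX01 pY01)
    moreover have "(\<integral>\<omega>. pX \<omega> * (1 + cos (\<theta>X \<omega>)) * indicator (A b) (X b \<omega>) \<partial>M)
        = (\<integral>\<omega>. pY \<omega> * (1 + cos (\<theta>Y \<omega>)) * indicator (A b) (Y b \<omega>) \<partial>N)"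
      by (rule weq[OF eX(5) nn(1) eY(5) nn'(1)]) (simp only: eX(1) eY(1) base0)
    moreover have "(\<integral>\<omega>. pX \<omega> * (1 + sin (\<theta>X \<omega>)) * indicator (A b) (X b \<omega>) \<partial>M)
        = (\<integral>\<omega>. pY \<omega> * (1 + sin (\<theta>Y \<omega>)) * indicator (A b) (Y b \<omega>) \<partial>N)"
      by (rule weq[OF eX(6) nn(2) eY(6) nn'(2)]) (simp only: eX(2) eY(2) base0)
    ultimately have "(CLINT \<omega>|M. (pX \<omega> * indicator (A b) (X b \<omega>) :: real) * iexp (\<theta>X \<omega>))
       = (CLINT \<omega>|N. (pY \<omega> * indicator (A b) (Y b \<omega>) :: real) * iexp (\<theta>Y \<omega>))"
      by (simp only: eX(3) eY(3))
    then show ?case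
      using insert.hyps by (simp add: pX_def pY_def \<theta>X_def \<theta>Y_def mult_ac)
  qed
  from this[OF J order_refl, of "\<lambda>_. 0"]
  have *: "(CLINT \<omega>|M. complex_of_real (\<Prod>j\<in>J. indicator (A j) (X j \<omega>)))
      = (CLINT \<omega>|N. complex_of_real (\<Prod>j\<in>J. indicator (A j) (Y j \<omega>)))" by simp
  have prob: "(CLINT \<omega>|L. complex_of_real (\<Prod>j\<in>J. indicator (A j) (Z j \<omega>)))
      = measure L {\<omega>\<in>space L. \<forall>j\<in>J. Z j \<omega> \<in> A j}"
    if Z: "\<And>j. j \<in> J \<Longrightarrow> Z j \<in> borel_measurable L" for L :: "'c measure" and Z :: "'i \<Rightarrow> 'c \<Rightarrow> real"
  proof -
    have "(\<Prod>j\<in>J. indicator (A j) (Z j \<omega>)) = (indicator {\<omega>\<in>space L. \<forall>j\<in>J. Z j \<omega> \<in> A j} \<omega> :: real)"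
      if "\<omega> \<in> space L" for \<omega>
      using that J by (auto simp: indicator_def prod_zero)
    then have "(CLINT \<omega>|L. complex_of_real (\<Prod>j\<in>J. indicator (A j) (Z j \<omega>)))
        = (CLINT \<omega>|L. complex_of_real (indicator {\<omega>\<in>space L. \<forall>j\<in>J. Z j \<omega> \<in> A j} \<omega>))"
      by (intro Bochner_Integration.integral_cong) (simp_all del: of_real_prod)
    also have "\<dots> = complex_of_real (\<integral>\<omega>. indicator {\<omega>\<in>space L. \<forall>j\<in>J. Z j \<omega> \<in> A j} \<omega> \<partial>L)"
      by (rule integral_complex_of_real)
    also have "\<dots> = measure L {\<omega>\<in>space L. \<forall>j\<in>J. Z j \<omega> \<in> A j}"
      by (simp add: Int_def conj_commute)
    finally show ?thesis .
  qed
  have "complex_of_real (measure M {\<omega>\<in>space M. \<forall>j\<in>J. X j \<omega> \<in> A j})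
      = complex_of_real (measure N {\<omega>\<in>space N. \<forall>j\<in>J. Y j \<omega> \<in> A j})"
    by (rule trans[OF prob[OF X, symmetric] trans[OF * prob[OF Y]]])
  then show ?thesis by (simp only: of_real_eq_iff)
qed

lemma borel_measurable_vec_lambda:
  fixes f :: "'n::finite \<Rightarrow> 'a \<Rightarrow> real"
  assumes "\<And>j. f j \<in> borel_measurable M"
  shows "(\<lambda>x. \<chi> j. f j x) \<in> borel_measurable M"
  using assms unfolding borel_measurable_euclidean_space[where f = "\<lambda>x. \<chi> j. f j x"]
  by (auto simp: Basis_vec_def inner_axis)

lemma borel_measurable_vec_nth:
  fixes f :: "'a \<Rightarrow> real^'n"
  assumes "f \<in> borel_measurable M"
  shows "(\<lambda>x. f x $ j) \<in> borel_measurable M"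
  using assms by (intro borel_measurable_continuous_on[where f = "\<lambda>v. v $ j"] continuous_intros)

text \<open>Vectors are flattened to scalars indexed by pairs of time and component. There the
  measures agree on finite-dimensional boxes, which determine them, and the law on paths is the
  image under the measurable map that reassembles vectors.\<close>

lemma proc_law_eqI:
  fixes X :: "real \<Rightarrow> 'a \<Rightarrow> real^'d" and Y :: "real \<Rightarrow> 'b \<Rightarrow> real^'d"
  assumes "prob_space M" "prob_space N"
    and X: "\<And>t. t \<in> {0..1} \<Longrightarrow> X t \<in> borel_measurable M"
    and Y: "\<And>t. t \<in> {0..1} \<Longrightarrow> Y t \<in> borel_measurable N"
    and eq: "\<And>T u. finite T \<Longrightarrow> T \<subseteq> {0..1} \<Longrightarrow>
       (CLINT \<omega>|M. iexp (\<Sum>t\<in>T. u t \<bullet> X t \<omega>)) = (CLINT \<omega>|N. iexp (\<Sum>t\<in>T. u t \<bullet> Y t \<omega>))"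
  shows "proc_law M X = proc_law N Y"
proof -
  interpret M: prob_space M by fact
  interpret N: prob_space N by fact
  define I where "I = {0..1::real} \<times> (UNIV::'d set)"
  let ?P = "Pi\<^sub>M I (\<lambda>_. borel :: real measure)"
  have c: "(\<lambda>\<omega>. Z (fst i) \<omega> $ snd i) \<in> borel_measurable L"
    if "\<And>t. t \<in> {0..1} \<Longrightarrow> Z t \<in> borel_measurable L" "i \<in> I"
    for L :: "'c measure" and Z :: "real \<Rightarrow> 'c \<Rightarrow> real^'d" and i
    using that by (intro borel_measurable_vec_nth) (auto simp: I_def)
  have m: "(\<lambda>\<omega>. \<lambda>i\<in>I. Z (fst i) \<omega> $ snd i) \<in> measurable L ?P"
    if "\<And>t. t \<in> {0..1} \<Longrightarrow> Z t \<in> borel_measurable L"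
    for L :: "'c measure" and Z :: "real \<Rightarrow> 'c \<Rightarrow> real^'d"
    using c[OF that] by (intro measurable_restrict) auto
  have scalar: "distr M ?P (\<lambda>\<omega>. \<lambda>i\<in>I. X (fst i) \<omega> $ snd i) = distr N ?P (\<lambda>\<omega>. \<lambda>i\<in>I. Y (fst i) \<omega> $ snd i)"
  proof (rule measure_eqI_PiM_infinite)
    show "finite_measure (distr M ?P (\<lambda>\<omega>. \<lambda>i\<in>I. X (fst i) \<omega> $ snd i))"
      by (rule M.finite_measure_distr[OF m[OF X]])
  next
    fix A :: "real \<times> 'd \<Rightarrow> real set" and J
    assume J: "finite J" "J \<subseteq> I" and A: "\<And>i. i \<in> J \<Longrightarrow> A i \<in> sets borel"
    have emb: "emeasure (distr L ?P (\<lambda>\<omega>. \<lambda>i\<in>I. Z (fst i) \<omega> $ snd i)) (prod_emb I (\<lambda>_. borel) J (Pi\<^sub>E J A))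
        = emeasure L {\<omega>\<in>space L. \<forall>i\<in>J. Z (fst i) \<omega> $ snd i \<in> A i}"
      if "\<And>t. t \<in> {0..1} \<Longrightarrow> Z t \<in> borel_measurable L"
      for L :: "'c measure" and Z :: "real \<Rightarrow> 'c \<Rightarrow> real^'d"
    proof -
      have "prod_emb I (\<lambda>_. borel) J (Pi\<^sub>E J A) \<in> sets ?P"
        using J A by (intro sets_PiM_I) auto
      moreover have "(\<lambda>\<omega>. \<lambda>i\<in>I. Z (fst i) \<omega> $ snd i) -` prod_emb I (\<lambda>_. borel) J (Pi\<^sub>E J A) \<inter> space L
          = {\<omega>\<in>space L. \<forall>i\<in>J. (\<lambda>i\<in>I. Z (fst i) \<omega> $ snd i) i \<in> A i}"
        by (auto simp: prod_emb_def PiE_iff restrict_apply' simp del: restrict_apply restrict_restrict cong: ball_cong)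
      moreover have "\<dots> = {\<omega>\<in>space L. \<forall>i\<in>J. Z (fst i) \<omega> $ snd i \<in> A i}"
        using J(2) by (intro Collect_cong conj_cong ball_cong refl) auto
      ultimately show ?thesis using m[OF that] by (subst emeasure_distr) auto
    qed
    have cf: "(CLINT \<omega>|M. iexp (\<Sum>i\<in>J. v i * (X (fst i) \<omega> $ snd i))) = (CLINT \<omega>|N. iexp (\<Sum>i\<in>J. v i * (Y (fst i) \<omega> $ snd i)))" for v
    proof -
      define T where "T = fst ` J"
      \<comment> \<open>Coordinates outside \<open>J\<close> get coefficient zero, so a scalar
        combination over \<open>J\<close> becomes one of inner products over
        \<open>T\<close>.\<close>
      define u where "u t = (\<chi> j. if (t, j) \<in> J then v (t, j) else 0)" for t
      have T: "finite T" "T \<subseteq> {0..1}" using J by (auto simp: T_def I_def)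
      have "(\<Sum>i\<in>J. v i * (Z (fst i) $ snd i)) = (\<Sum>t\<in>T. u t \<bullet> Z t)" for Z :: "real \<Rightarrow> real^'d"
      proof -
        have "(\<Sum>i\<in>J. v i * (Z (fst i) $ snd i)) = (\<Sum>i\<in>T \<times> UNIV. if i \<in> J then v i * (Z (fst i) $ snd i) else 0)"
          using T(1) by (intro sum.mono_neutral_cong_left) (force simp: T_def)+
        also have "\<dots> = (\<Sum>t\<in>T. \<Sum>j\<in>UNIV. (if (t, j) \<in> J then v (t, j) * Z t $ j else 0))"
          by (auto simp: sum.cartesian_product intro!: sum.cong)
        also have "\<dots> = (\<Sum>t\<in>T. u t \<bullet> Z t)"
          by (auto simp: u_def inner_vec_def intro!: sum.cong)
        finally show ?thesis .
      qed
      note * = this[of "\<lambda>t. X t _"] this[of "\<lambda>t. Y t _"]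
      show ?thesis unfolding * by (rule eq[OF T])
    qed
    have "measure M {\<omega>\<in>space M. \<forall>i\<in>J. X (fst i) \<omega> $ snd i \<in> A i}
        = measure N {\<omega>\<in>space N. \<forall>i\<in>J. Y (fst i) \<omega> $ snd i \<in> A i}"
      using J A cf by (intro joint_charfun_eq_imp_prob_eq[OF \<open>prob_space M\<close> \<open>prob_space N\<close>] c X Y) auto
    then show "emeasure (distr M ?P (\<lambda>\<omega>. \<lambda>i\<in>I. X (fst i) \<omega> $ snd i)) (prod_emb I (\<lambda>_. borel) J (Pi\<^sub>E J A))
      = emeasure (distr N ?P (\<lambda>\<omega>. \<lambda>i\<in>I. Y (fst i) \<omega> $ snd i)) (prod_emb I (\<lambda>_. borel) J (Pi\<^sub>E J A))"
      by (intro trans[OF emb[OF X] trans[OF _ emb[OF Y, symmetric]]])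
        (simp_all add: M.emeasure_eq_measure N.emeasure_eq_measure)
  qed simp_all
  define \<Phi> :: "(real \<times> 'd \<Rightarrow> real) \<Rightarrow> real \<Rightarrow> real^'d"
    where "\<Phi> x = (\<lambda>t\<in>{0..1}. \<chi> j. x (t, j))" for x
  have \<Phi>: "\<Phi> \<in> measurable ?P (PiM {0..1} (\<lambda>_. borel))"
    unfolding \<Phi>_def
    by (intro measurable_restrict borel_measurable_vec_lambda measurable_component_singleton) (auto simp: I_def)
  have plaw: "proc_law L Z = distr (distr L ?P (\<lambda>\<omega>. \<lambda>i\<in>I. Z (fst i) \<omega> $ snd i)) (PiM {0..1} (\<lambda>_. borel)) \<Phi>"
    if "\<And>t. t \<in> {0..1} \<Longrightarrow> Z t \<in> borel_measurable L"
    for L :: "'c measure" and Z :: "real \<Rightarrow> 'c \<Rightarrow> real^'d"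
  proof -
    have "(\<lambda>\<omega>. \<lambda>i\<in>I. Z (fst i) \<omega> $ snd i) \<in> measurable L ?P" by (rule m) (rule that)
    from distr_distr[OF \<Phi> this] show ?thesis
      by (auto simp: proc_law_def \<Phi>_def I_def fun_eq_iff vec_eq_iff intro!: distr_cong)
  qed
  show ?thesis
    by (rule trans[OF plaw[OF X] trans[OF _ plaw[OF Y, symmetric]]]) (simp_all only: scalar)
qed

section \<open>Characteristic functions of independent normal sums and of limits\<close>

text \<open>Each factor is the standard normal characteristic function at
  \<open>c i * \<sigma> i\<close>, reached by dividing \<open>Z i\<close> by
  \<open>\<sigma> i\<close>. In this way \<open>c i = 0\<close>, where \<open>c i * Z i\<close> has
  no density, is no exception.\<close>

lemma (in prob_space) charfun_sum_indep_normal: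
  assumes "finite I" and indep: "indep_vars (\<lambda>_. borel) Z I"
    and norm: "\<And>i. i \<in> I \<Longrightarrow> distributed M lborel (Z i) (normal_density 0 (\<sigma> i))"
    and \<sigma>: "\<And>i. i \<in> I \<Longrightarrow> 0 < \<sigma> i"
  shows "(CLINT \<omega>|M. iexp (\<Sum>i\<in>I. c i * Z i \<omega>)) = exp (- (\<Sum>i\<in>I. (c i * \<sigma> i)\<^sup>2) / 2)"
proof -
  have Zm: "Z i \<in> borel_measurable M" if "i \<in> I" for i
    using norm[OF that] by (auto simp: distributed_def)
  have "indep_vars (\<lambda>_. borel) (\<lambda>i \<omega>. c i * Z i \<omega>) I"
    using indep by (rule indep_vars_compose2) simp
  from char_distr_sum[OF this, of 1]
  have "char (distr M borel (\<lambda>\<omega>. \<Sum>i\<in>I. c i * Z i \<omega>)) 1 = (\<Prod>i\<in>I. char (distr M borel (\<lambda>\<omega>. c i * Z i \<omega>)) 1)" .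
  moreover have "char (distr M borel (\<lambda>\<omega>. \<Sum>i\<in>I. c i * Z i \<omega>)) 1 = (CLINT \<omega>|M. iexp (\<Sum>i\<in>I. c i * Z i \<omega>))"
    unfolding char_def using Zm by (subst integral_distr) auto
  moreover have "char (distr M borel (\<lambda>\<omega>. c i * Z i \<omega>)) 1 = exp (- (c i * \<sigma> i)\<^sup>2 / 2)" if i: "i \<in> I" for i
  proof -
    have "distributed M lborel (\<lambda>\<omega>. (Z i \<omega> - 0) / \<sigma> i) std_normal_density"
      using norm[OF i] \<sigma>[OF i] by (subst normal_standard_normal_convert[symmetric]) auto
    then have "distr M borel (\<lambda>\<omega>. Z i \<omega> / \<sigma> i) = std_normal_distribution"
      unfolding distributed_def by (simp cong: distr_cong)
    then have "exp (- ((c i * \<sigma> i)\<^sup>2) / 2) = char (distr M borel (\<lambda>\<omega>. Z i \<omega> / \<sigma> i)) (c i * \<sigma> i)"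
      by (simp add: char_std_normal_distribution)
    also have "\<dots> = (CLINT \<omega>|M. iexp ((c i * \<sigma> i) * (Z i \<omega> / \<sigma> i)))"
      unfolding char_def using Zm[OF i] by (subst integral_distr) auto
    also have "\<dots> = (CLINT \<omega>|M. iexp (1 * (c i * Z i \<omega>)))"
      using \<sigma>[OF i] by (intro Bochner_Integration.integral_cong) (auto simp: field_simps)
    also have "\<dots> = char (distr M borel (\<lambda>\<omega>. c i * Z i \<omega>)) 1"
      unfolding char_def using Zm[OF i] by (subst integral_distr) auto
    finally show ?thesis by simp
  qed
  ultimately have "(CLINT \<omega>|M. iexp (\<Sum>i\<in>I. c i * Z i \<omega>)) = (\<Prod>i\<in>I. complex_of_real (exp (- (c i * \<sigma> i)\<^sup>2 / 2)))"
    by simp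
  also have "\<dots> = exp (\<Sum>i\<in>I. - (c i * \<sigma> i)\<^sup>2 / 2)"
    using \<open>finite I\<close> by (simp add: exp_sum)
  finally show ?thesis by (simp add: sum_negf sum_divide_distrib)
qed

lemma (in prob_space) charfun_tendsto_AE:
  assumes "\<And>n. Z n \<in> borel_measurable M" "Z' \<in> borel_measurable M"
    and "AE \<omega> in M. (\<lambda>n. Z n \<omega>) \<longlonglongrightarrow> Z' \<omega>"
  shows "(\<lambda>n. CLINT \<omega>|M. iexp (Z n \<omega>)) \<longlonglongrightarrow> (CLINT \<omega>|M. iexp (Z' \<omega>))"
proof (rule integral_dominated_convergence[where w = "\<lambda>_. 1"])
  show "AE \<omega> in M. (\<lambda>n. iexp (Z n \<omega>)) \<longlonglongrightarrow> iexp (Z' \<omega>)"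
    using assms(3) by eventually_elim (intro tendsto_intros)
qed (use assms in auto)

lemma iexp_diff_le: "cmod (iexp x - iexp y) \<le> \<bar>x - y\<bar>"
proof -
  have "iexp x - iexp y = iexp y * (iexp (x - y) - 1)"
    using iexp_add[of y "x - y"] by (simp add: algebra_simps)
  then show ?thesis
    using iexp_approx1[of "x - y" 0] by (simp add: norm_mult)
qed

text \<open>\<open>iexp\<close> is bounded and 1-Lipschitz: off the exceptional sets the integrands
  differ by at most \<open>C * e\<close>, and on them by at most 2, while their probabilities tend
  to zero.\<close>

lemma (in prob_space) charfun_tendsto_in_prob:
  fixes Z :: "nat \<Rightarrow> 'k \<Rightarrow> 'a \<Rightarrow> real^'n"
  assumes "finite K"
    and [measurable]: "\<And>n k. k \<in> K \<Longrightarrow> Z n k \<in> borel_measurable M" "\<And>k. k \<in> K \<Longrightarrow> Z' k \<in> borel_measurable M"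
    and lim: "\<And>k e. k \<in> K \<Longrightarrow> e > 0 \<Longrightarrow> (\<lambda>n. prob {\<omega>\<in>space M. e < norm (Z n k \<omega> - Z' k \<omega>)}) \<longlonglongrightarrow> 0"
  shows "(\<lambda>n. CLINT \<omega>|M. iexp (\<Sum>k\<in>K. c k \<bullet> Z n k \<omega>)) \<longlonglongrightarrow> (CLINT \<omega>|M. iexp (\<Sum>k\<in>K. c k \<bullet> Z' k \<omega>))"
proof -
  let ?S = "\<lambda>n \<omega>. \<Sum>k\<in>K. c k \<bullet> Z n k \<omega>" and ?S' = "\<lambda>\<omega>. \<Sum>k\<in>K. c k \<bullet> Z' k \<omega>"
  let ?B = "\<lambda>e n k. {\<omega>\<in>space M. e < norm (Z n k \<omega> - Z' k \<omega>)}"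
  define C where "C = (\<Sum>k\<in>K. norm (c k))"
  have C: "C \<ge> 0" unfolding C_def by (intro sum_nonneg) auto
  have Bm [measurable]: "?B e n k \<in> sets M" if "k \<in> K" for e n k
    using that by measurable
  have bound: "norm ((CLINT \<omega>|M. iexp (?S n \<omega>)) - (CLINT \<omega>|M. iexp (?S' \<omega>)))
      \<le> C * e + 2 * (\<Sum>k\<in>K. prob (?B e n k))" if e: "e > 0" for e n
  proof -
    have pt: "norm (iexp (?S n \<omega>) - iexp (?S' \<omega>)) \<le> C * e + 2 * (\<Sum>k\<in>K. indicator (?B e n k) \<omega>)"
      if "\<omega> \<in> space M" for \<omega>
    proof (cases "\<exists>k\<in>K. \<omega> \<in> ?B e n k")
      case True
      then obtain k where k: "k \<in> K" "\<omega> \<in> ?B e n k" by blast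
      have "1 \<le> (\<Sum>k\<in>K. indicator (?B e n k) \<omega> :: real)"
        using member_le_sum[of k K "\<lambda>k. indicator (?B e n k) \<omega> :: real"] k \<open>finite K\<close> by simp
      moreover have "norm (iexp (?S n \<omega>) - iexp (?S' \<omega>)) \<le> 1 + 1"
        by (rule norm_triangle_ineq4[THEN order_trans]) (simp only: norm_iexp)
      moreover have "0 \<le> C * e" using C e by simp
      ultimately show ?thesis by linarith
    next
      case False
      then have le: "norm (Z n k \<omega> - Z' k \<omega>) \<le> e" if "k \<in> K" for k
        using that \<open>\<omega> \<in> space M\<close> by (auto simp: not_less)
      have "norm (iexp (?S n \<omega>) - iexp (?S' \<omega>)) \<le> \<bar>?S n \<omega> - ?S' \<omega>\<bar>"
        by (rule iexp_diff_le)
      also have "\<dots> = \<bar>\<Sum>k\<in>K. c k \<bullet> (Z n k \<omega> - Z' k \<omega>)\<bar>"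
        by (simp add: inner_diff_right sum_subtractf)
      also have "\<dots> \<le> (\<Sum>k\<in>K. norm (c k) * e)"
        using le by (intro order_trans[OF sum_abs] sum_mono order_trans[OF Cauchy_Schwarz_ineq2] mult_left_mono) auto
      also have "\<dots> = C * e" by (simp add: C_def sum_distrib_right)
      also have "\<dots> \<le> C * e + 2 * (\<Sum>k\<in>K. indicator (?B e n k) \<omega>)"
        by (simp add: sum_nonneg)
      finally show ?thesis .
    qed
    have int: "integrable M (\<lambda>\<omega>. iexp (?S n \<omega>))" "integrable M (\<lambda>\<omega>. iexp (?S' \<omega>))"
    proof -
      have [measurable]: "?S n \<in> borel_measurable M" "?S' \<in> borel_measurable M"
        using assms(2,3) by (auto intro!: borel_measurable_sum borel_measurable_inner)
      show "integrable M (\<lambda>\<omega>. iexp (?S n \<omega>))" "integrable M (\<lambda>\<omega>. iexp (?S' \<omega>))"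
        by (auto intro!: integrable_bounded[of _ 1] simp only: norm_iexp order_refl; measurable)+
    qed
    have intB: "integrable M (\<lambda>\<omega>. indicator (?B e n k) \<omega> :: real)" if "k \<in> K" for k
      using Bm[OF that] by (intro integrable_real_indicator) (auto simp: less_top[symmetric])
    have "norm ((CLINT \<omega>|M. iexp (?S n \<omega>)) - (CLINT \<omega>|M. iexp (?S' \<omega>)))
        = norm (CLINT \<omega>|M. iexp (?S n \<omega>) - iexp (?S' \<omega>))"
      using int by simp
    also have "\<dots> \<le> (\<integral>\<omega>. norm (iexp (?S n \<omega>) - iexp (?S' \<omega>)) \<partial>M)" by simp
    also have "\<dots> \<le> (\<integral>\<omega>. C * e + 2 * (\<Sum>k\<in>K. indicator (?B e n k) \<omega>) \<partial>M)"
    proof (rule integral_mono)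
      show "integrable M (\<lambda>\<omega>. norm (iexp (?S n \<omega>) - iexp (?S' \<omega>)))"
        using int by (intro integrable_norm Bochner_Integration.integrable_diff)
      show "integrable M (\<lambda>\<omega>. C * e + 2 * (\<Sum>k\<in>K. indicator (?B e n k) \<omega>))"
        using intB by (intro Bochner_Integration.integrable_add integrable_mult_right Bochner_Integration.integrable_sum) auto
    qed (rule pt)
    also have "\<dots> = C * e + 2 * (\<Sum>k\<in>K. prob (?B e n k))"
    proof -
      have "(\<integral>\<omega>. C * e + 2 * (\<Sum>k\<in>K. indicator (?B e n k) \<omega>) \<partial>M)
          = C * e + 2 * (\<Sum>k\<in>K. \<integral>\<omega>. indicator (?B e n k) \<omega> \<partial>M)"
        using intB by (simp add: prob_space)
      moreover have "(\<integral>\<omega>. indicator (?B e n k) \<omega> \<partial>M) = prob (?B e n k)" if "k \<in> K" for k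
        using Bm[OF that] by (simp add: Int_absorb2 sets.sets_into_space)
      ultimately show ?thesis by simp
    qed
    finally show ?thesis .
  qed
  show ?thesis
  proof (rule LIMSEQ_I)
    fix r :: real assume r: "r > 0"
    \<comment> \<open>Adding 1 to \<open>C\<close> covers the case in which all \<open>c k\<close>
      vanish.\<close>
    define e where "e = r / (2 * (C + 1))"
    have e: "e > 0" "C * e < r"
      using r C by (auto simp: e_def field_simps intro: add_nonneg_pos)
    have "(\<lambda>n. C * e + 2 * (\<Sum>k\<in>K. prob (?B e n k))) \<longlonglongrightarrow> C * e + 2 * (\<Sum>k\<in>K. 0)"
      by (intro tendsto_intros lim e)
    then have "\<forall>\<^sub>F n in sequentially. C * e + 2 * (\<Sum>k\<in>K. prob (?B e n k)) < r"
      using e(2) by (intro order_tendstoD(2)[where y = "C * e"]) auto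
    then obtain n0 where "\<And>n. n \<ge> n0 \<Longrightarrow> C * e + 2 * (\<Sum>k\<in>K. prob (?B e n k)) < r"
      unfolding eventually_sequentially by blast
    with bound[OF e(1)]
    show "\<exists>n0. \<forall>n\<ge>n0. norm ((CLINT \<omega>|M. iexp (?S n \<omega>)) - (CLINT \<omega>|M. iexp (?S' \<omega>))) < r"
      by (meson le_less_trans)
  qed
qed

section \<open>Wiener integrals of step functions\<close>

text \<open>As \<open>q\<close> is itself a grid point, the cells ending by \<open>q\<close> form an
  initial segment of the grid. It is applied to paths of \<open>W\<close> and, for variances, to the
  identity function.\<close>

lemma sum_increments_upto:
  fixes f :: "real \<Rightarrow> 'v::ab_group_add"
  assumes "sorted_wrt (<) ts" "q \<in> set ts"
  shows "(\<Sum>k<length ts - 1. if ts ! Suc k \<le> q then f (ts ! Suc k) - f (ts ! k) else 0) = f q - f (ts ! 0)"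
proof -
  obtain p where p: "p < length ts" "q = ts ! p"
    using assms(2) by (auto simp: in_set_conv_nth)
  have "ts ! Suc k \<le> q \<longleftrightarrow> k < p" if "k < length ts - 1" for k
    using sorted_wrt_nth_less[OF assms(1), of p "Suc k"] sorted_wrt_nth_less[OF assms(1), of "Suc k" p] p that
    by (metis Suc_lessI Suc_less_eq less_diff_conv linorder_not_less not_less_eq order_le_less plus_1_eq_Suc add.commute)
  then have "(\<Sum>k<length ts - 1. if ts ! Suc k \<le> q then f (ts ! Suc k) - f (ts ! k) else 0)
      = (\<Sum>k<length ts - 1. if k < p then f (ts ! Suc k) - f (ts ! k) else 0)"
    by (intro sum.cong) auto
  also have "\<dots> = (\<Sum>k<p. f (ts ! Suc k) - f (ts ! k))"
    using p by (intro sum.mono_neutral_cong_right) auto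
  also have "\<dots> = f q - f (ts ! 0)"
    using sum_lessThan_telescope[of "\<lambda>k. f (ts ! k)" p] p by simp
  finally show ?thesis .
qed

text \<open>The Wiener covariance \<open>min (q i) (q j)\<close> is the \<open>L^2\<close> inner
  product of the indicators of \<open>(0, q i]\<close> and \<open>(0, q j]\<close>.\<close>

lemma sum_min_eq_integral_norm_sq:
  fixes b :: "'i \<Rightarrow> 'v::real_inner"
  assumes "finite I" "\<And>i. i \<in> I \<Longrightarrow> 0 \<le> q i"
  shows "(\<integral>s. (norm (\<Sum>i\<in>I. if 0 < s \<and> s \<le> q i then b i else 0))\<^sup>2 \<partial>lborel)
      = (\<Sum>i\<in>I. \<Sum>j\<in>I. (b i \<bullet> b j) * min (q i) (q j))"
proof -
  have "(norm (\<Sum>i\<in>I. if 0 < s \<and> s \<le> q i then b i else 0))\<^sup>2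
      = (\<Sum>i\<in>I. \<Sum>j\<in>I. (b i \<bullet> b j) * indicator {0<..min (q i) (q j)} s)" for s
    by (auto simp: power2_norm_eq_inner inner_sum_left inner_sum_right indicator_def intro!: sum.cong inner_commute)
  then have "(\<integral>s. (norm (\<Sum>i\<in>I. if 0 < s \<and> s \<le> q i then b i else 0))\<^sup>2 \<partial>lborel)
      = (\<integral>s. (\<Sum>i\<in>I. \<Sum>j\<in>I. (b i \<bullet> b j) * indicator {0<..min (q i) (q j)} s) \<partial>lborel)"
    by simp
  also have "\<dots> = (\<Sum>i\<in>I. \<Sum>j\<in>I. (b i \<bullet> b j) * (\<integral>s. indicator {0<..min (q i) (q j)} s \<partial>lborel))"
  proof -
    have int: "integrable lborel (\<lambda>s. c * indicator {0<..m} s)" for c m :: real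
      by (cases "0 \<le> m") (auto intro!: integrable_mult_right integrable_real_indicator)
    show ?thesis
      by (subst Bochner_Integration.integral_sum, intro Bochner_Integration.integrable_sum int,
          intro sum.cong refl, subst Bochner_Integration.integral_sum, rule int,
          intro sum.cong refl integral_mult_right_zero)
  qed
  also have "\<dots> = (\<Sum>i\<in>I. \<Sum>j\<in>I. (b i \<bullet> b j) * min (q i) (q j))"
    using assms(2) by (auto intro!: sum.cong)
  finally show ?thesis .
qed

text \<open>This is the Ito isometry in characteristic-function form: the exponent is the squared
  norm of the step function whose Wiener integral is the given combination. Sorting the distinct
  times reduces the claim to independent normal increments.\<close>

lemma wiener_charfun:
  fixes W :: "real \<Rightarrow> 'a \<Rightarrow> real^'m" and q :: "'i \<Rightarrow> real"
  assumes W: "std_wiener M W" and I: "finite I" and q: "\<And>i. i \<in> I \<Longrightarrow> q i \<in> {0..1}"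
  shows "(CLINT \<omega>|M. iexp (\<Sum>i\<in>I. b i \<bullet> W (q i) \<omega>))
      = exp (- (\<integral>s. (norm (\<Sum>i\<in>I. if 0 < s \<and> s \<le> q i then b i else 0))\<^sup>2 \<partial>lborel) / 2)"
proof -
  interpret prob_space M using W by (simp add: std_wiener_def)
  \<comment> \<open>Time 0 is adjoined because each \<open>W (q i)\<close> is written as a sum of
    increments starting at 0, where \<open>W\<close> vanishes almost surely.\<close>
  define P where "P = insert 0 (q ` I)"
  define ts where "ts = sorted_list_of_set P"
  have P: "finite P" "P \<subseteq> {0..1}" using I q by (auto simp: P_def)
  have ts: "sorted_wrt (<) ts" "set ts = P"
    using P by (auto simp: ts_def)
  have ts01: "set ts \<subseteq> {0..1}" using ts P by simp
  have ts_ne: "0 < length ts" using ts(2) by (auto simp: P_def)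
  have ts0: "ts ! 0 = 0"
  proof -
    have "0 \<in> set ts" using ts by (simp add: P_def)
    then obtain p where p: "p < length ts" "ts ! p = 0" by (auto simp: in_set_conv_nth)
    have "ts ! 0 \<in> {0..1}" using ts01 ts_ne nth_mem by blast
    then show ?thesis
      using sorted_wrt_nth_less[OF ts(1), of 0 p] p by (cases "p = 0") auto
  qed
  define n where "n = length ts - 1"
  define D where "D = (\<lambda>(i,j) \<omega>. W (ts ! Suc i) \<omega> $ j - W (ts ! i) \<omega> $ j)"
  have norm: "distributed M lborel (D (i, j)) (normal_density 0 (sqrt (ts ! Suc i - ts ! i)))" if "i < n" for i j
    using W ts(1) ts01 that unfolding std_wiener_def D_def n_def by auto
  have indep: "indep_vars (\<lambda>_. borel) D ({..<n} \<times> UNIV)"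
    using W ts(1) ts01 unfolding std_wiener_def D_def n_def by blast
  have less: "ts ! k < ts ! Suc k" if "k < n" for k
    using sorted_wrt_nth_less[OF ts(1), of k "Suc k"] that by (auto simp: n_def)
  \<comment> \<open>Summation by parts: an increment is picked up by every \<open>b i\<close> whose
    time lies at or beyond the end of its cell.\<close>
  define a where "a k = (\<Sum>i\<in>I. if ts ! Suc k \<le> q i then b i else 0)" for k
  have qts: "q i \<in> set ts" if "i \<in> I" for i using that ts by (simp add: P_def)
  have sumW: "(\<Sum>i\<in>I. b i \<bullet> W (q i) \<omega>) = (\<Sum>x\<in>{..<n} \<times> UNIV. a (fst x) $ snd x * D x \<omega>)"
    if "W 0 \<omega> = 0" for \<omega>
  proof -
    have "(\<Sum>i\<in>I. b i \<bullet> W (q i) \<omega>) = (\<Sum>i\<in>I. b i \<bullet> (W (q i) \<omega> - W (ts ! 0) \<omega>))"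
      by (simp add: ts0 that)
    also have "\<dots> = (\<Sum>i\<in>I. \<Sum>k<n. b i \<bullet> (if ts ! Suc k \<le> q i then W (ts ! Suc k) \<omega> - W (ts ! k) \<omega> else 0))"
      unfolding n_def
      by (intro sum.cong refl) (simp add: sum_increments_upto[OF ts(1) qts, of _ "\<lambda>t. W t \<omega>", symmetric] inner_sum_right)
    also have "\<dots> = (\<Sum>k<n. \<Sum>i\<in>I. b i \<bullet> (if ts ! Suc k \<le> q i then W (ts ! Suc k) \<omega> - W (ts ! k) \<omega> else 0))"
      by (rule sum.swap)
    also have "\<dots> = (\<Sum>k<n. a k \<bullet> (W (ts ! Suc k) \<omega> - W (ts ! k) \<omega>))"
      by (auto simp: a_def inner_sum_left intro!: sum.cong)
    also have "\<dots> = (\<Sum>k<n. \<Sum>j\<in>UNIV. a k $ j * D (k, j) \<omega>)"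
      by (simp add: inner_vec_def D_def)
    also have "\<dots> = (\<Sum>x\<in>{..<n} \<times> UNIV. a (fst x) $ snd x * D x \<omega>)"
      by (auto simp: sum.cartesian_product intro!: sum.cong)
    finally show ?thesis .
  qed
  have W0: "AE \<omega> in M. W 0 \<omega> = 0" using W by (simp add: std_wiener_def)
  have Wm: "W t \<in> borel_measurable M" if "t \<in> {0..1}" for t
    using W that by (simp add: std_wiener_def)
  have Dm: "D x \<in> borel_measurable M" if "x \<in> {..<n} \<times> UNIV" for x
    using norm[of "fst x" "snd x"] that by (auto simp: distributed_def)
  have "(CLINT \<omega>|M. iexp (\<Sum>i\<in>I. b i \<bullet> W (q i) \<omega>))
      = (CLINT \<omega>|M. iexp (\<Sum>x\<in>{..<n} \<times> UNIV. a (fst x) $ snd x * D x \<omega>))"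
  proof (rule integral_cong_AE)
    have [measurable]: "(\<lambda>\<omega>. \<Sum>i\<in>I. b i \<bullet> W (q i) \<omega>) \<in> borel_measurable M"
      using Wm q by (intro borel_measurable_sum borel_measurable_inner) auto
    show "(\<lambda>\<omega>. iexp (\<Sum>i\<in>I. b i \<bullet> W (q i) \<omega>)) \<in> borel_measurable M" by measurable
    have [measurable]: "(\<lambda>\<omega>. \<Sum>x\<in>{..<n} \<times> UNIV. a (fst x) $ snd x * D x \<omega>) \<in> borel_measurable M"
      using Dm by (intro borel_measurable_sum borel_measurable_times) auto
    show "(\<lambda>\<omega>. iexp (\<Sum>x\<in>{..<n} \<times> UNIV. a (fst x) $ snd x * D x \<omega>)) \<in> borel_measurable M" by measurable
    show "AE \<omega> in M. iexp (\<Sum>i\<in>I. b i \<bullet> W (q i) \<omega>) = iexp (\<Sum>x\<in>{..<n} \<times> UNIV. a (fst x) $ snd x * D x \<omega>)"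
      using W0 by eventually_elim (simp only: sumW)
  qed
  also have "\<dots> = exp (- (\<Sum>x\<in>{..<n} \<times> UNIV. (a (fst x) $ snd x * sqrt (ts ! Suc (fst x) - ts ! fst x))\<^sup>2) / 2)"
    using less norm by (intro charfun_sum_indep_normal indep) auto
  also have "(\<Sum>x\<in>{..<n} \<times> UNIV. (a (fst x) $ snd x * sqrt (ts ! Suc (fst x) - ts ! fst x))\<^sup>2)
      = (\<Sum>k<n. \<Sum>j\<in>UNIV. (a k $ j * sqrt (ts ! Suc k - ts ! k))\<^sup>2)"
    by (auto simp: sum.cartesian_product intro!: sum.cong)
  also have "\<dots> = (\<Sum>k<n. (a k \<bullet> a k) * (ts ! Suc k - ts ! k))"
    using less[THEN less_imp_le]
    by (auto simp: inner_vec_def power_mult_distrib sum_distrib_right power2_eq_square[of "_ $ _"] intro!: sum.cong)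
  also have "\<dots> = (\<Sum>k<n. \<Sum>i\<in>I. \<Sum>j\<in>I. (b i \<bullet> b j) * (if ts ! Suc k \<le> min (q i) (q j) then ts ! Suc k - ts ! k else 0))"
    by (auto simp: a_def inner_sum_left inner_sum_right sum_distrib_right intro!: sum.cong inner_commute)
  also have "\<dots> = (\<Sum>i\<in>I. \<Sum>j\<in>I. \<Sum>k<n. (b i \<bullet> b j) * (if ts ! Suc k \<le> min (q i) (q j) then ts ! Suc k - ts ! k else 0))"
    by (subst sum.swap) (intro sum.cong refl sum.swap)
  also have "\<dots> = (\<Sum>i\<in>I. \<Sum>j\<in>I. (b i \<bullet> b j) * min (q i) (q j))"
  proof (intro sum.cong refl)
    fix i j assume "i \<in> I" "j \<in> I"
    then have "min (q i) (q j) \<in> set ts" using qts by (simp add: min_def)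
    from sum_increments_upto[OF ts(1) this, of "\<lambda>t. t"] ts0
    show "(\<Sum>k<n. (b i \<bullet> b j) * (if ts ! Suc k \<le> min (q i) (q j) then ts ! Suc k - ts ! k else 0)) = (b i \<bullet> b j) * min (q i) (q j)"
      by (simp add: n_def sum_distrib_left[symmetric])
  qed
  also have "\<dots> = (\<integral>s. (norm (\<Sum>i\<in>I. if 0 < s \<and> s \<le> q i then b i else 0))\<^sup>2 \<partial>lborel)"
    using I q by (intro sum_min_eq_integral_norm_sq[symmetric]) auto
  finally show ?thesis .
qed

text \<open>The grids \<open>i t / 2^n\<close> depend on \<open>t\<close>, so a linear combination of increments is rewritten as
one of values; the variance formula is insensitive to repeated or unordered times.\<close>
lemma dyadic_increments_eq:
  fixes v :: "'k \<Rightarrow> nat \<Rightarrow> 'v::real_inner"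
  shows "(\<Sum>k\<in>K. \<Sum>i<2^n. v k i \<bullet> (Y (real (Suc i) * t k / 2^n) - Y (real i * t k / 2^n)))
    = (\<Sum>(k,i,e)\<in>K \<times> {..<2^n} \<times> UNIV. (if e then v k i else - v k i) \<bullet> Y (real (if e then Suc i else i) * t k / 2^n))"
  by (simp add: sum.cartesian_product[symmetric] UNIV_bool inner_diff_right)

text \<open>The integrand belonging to the rewritten combination: the indicator of
  \<open>(0, p']\<close> minus that of \<open>(0, p]\<close> is that of the cell
  \<open>(p, p']\<close>. The odd map \<open>L\<close> leaves room for the transposed noise
  coefficient.\<close>

lemma dyadic_increments_step:
  fixes v :: "'k \<Rightarrow> nat \<Rightarrow> 'v::real_vector" and L :: "'v \<Rightarrow> 'w::ab_group_add"
  assumes t: "\<And>k. k \<in> K \<Longrightarrow> 0 \<le> t k" and L: "\<And>x. L (- x) = - L x"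
  shows "(\<Sum>(k,i,e)\<in>K \<times> {..<2^n} \<times> UNIV. if 0 < s \<and> s \<le> real (if e then Suc i else i) * t k / 2^n
            then L (if e then v k i else - v k i) else 0)
    = (\<Sum>k\<in>K. \<Sum>i<2^n. if real i * t k / 2^n < s \<and> s \<le> real (Suc i) * t k / 2^n then L (v k i) else 0)"
proof -
  have "(if 0 < s \<and> s \<le> real (Suc i) * t k / 2^n then L (v k i) else 0) +
      (if 0 < s \<and> s \<le> real i * t k / 2^n then L (- v k i) else 0)
      = (if real i * t k / 2^n < s \<and> s \<le> real (Suc i) * t k / 2^n then L (v k i) else 0)" if "k \<in> K" for k i
  proof -
    have "0 \<le> real i * t k / 2^n" "real i * t k / 2^n \<le> real (Suc i) * t k / 2^n"
      using t[OF that] by (auto simp: divide_right_mono mult_right_mono)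
    then show ?thesis by (auto simp: L)
  qed
  then show ?thesis
    by (simp add: sum.cartesian_product[symmetric] UNIV_bool cong: if_cong sum.cong) (simp add: add.commute cong: sum.cong)
qed

lemma dyadic_cell:
  assumes "0 < s" "s \<le> t"
  obtains i0 where "i0 < 2^n" "\<And>i. real i * t / 2^n < s \<and> s \<le> real (Suc i) * t / 2^n \<longleftrightarrow> i = i0"
proof -
  define x where "x = s * 2^n / t"
  have x: "0 < x" "x \<le> 2^n" using assms by (auto simp: x_def field_simps)
  \<comment> \<open>In units of the mesh, cell \<open>i\<close> is \<open>(i, i + 1]\<close>, so the
    cell of \<open>x\<close> ends at the ceiling of \<open>x\<close>.\<close>
  define i0 where "i0 = nat \<lceil>x\<rceil> - 1"
  have c: "\<lceil>x\<rceil> \<ge> 1" "\<lceil>x\<rceil> \<le> 2^n" using x by (auto simp: ceiling_le_iff le_ceiling_iff)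
  have iff: "real i * t / 2^n < s \<and> s \<le> real (Suc i) * t / 2^n \<longleftrightarrow> i = i0" for i
  proof -
    have "real i * t / 2^n < s \<and> s \<le> real (Suc i) * t / 2^n \<longleftrightarrow> real i < x \<and> x \<le> real (Suc i)"
      using assms by (simp add: x_def field_simps)
    also have "\<dots> \<longleftrightarrow> \<lceil>x\<rceil> = int i + 1"
      by (auto simp: ceiling_eq_iff)
    also have "\<dots> \<longleftrightarrow> i = i0"
    proof -
      define z where "z = \<lceil>x\<rceil>"
      have "1 \<le> z" using c(1) by (simp only: z_def)
      then show ?thesis unfolding i0_def z_def[symmetric] by linarith
    qed
    finally show ?thesis .
  qed
  have "int i0 = \<lceil>x\<rceil> - 1"
  proof -
    define z where "z = \<lceil>x\<rceil>"
    have "1 \<le> z" using c(1) by (simp only: z_def)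
    then show ?thesis unfolding i0_def z_def[symmetric] by linarith
  qed
  then have "int i0 < 2^n" using c(2) by (simp only:)
  then have "int i0 < int (2^n)" by simp
  then have "i0 < 2^n" by (simp only: of_nat_less_iff)
  then show ?thesis using iff that by blast
qed

lemma not_in_dyadic_cell:
  assumes "\<not> (0 < s \<and> s \<le> t)" "0 \<le> t" "i < 2^n"
  shows "\<not> (real i * t / 2^n < s \<and> s \<le> real (Suc i) * t / 2^n)"
proof -
  have "real (Suc i) \<le> real (2^n)" using assms(3) by (simp only: of_nat_le_iff Suc_le_eq)
  then have "real (Suc i) * t \<le> 2^n * t" using assms by (intro mult_right_mono) auto
  then have "real (Suc i) * t / 2^n \<le> t" by (simp add: divide_le_eq mult.commute)
  moreover have "0 \<le> real i * t / 2^n" using assms by simp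
  ultimately show ?thesis using assms(1) by linarith
qed

text \<open>The tag of a cell is its left (\<open>e = 0\<close>) or right (\<open>e = 1\<close>) end point.\<close>
lemma dyadic_step_tendsto:
  fixes \<phi> :: "real \<Rightarrow> 'v::real_normed_vector"
  assumes \<phi>: "continuous_on {0..1} \<phi>" and t: "t \<in> {0..1}" and e: "e \<le> (1::nat)"
  shows "(\<lambda>n. \<Sum>i<2^n. if real i * t / 2^n < s \<and> s \<le> real (Suc i) * t / 2^n then \<phi> (real (i + e) * t / 2^n) else 0)
     \<longlonglongrightarrow> (if 0 < s \<and> s \<le> t then \<phi> s else 0)"
proof (cases "0 < s \<and> s \<le> t")
  case True
  then have s: "0 < s" "s \<le> t" by auto
  have "\<exists>i0. i0 < 2^n \<and> (\<forall>i. real i * t / 2^n < s \<and> s \<le> real (Suc i) * t / 2^n \<longleftrightarrow> i = i0)" for n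
    using dyadic_cell[OF s, of n] by metis
  then obtain i0 where i0: "\<And>n. i0 n < 2^n"
    "\<And>n i. real i * t / 2^n < s \<and> s \<le> real (Suc i) * t / 2^n \<longleftrightarrow> i = i0 n" by metis
  let ?\<tau> = "\<lambda>n. real (i0 n + e) * t / 2^n"
  have eq: "(\<Sum>i<2^n. if real i * t / 2^n < s \<and> s \<le> real (Suc i) * t / 2^n then \<phi> (real (i + e) * t / 2^n) else 0) = \<phi> (?\<tau> n)" for n
    unfolding i0(2) using i0(1) by (simp add: sum.delta)
  have cell: "real (i0 n) * t / 2^n < s" "s \<le> real (Suc (i0 n)) * t / 2^n" for n
    using i0(2)[of "i0 n" n] by auto
  have le: "\<bar>?\<tau> n - s\<bar> \<le> t * (1/2)^n" for n
  proof -
    have a: "real (Suc (i0 n)) * t / 2^n = real (i0 n) * t / 2^n + t / 2^n"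
      by (simp add: distrib_right add_divide_distrib)
    have b: "t * (1/2)^n = t / 2^n" by (simp add: power_one_over field_simps)
    have "?\<tau> n = real (i0 n) * t / 2^n \<or> ?\<tau> n = real (Suc (i0 n)) * t / 2^n"
    proof (cases e)
      case 0
      then show ?thesis by (intro disjI1) (simp only: add_0_right)
    next
      case (Suc e')
      with e have "i0 n + e = Suc (i0 n)" by simp
      then show ?thesis by (intro disjI2) (simp only:)
    qed
    moreover have "\<bar>x - s\<bar> \<le> d" if "y < s" "s \<le> y + d" "x = y \<or> x = y + d" for x y d :: real
      using that by auto
    ultimately show ?thesis
      using cell[of n] unfolding a b by blast
  qed
  have "\<forall>n. norm (?\<tau> n - s) \<le> t * (1/2)^n"
    unfolding real_norm_def by (intro allI le)
  moreover have "(\<lambda>n. t * (1/2::real)^n) \<longlonglongrightarrow> 0"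
    by (rule tendsto_mult_right_zero) (simp add: LIMSEQ_power_zero)
  ultimately have "(\<lambda>n. ?\<tau> n - s) \<longlonglongrightarrow> 0"
    by (rule Lim_null_comparison[OF always_eventually])
  then have lim: "?\<tau> \<longlonglongrightarrow> s" by (rule LIM_zero_cancel)
  have "?\<tau> n \<in> {0..1}" for n
  proof -
    have "real (i0 n + e) \<le> 2^n"
    proof -
      have "i0 n + e \<le> 2^n" using i0(1)[of n] e by linarith
      then have "real (i0 n + e) \<le> real (2^n)" by (simp only: of_nat_le_iff)
      then show ?thesis by simp
    qed
    then have "real (i0 n + e) * t \<le> 2^n * 1"
      using t by (intro mult_mono) auto
    then show ?thesis using t by (auto simp: divide_le_eq)
  qed
  then have "(\<lambda>n. \<phi> (?\<tau> n)) \<longlonglongrightarrow> \<phi> s"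
    using s t lim by (intro continuous_on_tendsto_compose[OF \<phi>]) auto
  then show ?thesis using True unfolding eq by simp
next
  case False
  then have "\<not> (real i * t / 2^n < s \<and> s \<le> real (Suc i) * t / 2^n)" if "i < 2^n" for i n
    using that t by (intro not_in_dyadic_cell) auto
  then have "(\<Sum>i<2^n. if real i * t / 2^n < s \<and> s \<le> real (Suc i) * t / 2^n then \<phi> (real (i + e) * t / 2^n) else 0) = 0" for n
    by (intro sum.neutral) auto
  then show ?thesis unfolding if_not_P[OF False] by (simp only: tendsto_const)
qed

text \<open>At most one summand is nonzero, since the half-open cells are disjoint; hence the bound
  does not grow with the number of cells and can dominate the limit.\<close>

lemma norm_dyadic_step_le:
  fixes \<phi> :: "nat \<Rightarrow> 'v::real_normed_vector"
  assumes B: "0 \<le> B" "\<And>i. i < 2^n \<Longrightarrow> norm (\<phi> i) \<le> B" and t: "0 \<le> t"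
  shows "norm (\<Sum>i<2^n. if real i * t / 2^n < s \<and> s \<le> real (Suc i) * t / 2^n then \<phi> i else 0) \<le> B"
proof (cases "0 < s \<and> s \<le> t")
  case True
  then obtain i0 where i0: "i0 < 2^n" "\<And>i. real i * t / 2^n < s \<and> s \<le> real (Suc i) * t / 2^n \<longleftrightarrow> i = i0"
    using dyadic_cell by metis
  then show ?thesis unfolding i0(2) using i0(1) B by (simp add: sum.delta)
next
  case False
  then have "\<not> (real i * t / 2^n < s \<and> s \<le> real (Suc i) * t / 2^n)" if "i < 2^n" for i
    using that t by (intro not_in_dyadic_cell) auto
  then have "(\<Sum>i<2^n. if real i * t / 2^n < s \<and> s \<le> real (Suc i) * t / 2^n then \<phi> i else 0) = 0"
    by (intro sum.neutral) auto
  then show ?thesis using B by simp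
qed

lemma integral_norm_sq_tendsto:
  fixes f :: "nat \<Rightarrow> real \<Rightarrow> 'v::euclidean_space"
  assumes [measurable]: "\<And>n. f n \<in> borel_measurable borel"
    and lim: "\<And>s. (\<lambda>n. f n s) \<longlonglongrightarrow> f' s"
    and B: "\<And>n s. norm (f n s) \<le> B" and supp: "\<And>n s. s \<notin> {0..1} \<Longrightarrow> f n s = 0"
  shows "(\<lambda>n. \<integral>s. (norm (f n s))\<^sup>2 \<partial>lborel) \<longlonglongrightarrow> (\<integral>s. (norm (f' s))\<^sup>2 \<partial>lborel)"
proof (rule integral_dominated_convergence[where w = "\<lambda>s. B\<^sup>2 * indicator {0..1} s"])
  have [measurable]: "f' \<in> borel_measurable borel"
    by (rule borel_measurable_LIMSEQ_metric[OF assms(1) lim])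
  show "(\<lambda>s. (norm (f' s))\<^sup>2) \<in> borel_measurable lborel" by measurable
  show "AE s in lborel. (\<lambda>n. (norm (f n s))\<^sup>2) \<longlonglongrightarrow> (norm (f' s))\<^sup>2"
    by (intro always_eventually allI tendsto_intros lim)
  show "AE s in lborel. norm ((norm (f n s))\<^sup>2) \<le> B\<^sup>2 * indicator {0..1} s" for n
    using B supp by (intro always_eventually allI) (auto simp: indicator_def intro: power_mono)
qed auto

section \<open>Linear flows\<close>

lemma bounded_bilinear_matrix_vector_mult:
  "bounded_bilinear (\<lambda>(A::real^'n^'m) x. A *v x)"
  unfolding bilinear_conv_bounded_bilinear[symmetric] bilinear_def
  by (auto intro!: linearI simp: matrix_vector_mult_add_rdistrib matrix_vector_right_distrib
      scaleR_matrix_vector_assoc[symmetric] matrix_vector_mult_scaleR)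

lemma inner_matrix_vector_mult:
  fixes A :: "real^'n^'m"
  shows "x \<bullet> (A *v y) = (transpose A *v x) \<bullet> y"
  by (simp add: dot_lmul_matrix)

lemma bounded_bilinear_matrix_matrix_mult:
  "bounded_bilinear (\<lambda>(A::real^'n^'m) (B::real^'p^'n). A ** B)"
  unfolding bilinear_conv_bounded_bilinear[symmetric] bilinear_def
  by (auto intro!: linearI simp: vec_eq_iff matrix_matrix_mult_def sum.distrib algebra_simps sum_distrib_left)

lemma bounded_linear_transpose: "bounded_linear (transpose :: real^'n^'m \<Rightarrow> real^'m^'n)"
  unfolding linear_conv_bounded_linear[symmetric]
  by (auto intro!: linearI simp: vec_eq_iff transpose_def)

lemmas continuous_on_matrix_vector_mult [continuous_intros] =
  bounded_bilinear.continuous_on[OF bounded_bilinear_matrix_vector_mult]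
lemmas continuous_on_matrix_matrix_mult [continuous_intros] =
  bounded_bilinear.continuous_on[OF bounded_bilinear_matrix_matrix_mult]
lemmas continuous_on_transpose [continuous_intros] =
  bounded_linear.continuous_on[OF bounded_linear_transpose]

lemma continuous_on_matrixI:
  fixes A :: "'a::topological_space \<Rightarrow> real^'n^'m"
  assumes "\<And>x. continuous_on S (\<lambda>s. A s *v x)"
  shows "continuous_on S A"
proof -
  have "continuous_on S (\<lambda>s. \<chi> i j. (A s *v axis j 1) $ i)"
    by (intro continuous_intros assms)
  then show ?thesis
    by (simp add: matrix_vector_mult_basis column_def)
qed

lemma continuous_on_bounded_matrix_vector_mult:
  fixes A :: "real \<Rightarrow> real^'n^'m"
  assumes "continuous_on {0..1} A"
  obtains K where "0 \<le> K" "\<And>t x. t \<in> {0..1} \<Longrightarrow> norm (A t *v x) \<le> K * norm x"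
proof -
  obtain C where C: "\<And>(B::real^'n^'m) x. norm (B *v x) \<le> norm B * norm x * C"
    using bounded_bilinear.bounded[OF bounded_bilinear_matrix_vector_mult] by blast
  obtain N where N: "\<And>t. t \<in> {0..1} \<Longrightarrow> norm (A t) \<le> N"
    using compact_imp_bounded[OF compact_continuous_image[OF assms compact_Icc]]
    unfolding bounded_iff by blast
  have "N \<ge> 0" using order_trans[OF norm_ge_zero N[of 0]] by simp
  have "norm (A t *v x) \<le> (N * \<bar>C\<bar>) * norm x" if "t \<in> {0..1}" for t x
  proof -
    have "norm (A t *v x) \<le> norm (A t) * norm x * C" by (rule C)
    also have "\<dots> \<le> norm (A t) * norm x * \<bar>C\<bar>" by (intro mult_left_mono) auto
    also have "\<dots> \<le> N * norm x * \<bar>C\<bar>" using N[OF that] by (intro mult_right_mono) auto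
    finally show ?thesis by (simp add: mult_ac)
  qed
  then show ?thesis using that \<open>N \<ge> 0\<close> by (metis abs_ge_zero mult_nonneg_nonneg)
qed

text \<open>The equation in \<open>t\<close> holds on all of \<open>{0..1}\<close> for every initial
  time \<open>s\<close>, so \<open>F\<close> also runs backwards and \<open>F t 0\<close> can invert
  \<open>F 0 t\<close>.\<close>

locale linear_flow =
  fixes \<alpha> :: "real \<Rightarrow> real^'d^'d" and F :: "real \<Rightarrow> real \<Rightarrow> real^'d^'d"
  assumes cont_alpha: "continuous_on {0..1} \<alpha>"
    and flow_init: "\<And>s. s \<in> {0..1} \<Longrightarrow> F s s = mat 1"
    and flow_ode: "\<And>s t. s \<in> {0..1} \<Longrightarrow> t \<in> {0..1} \<Longrightarrow>
          ((\<lambda>t. F s t) has_vector_derivative (\<alpha> t ** F s t)) (at t within {0..1})"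
begin

text \<open>The derivative of \<open>norm (y r)\<close> squared lies within plus or minus
  \<open>2 K\<close> times itself, so the exponential weights \<open>exp (- 2 K r)\<close> and
  \<open>exp (2 K r)\<close> make it monotone in either direction. Both are kept because
  \<open>t\<close> may precede \<open>s\<close>; the two times differ by at most 1, which gives
  \<open>exp K\<close>.\<close>

lemma gronwall:
  fixes y :: "real \<Rightarrow> real^'d"
  assumes K: "0 \<le> K" "\<And>t x. t \<in> {0..1} \<Longrightarrow> norm (\<alpha> t *v x) \<le> K * norm x"
    and y: "\<And>t. t \<in> {0..1} \<Longrightarrow> (y has_vector_derivative \<alpha> t *v y t) (at t within {0..1})"
    and st: "s \<in> {0..1}" "t \<in> {0..1}"
  shows "norm (y t) \<le> exp K * norm (y s)"
proof -
  have ineq: "\<bar>y r \<bullet> (\<alpha> r *v y r)\<bar> \<le> K * (y r \<bullet> y r)" if "r \<in> {0..1}" for r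
  proof -
    have "\<bar>y r \<bullet> (\<alpha> r *v y r)\<bar> \<le> norm (y r) * norm (\<alpha> r *v y r)" by (rule Cauchy_Schwarz_ineq2)
    also have "\<dots> \<le> norm (y r) * (K * norm (y r))" using K(2)[OF that] by (intro mult_left_mono) auto
    also have "\<dots> = K * (y r \<bullet> y r)" by (simp add: dot_square_norm power2_eq_square)
    finally show ?thesis .
  qed
  have der: "((\<lambda>r. (y r \<bullet> y r) * exp (c * r)) has_real_derivative
      (2 * (y r \<bullet> (\<alpha> r *v y r)) + c * (y r \<bullet> y r)) * exp (c * r)) (at r within {a..b})"
    if "r \<in> {a..b}" "{a..b} \<subseteq> {0..1}" for a b r c
  proof -
    have "(y has_vector_derivative \<alpha> r *v y r) (at r within {a..b})"
      using y[of r] that has_vector_derivative_within_subset by blast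
    then have "((\<lambda>r. y r \<bullet> y r) has_vector_derivative (y r \<bullet> (\<alpha> r *v y r) + (\<alpha> r *v y r) \<bullet> y r)) (at r within {a..b})"
      by (intro bounded_bilinear.has_vector_derivative[OF bounded_bilinear_inner])
    then have "((\<lambda>r. y r \<bullet> y r) has_real_derivative 2 * (y r \<bullet> (\<alpha> r *v y r))) (at r within {a..b})"
      by (simp add: has_real_derivative_iff_has_vector_derivative inner_commute)
    then show ?thesis
      by (auto intro!: derivative_eq_intros simp: algebra_simps)
  qed
  have mono: "(y b \<bullet> y b) * exp (- 2 * K * b) \<le> (y a \<bullet> y a) * exp (- 2 * K * a)"
      "(y a \<bullet> y a) * exp (2 * K * a) \<le> (y b \<bullet> y b) * exp (2 * K * b)"
    if ab: "a \<le> b" "{a..b} \<subseteq> {0..1}" for a b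
  proof -
    obtain z where z: "z \<in> {a..b}" and eq: "(y b \<bullet> y b) * exp (- 2 * K * b) - (y a \<bullet> y a) * exp (- 2 * K * a)
        = (2 * (y z \<bullet> (\<alpha> z *v y z)) + (- 2 * K) * (y z \<bullet> y z)) * exp (- 2 * K * z) * (b - a)"
      using mvt_very_simple[OF ab(1) der[OF _ ab(2), of _ "- 2 * K", unfolded has_field_derivative_def], OF atLeastAtMost_iff[THEN iffD2, OF conjI]]
      by blast
    have "2 * (y z \<bullet> (\<alpha> z *v y z)) + (- 2 * K) * (y z \<bullet> y z) \<le> 0"
      using ineq[of z] z ab by auto
    then have "(2 * (y z \<bullet> (\<alpha> z *v y z)) + (- 2 * K) * (y z \<bullet> y z)) * exp (- 2 * K * z) * (b - a) \<le> 0"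
      using ab by (intro mult_nonpos_nonneg) auto
    with eq show "(y b \<bullet> y b) * exp (- 2 * K * b) \<le> (y a \<bullet> y a) * exp (- 2 * K * a)" by linarith
    obtain z where z: "z \<in> {a..b}" and eq: "(y b \<bullet> y b) * exp (2 * K * b) - (y a \<bullet> y a) * exp (2 * K * a)
        = (2 * (y z \<bullet> (\<alpha> z *v y z)) + (2 * K) * (y z \<bullet> y z)) * exp (2 * K * z) * (b - a)"
      using mvt_very_simple[OF ab(1) der[OF _ ab(2), of _ "2 * K", unfolded has_field_derivative_def], OF atLeastAtMost_iff[THEN iffD2, OF conjI]]
      by blast
    have "2 * (y z \<bullet> (\<alpha> z *v y z)) + (2 * K) * (y z \<bullet> y z) \<ge> 0"
      using ineq[of z] z ab by auto
    then have "(2 * (y z \<bullet> (\<alpha> z *v y z)) + (2 * K) * (y z \<bullet> y z)) * exp (2 * K * z) * (b - a) \<ge> 0"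
      using ab by (intro mult_nonneg_nonneg) auto
    with eq show "(y a \<bullet> y a) * exp (2 * K * a) \<le> (y b \<bullet> y b) * exp (2 * K * b)" by linarith
  qed
  have "y t \<bullet> y t \<le> exp (2 * K) * (y s \<bullet> y s)"
  proof (cases "s \<le> t")
    case True
    have "exp (2 * K * t) * exp (- 2 * K * t) = 1" by (simp add: exp_add[symmetric])
    then have "y t \<bullet> y t = exp (2 * K * t) * ((y t \<bullet> y t) * exp (- 2 * K * t))" by (metis mult.assoc mult.commute mult_1)
    also have "\<dots> \<le> exp (2 * K * t) * ((y s \<bullet> y s) * exp (- 2 * K * s))"
      using mono(1)[of s t] True st by (intro mult_left_mono) auto
    also have "\<dots> = exp (2 * K * (t - s)) * (y s \<bullet> y s)"
      using exp_add[of "2 * K * t" "- 2 * K * s"] by (simp add: algebra_simps)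
    also have "\<dots> \<le> exp (2 * K) * (y s \<bullet> y s)"
      using K(1) st by (intro mult_right_mono) (auto intro!: mult_left_le)
    finally show ?thesis .
  next
    case False
    have "exp (- 2 * K * t) * exp (2 * K * t) = 1" by (simp add: exp_add[symmetric])
    then have "y t \<bullet> y t = exp (- 2 * K * t) * ((y t \<bullet> y t) * exp (2 * K * t))" by (metis mult.assoc mult.commute mult_1)
    also have "\<dots> \<le> exp (- 2 * K * t) * ((y s \<bullet> y s) * exp (2 * K * s))"
      using mono(2)[of t s] False st by (intro mult_left_mono) auto
    also have "\<dots> = exp (2 * K * (s - t)) * (y s \<bullet> y s)"
      using exp_add[of "2 * K * s" "- 2 * K * t"] by (simp add: algebra_simps)
    also have "\<dots> \<le> exp (2 * K) * (y s \<bullet> y s)"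
      using K(1) st by (intro mult_right_mono) (auto intro!: mult_left_le)
    finally show ?thesis .
  qed
  also have "\<dots> = (exp K * norm (y s))\<^sup>2"
    by (simp add: power_mult_distrib dot_square_norm exp_double)
  finally have "(norm (y t))\<^sup>2 \<le> (exp K * norm (y s))\<^sup>2"
    by (simp add: dot_square_norm)
  then show ?thesis by (rule power2_le_imp_le) simp
qed

lemma flow_vec_ode:
  assumes "s \<in> {0..1}" "t \<in> {0..1}"
  shows "((\<lambda>t. F s t *v x) has_vector_derivative (\<alpha> t *v (F s t *v x))) (at t within {0..1})"
  using bounded_linear.has_vector_derivative[OF
      bounded_bilinear.bounded_linear_left[OF bounded_bilinear_matrix_vector_mult] flow_ode[OF assms], of x]
  by (simp add: matrix_vector_mul_assoc)

lemma flow_bound: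
  obtains C where "0 \<le> C" "\<And>s t x. s \<in> {0..1} \<Longrightarrow> t \<in> {0..1} \<Longrightarrow> norm (F s t *v x) \<le> C * norm x"
proof -
  obtain K where K: "0 \<le> K" "\<And>t x. t \<in> {0..1} \<Longrightarrow> norm (\<alpha> t *v x) \<le> K * norm x"
    using continuous_on_bounded_matrix_vector_mult[OF cont_alpha] by blast
  have "norm (F s t *v x) \<le> exp K * norm x" if "s \<in> {0..1}" "t \<in> {0..1}" for s t x
    using gronwall[OF K flow_vec_ode[OF that(1)] that, of x] flow_init[OF that(1)] by simp
  then show ?thesis using that[of "exp K"] by simp
qed

text \<open>As functions of the final time, both sides solve the same equation and agree at time
  \<open>s\<close>; their difference starts at zero there and stays zero by
  \<open>gronwall\<close>.\<close>

lemma flow_mult: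
  assumes "r \<in> {0..1}" "s \<in> {0..1}" "t \<in> {0..1}"
  shows "F s t ** F r s = F r t"
proof -
  obtain K where K: "0 \<le> K" "\<And>t x. t \<in> {0..1} \<Longrightarrow> norm (\<alpha> t *v x) \<le> K * norm x"
    using continuous_on_bounded_matrix_vector_mult[OF cont_alpha] by blast
  have "F s t *v (F r s *v x) = F r t *v x" for x
  proof -
    let ?y = "\<lambda>t. F s t *v (F r s *v x) - F r t *v x"
    have "(?y has_vector_derivative \<alpha> t *v ?y t) (at t within {0..1})" if "t \<in> {0..1}" for t
      unfolding matrix_vector_mult_diff_distrib
      using flow_vec_ode assms that by (intro has_vector_derivative_diff) auto
    from gronwall[OF K this assms(2,3)] show ?thesis
      by (simp add: flow_init[OF assms(2)])
  qed
  then show ?thesis by (simp add: matrix_eq matrix_vector_mul_assoc)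
qed

lemma flow_continuous_right:
  assumes "s \<in> {0..1}"
  shows "continuous_on {0..1} (\<lambda>t. F s t)"
  using flow_ode[OF assms] by (rule continuous_on_vector_derivative)

text \<open>The differential equation concerns the second argument. Continuity in the first is
  deduced from \<open>F s 0\<close> being the inverse of \<open>F 0 s\<close>, together with the
  uniform bound on the flow; \<open>F s t = F 0 t ** F s 0\<close> then handles general
  \<open>t\<close>.\<close>

lemma flow_continuous_left:
  assumes "t \<in> {0..1}"
  shows "continuous_on {0..1} (\<lambda>s. F s t)"
proof -
  obtain C where C: "0 \<le> C" "\<And>s t x. s \<in> {0..1} \<Longrightarrow> t \<in> {0..1} \<Longrightarrow> norm (F s t *v x) \<le> C * norm x"
    using flow_bound by blast
  have "continuous_on {0..1} (\<lambda>s. F s 0)"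
  proof (rule continuous_on_matrixI)
    fix x
    have "((\<lambda>s. F s 0 *v x) \<longlongrightarrow> F s' 0 *v x) (at s' within {0..1})" if s': "s' \<in> {0..1}" for s'
    proof -
      define z where "z = F s' 0 *v x"
      have ev: "\<forall>\<^sub>F s in at s' within {0..1}. norm (F s 0 *v x - z) \<le> C * norm (F 0 s' *v z - F 0 s *v z)"
      proof -
        have "norm (F s 0 *v x - z) \<le> C * norm (F 0 s' *v z - F 0 s *v z)" if s: "s \<in> {0..1}" for s
        proof -
          \<comment> \<open>The resolvent identity for inverses: the difference of the inverses is
            an inverse times the difference of the original matrices times the other
            inverse.\<close>
          have "F s 0 *v (F 0 s' *v z - F 0 s *v z) = (F s 0 ** (F 0 s' ** F s' 0)) *v x - (F s 0 ** F 0 s) *v z"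
            by (simp add: matrix_vector_mult_diff_distrib matrix_vector_mul_assoc z_def matrix_mul_assoc)
          also have "\<dots> = F s 0 *v x - z"
            using s s' by (simp add: flow_mult flow_init)
          finally show ?thesis using C(2)[OF s, of 0 "F 0 s' *v z - F 0 s *v z"] by simp
        qed
        then show ?thesis by (auto simp: eventually_at_filter)
      qed
      have "((\<lambda>s. F 0 s *v z) \<longlongrightarrow> F 0 s' *v z) (at s' within {0..1})"
        using s' continuous_on_matrix_vector_mult[OF flow_continuous_right[of 0] continuous_on_const, of z]
        by (auto simp: continuous_on_def)
      then have "((\<lambda>s. C * norm (F 0 s' *v z - F 0 s *v z)) \<longlongrightarrow> C * norm (F 0 s' *v z - F 0 s' *v z)) (at s' within {0..1})"
        by (intro tendsto_intros)
      then have "((\<lambda>s. C * norm (F 0 s' *v z - F 0 s *v z)) \<longlongrightarrow> 0) (at s' within {0..1})" by simp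
      from Lim_null_comparison[OF ev this] show ?thesis
        unfolding z_def by (rule LIM_zero_cancel)
    qed
    then show "continuous_on {0..1} (\<lambda>s. F s 0 *v x)" by (auto simp: continuous_on_def)
  qed
  then have "continuous_on {0..1} (\<lambda>s. F 0 t ** F s 0)" by (intro continuous_intros)
  then show ?thesis
    by (rule continuous_on_eq) (use assms flow_mult in auto)
qed

text \<open>The summand differs from \<open>F b t *v x b - F a t *v x a\<close>, whose sum telescopes, by
\<open>F b t\<close> applied to \<open>\<integral>\<^sub>a\<^sup>b \<alpha> r *v (x r - F a r *v x a) dr\<close>, which is uniformly small compared to \<open>b - a\<close>.\<close>
lemma flow_path_tendsto:
  fixes x :: "real \<Rightarrow> real^'d"
  assumes x: "continuous_on {0..1} x" "x 0 = 0" and t: "t \<in> {0..1}"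
    and J: "\<And>s. s \<in> {0..1} \<Longrightarrow> J s = x s - integral {0..s} (\<lambda>r. \<alpha> r *v x r)"
  shows "(\<lambda>n. \<Sum>i<2^n. F (real (Suc i) * t / 2^n) t *v (J (real (Suc i) * t / 2^n) - J (real i * t / 2^n)))
     \<longlonglongrightarrow> x t"
proof -
  obtain K where K: "0 \<le> K" "\<And>t x. t \<in> {0..1} \<Longrightarrow> norm (\<alpha> t *v x) \<le> K * norm x"
    using continuous_on_bounded_matrix_vector_mult[OF cont_alpha] by blast
  obtain C where C: "0 \<le> C" "\<And>s t x. s \<in> {0..1} \<Longrightarrow> t \<in> {0..1} \<Longrightarrow> norm (F s t *v x) \<le> C * norm x"
    using flow_bound by blast
  \<comment> \<open>Pulled back to time 0, the error \<open>x r - F a r *v x a\<close> is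
    \<open>F 0 r *v (y r - y a)\<close>, so uniform continuity of the single function
    \<open>y\<close> controls all cells at once.\<close>
  define y where "y s = F s 0 *v x s" for s
  have ycont: "continuous_on {0..1} y"
    unfolding y_def by (intro continuous_intros flow_continuous_left x) auto
  then have yunif: "uniformly_continuous_on {0..1} y"
    by (intro compact_uniformly_continuous) auto
  have cell: "norm (F b t *v (J b - J a) - (F b t *v x b - F a t *v x a)) \<le> C * (K * (C * e)) * (b - a)"
    if ab: "0 \<le> a" "a \<le> b" "b \<le> 1" and e: "\<And>r. r \<in> {a..b} \<Longrightarrow> norm (y r - y a) \<le> e" for a b e
  proof -
    have sub: "{a..b} \<subseteq> {0..1}" using ab by auto
    have ax: "continuous_on {0..1} (\<lambda>r. \<alpha> r *v x r)" by (intro continuous_intros cont_alpha x)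
    have af: "continuous_on {0..1} (\<lambda>r. \<alpha> r *v (F a r *v x a))"
      using ab by (intro continuous_intros cont_alpha flow_continuous_right) auto
    have int: "(\<lambda>r. \<alpha> r *v x r) integrable_on {a..b}" "(\<lambda>r. \<alpha> r *v (F a r *v x a)) integrable_on {a..b}"
      "(\<lambda>r. \<alpha> r *v x r) integrable_on {0..b}"
      using ab continuous_on_subset[OF ax, of "{a..b}"] continuous_on_subset[OF af, of "{a..b}"]
        continuous_on_subset[OF ax, of "{0..b}"]
      by (auto intro!: integrable_continuous_real)
    have J_eq: "J b - J a = x b - x a - integral {a..b} (\<lambda>r. \<alpha> r *v x r)"
      using Henstock_Kurzweil_Integration.integral_combine[OF ab(1,2) int(3)] ab by (simp add: J algebra_simps)
    have "((\<lambda>r. \<alpha> r *v (F a r *v x a)) has_integral (F a b *v x a - F a a *v x a)) {a..b}"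
      using ab sub flow_vec_ode by (intro fundamental_theorem_of_calculus) (auto intro: has_vector_derivative_within_subset[OF _ sub])
    then have FTC: "integral {a..b} (\<lambda>r. \<alpha> r *v (F a r *v x a)) = F a b *v x a - x a"
      using ab by (simp add: integral_unique flow_init)
    have Fb: "F b t *v (F a b *v x a) = F a t *v x a"
      using ab t by (simp add: matrix_vector_mul_assoc flow_mult)
    have diff: "F b t *v (J b - J a) - (F b t *v x b - F a t *v x a)
        = - (F b t *v (integral {a..b} (\<lambda>r. \<alpha> r *v (x r - F a r *v x a))))"
    proof -
      have "integral {a..b} (\<lambda>r. \<alpha> r *v (x r - F a r *v x a))
          = integral {a..b} (\<lambda>r. \<alpha> r *v x r) - (F a b *v x a - x a)"
        unfolding matrix_vector_mult_diff_distrib FTC[symmetric] using int by (intro integral_diff)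
      then show ?thesis unfolding J_eq Fb[symmetric]
        by (simp only: matrix_vector_mult_diff_distrib[of "F b t"]) simp
    qed
    have "norm (\<alpha> r *v (x r - F a r *v x a)) \<le> K * (C * e)" if r: "r \<in> {a..b}" for r
    proof -
      have r01: "r \<in> {0..1}" "a \<in> {0..1}" using r ab by auto
      have "x r - F a r *v x a = F 0 r *v (y r - y a)"
        using r01 by (simp add: y_def matrix_vector_mult_diff_distrib matrix_vector_mul_assoc flow_mult flow_init)
      then have "norm (x r - F a r *v x a) \<le> C * e"
        using C(2)[of 0 r "y r - y a"] e[OF r] r01 C(1) by (metis atLeastAtMost_iff mult_left_mono order_trans zero_le_one order_refl)
      then show ?thesis
        using K(2)[OF r01(1), of "x r - F a r *v x a"] K(1) by (meson mult_left_mono order_trans)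
    qed
    then have "norm (integral {a..b} (\<lambda>r. \<alpha> r *v (x r - F a r *v x a))) \<le> K * (C * e) * (b - a)"
      using ab sub by (intro integral_bound) (auto intro!: continuous_intros continuous_on_subset[OF cont_alpha] continuous_on_subset[OF x(1)] continuous_on_subset[OF flow_continuous_right])
    then have "norm (F b t *v (integral {a..b} (\<lambda>r. \<alpha> r *v (x r - F a r *v x a)))) \<le> C * (K * (C * e) * (b - a))"
      using C(2)[of b t] C(1) ab t by (meson atLeastAtMost_iff mult_left_mono order_trans)
    then show ?thesis unfolding diff norm_minus_cancel by (simp add: mult_ac)
  qed
  show ?thesis
  proof (rule LIMSEQ_I)
    fix r :: real assume r: "r > 0"
    \<comment> \<open>The total error is at most \<open>C * (K * (C * e)) * t\<close>; the added 1
      keeps the denominator positive and the bound strict.\<close>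
    define e where "e = r / (C * (K * C) + 1)"
    have den: "C * (K * C) + 1 > 0" using C K by (intro add_nonneg_pos) auto
    have e: "e > 0" "C * (K * (C * e)) < r"
    proof -
      show "e > 0" using r den by (simp add: e_def)
      have "C * (K * (C * e)) = (C * (K * C)) * e" by simp
      also have "\<dots> < (C * (K * C) + 1) * e" using \<open>e > 0\<close> by (intro mult_strict_right_mono) auto
      also have "\<dots> = r" using den by (simp add: e_def)
      finally show "C * (K * (C * e)) < r" .
    qed
    obtain d where d: "d > 0" "\<And>r r'. r \<in> {0..1} \<Longrightarrow> r' \<in> {0..1} \<Longrightarrow> dist r' r < d \<Longrightarrow> dist (y r') (y r) < e"
      using uniformly_continuous_onE[OF yunif e(1)] by blast
    obtain n0 where n0: "(1/2::real)^n0 < d"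
      using real_arch_pow_inv[OF d(1), of "1/2"] by auto
    show "\<exists>n0. \<forall>n\<ge>n0. norm ((\<Sum>i<2^n. F (real (Suc i) * t / 2^n) t *v (J (real (Suc i) * t / 2^n) - J (real i * t / 2^n))) - x t) < r"
    proof (intro exI allI impI)
      fix n assume n: "n \<ge> n0"
      define p where "p i = real i * t / 2^n" for i
      have p0: "p 0 = 0" and pt: "p (2^n) = t" by (simp_all add: p_def)
      have pstep: "p (Suc i) - p i = t / 2^n" for i
        by (simp add: p_def field_simps)
      have p01: "p i \<in> {0..1}" if "i \<le> 2^n" for i
      proof -
        have "real i \<le> real (2^n)" using that by (simp only: of_nat_le_iff)
        then have "real i * t \<le> 2^n * 1" using t by (intro mult_mono) auto
        then show ?thesis using t by (simp add: p_def divide_le_eq)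
      qed
      have small: "t / 2^n < d"
      proof -
        have "t / 2^n \<le> 1 / 2^n" using t by (intro divide_right_mono) auto
        also have "\<dots> = (1/2)^n" by (simp add: power_one_over)
        also have "\<dots> \<le> (1/2)^n0" using n by (intro power_decreasing) auto
        finally show ?thesis using n0 by linarith
      qed
      have tele: "x t = (\<Sum>i<2^n. F (p (Suc i)) t *v x (p (Suc i)) - F (p i) t *v x (p i))"
        unfolding sum_lessThan_telescope[of "\<lambda>i. F (p i) t *v x (p i)"] p0 pt using t x(2) by (simp add: flow_init)
      have "norm ((\<Sum>i<2^n. F (p (Suc i)) t *v (J (p (Suc i)) - J (p i))) - x t)
          = norm (\<Sum>i<2^n. F (p (Suc i)) t *v (J (p (Suc i)) - J (p i)) - (F (p (Suc i)) t *v x (p (Suc i)) - F (p i) t *v x (p i)))"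
        unfolding tele by (simp only: sum_subtractf)
      also have "\<dots> \<le> (\<Sum>i<(2::nat)^n. C * (K * (C * e)) * (t / 2^n))"
      proof (rule sum_norm_le)
        fix i :: nat assume "i \<in> {..<2^n}"
        then have pi: "p i \<in> {0..1}" "p (Suc i) \<in> {0..1}" using p01[of i] p01[of "Suc i"] by auto
        have le: "p i \<le> p (Suc i)" using pstep[of i] t by (simp add: algebra_simps)
        have "norm (y s - y (p i)) \<le> e" if "s \<in> {p i..p (Suc i)}" for s
        proof -
          have "dist s (p i) < d" using that pstep[of i] small by (auto simp: dist_real_def)
          then show ?thesis using d(2)[of "p i" s] pi that by (auto simp: dist_norm)
        qed
        from cell[OF _ le _ this] pi
        show "norm (F (p (Suc i)) t *v (J (p (Suc i)) - J (p i)) - (F (p (Suc i)) t *v x (p (Suc i)) - F (p i) t *v x (p i)))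
            \<le> C * (K * (C * e)) * (t / 2^n)"
          unfolding pstep by simp
      qed
      also have "\<dots> = C * (K * (C * e)) * t" by simp
      also have "\<dots> \<le> C * (K * (C * e))"
        using t C K e by (intro mult_left_le) auto
      also have "\<dots> < r" by (rule e)
      finally show "norm ((\<Sum>i<2^n. F (real (Suc i) * t / 2^n) t *v (J (real (Suc i) * t / 2^n) - J (real i * t / 2^n))) - x t) < r"
        by (simp only: p_def)
    qed
  qed
qed

end

section \<open>The law of the solution of the stochastic differential equation\<close>

lemma tendsto_exp_neg_half:
  assumes "V \<longlonglongrightarrow> V'"
  shows "(\<lambda>n. complex_of_real (exp (- V n / 2))) \<longlonglongrightarrow> complex_of_real (exp (- V' / 2))"
  using assms by (intro tendsto_of_real tendsto_exp tendsto_divide tendsto_minus tendsto_const) auto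

text \<open>Each sum \<open>ito_sum\<close> is a Wiener integral of a left-tagged step function, and
  convergence in probability carries the characteristic functions to the limit. The index
  \<open>k\<close> is kept apart from the time \<open>t k\<close>, because the combinations needed
  for the solution repeat times.\<close>

lemma ito_charfun:
  fixes W :: "real \<Rightarrow> 'a \<Rightarrow> (real,'m::finite) vec" and G :: "real \<Rightarrow> ((real,'m) vec,'d::{finite,linorder}) vec"
  assumes W: "std_wiener M W" and G: "continuous_on {0..1} G"
    and K: "finite K" and t: "\<And>k. k \<in> K \<Longrightarrow> t k \<in> {0..1}"
    and I: "\<And>k. k \<in> K \<Longrightarrow> is_ito_integral M G W (t k) (I k)"
  shows "(CLINT \<omega>|M. iexp (\<Sum>k\<in>K. c k \<bullet> I k \<omega>))
     = exp (- (\<integral>s. (norm (\<Sum>k\<in>K. if 0 < s \<and> s \<le> t k then transpose (G s) *v c k else 0))\<^sup>2 \<partial>lborel) / 2)"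
proof -
  interpret prob_space M using W by (simp add: std_wiener_def)
  have p01: "real i * t k / 2^n \<in> {0..1}" if "k \<in> K" "i \<le> 2^n" for k i n
  proof -
    have "real i \<le> real (2^n)" using that by (simp only: of_nat_le_iff)
    then have "real i * t k \<le> 2^n * 1" using t[OF that(1)] by (intro mult_mono) auto
    then show ?thesis using t[OF that(1)] by (simp add: divide_le_eq)
  qed
  have Wm: "W s \<in> borel_measurable M" if "s \<in> {0..1}" for s
    using W that by (simp add: std_wiener_def)
  have itom: "ito_sum G W (t k) n \<in> borel_measurable M" if "k \<in> K" for k n
  proof -
    have [measurable]: "(\<lambda>\<omega>. A *v f \<omega>) \<in> borel_measurable M" if "f \<in> borel_measurable M" for f and A :: "((real,'m) vec,'d) vec"
      using that by (intro borel_measurable_continuous_on[of "\<lambda>x. A *v x"] continuous_intros)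
    show ?thesis unfolding ito_sum_def[abs_def]
    proof (intro borel_measurable_sum)
      fix i :: nat assume "i \<in> {..<2^n}"
      then have [measurable]: "W (real (Suc i) * t k / 2^n) \<in> borel_measurable M" "W (real i * t k / 2^n) \<in> borel_measurable M"
        using p01[OF that, of i n] p01[OF that, of "Suc i" n] by (auto intro!: Wm)
      show "(\<lambda>\<omega>. G (real i * t k / 2 ^ n) *v (W (real (Suc i) * t k / 2 ^ n) \<omega> - W (real i * t k / 2 ^ n) \<omega>)) \<in> borel_measurable M"
        by measurable
    qed
  qed
  have lim1: "(\<lambda>n. CLINT \<omega>|M. iexp (\<Sum>k\<in>K. c k \<bullet> ito_sum G W (t k) n \<omega>)) \<longlonglongrightarrow> (CLINT \<omega>|M. iexp (\<Sum>k\<in>K. c k \<bullet> I k \<omega>))"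
    using I by (intro charfun_tendsto_in_prob K itom) (auto simp: is_ito_integral_def)
  define v where "v n k i = transpose (G (real i * t k / 2^n)) *v c k" for n :: nat and k and i :: nat
  define f where "f n s = (\<Sum>k\<in>K. \<Sum>i<2^n. if real i * t k / 2^n < s \<and> s \<le> real (Suc i) * t k / 2^n then v n k i else 0)"
    for n :: nat and s
  have cf: "(CLINT \<omega>|M. iexp (\<Sum>k\<in>K. c k \<bullet> ito_sum G W (t k) n \<omega>)) = exp (- (\<integral>s. (norm (f n s))\<^sup>2 \<partial>lborel) / 2)" for n
  proof -
    define q where "q = (\<lambda>(k,i,e). real (if e then Suc i else i) * t k / 2^n)"
    define b where "b = (\<lambda>(k,i,e). if e then v n k i else - v n k i)"
    let ?I = "K \<times> {..<2^n} \<times> (UNIV::bool set)"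
    have "(\<Sum>k\<in>K. c k \<bullet> ito_sum G W (t k) n \<omega>) = (\<Sum>x\<in>?I. b x \<bullet> W (q x) \<omega>)" for \<omega>
    proof -
      have "(\<Sum>k\<in>K. c k \<bullet> ito_sum G W (t k) n \<omega>)
          = (\<Sum>k\<in>K. \<Sum>i<2^n. v n k i \<bullet> (W (real (Suc i) * t k / 2^n) \<omega> - W (real i * t k / 2^n) \<omega>))"
        by (simp only: ito_sum_def inner_sum_right inner_matrix_vector_mult v_def)
      also have "\<dots> = (\<Sum>x\<in>?I. b x \<bullet> W (q x) \<omega>)"
        unfolding dyadic_increments_eq[where Y = "\<lambda>s. W s \<omega>"] by (intro sum.cong) (auto simp: b_def q_def)
      finally show ?thesis .
    qed
    moreover have "(CLINT \<omega>|M. iexp (\<Sum>x\<in>?I. b x \<bullet> W (q x) \<omega>))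
        = exp (- (\<integral>s. (norm (\<Sum>x\<in>?I. if 0 < s \<and> s \<le> q x then b x else 0))\<^sup>2 \<partial>lborel) / 2)"
    proof (rule wiener_charfun[OF W])
      show "q x \<in> {0..1}" if "x \<in> ?I" for x
        using that p01[of "fst x" "fst (snd x)" n] p01[of "fst x" "Suc (fst (snd x))" n] by (auto simp: q_def split: if_splits)
    qed (use K in auto)
    moreover have "(\<Sum>x\<in>?I. if 0 < s \<and> s \<le> q x then b x else 0) = f n s" for s
    proof -
      have "f n s = (\<Sum>(k,i,e)\<in>?I. if 0 < s \<and> s \<le> real (if e then Suc i else i) * t k / 2^n
            then (if e then v n k i else - v n k i) else 0)"
        unfolding f_def using t by (intro dyadic_increments_step[where L = "\<lambda>x. x", symmetric]) auto
      also have "\<dots> = (\<Sum>x\<in>?I. if 0 < s \<and> s \<le> q x then b x else 0)"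
        by (intro sum.cong) (auto simp: b_def q_def)
      finally show ?thesis by simp
    qed
    ultimately show ?thesis by simp
  qed
  obtain B where B: "0 \<le> B" "\<And>r x. r \<in> {0..1} \<Longrightarrow> norm (transpose (G r) *v x) \<le> B * norm x"
    using continuous_on_bounded_matrix_vector_mult[OF continuous_on_transpose[OF G]] by blast
  have "(\<lambda>n. \<integral>s. (norm (f n s))\<^sup>2 \<partial>lborel) \<longlonglongrightarrow>
     (\<integral>s. (norm (\<Sum>k\<in>K. if 0 < s \<and> s \<le> t k then transpose (G s) *v c k else 0))\<^sup>2 \<partial>lborel)"
  proof (rule integral_norm_sq_tendsto)
    show "f n \<in> borel_measurable borel" for n
      unfolding f_def[abs_def] by (intro borel_measurable_sum) measurable
    show "(\<lambda>n. f n s) \<longlonglongrightarrow> (\<Sum>k\<in>K. if 0 < s \<and> s \<le> t k then transpose (G s) *v c k else 0)" for s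
      unfolding f_def v_def
    proof (intro tendsto_sum)
      fix k assume "k \<in> K"
      then show "(\<lambda>n. \<Sum>i<2^n. if real i * t k / 2^n < s \<and> s \<le> real (Suc i) * t k / 2^n then transpose (G (real i * t k / 2^n)) *v c k else 0)
        \<longlonglongrightarrow> (if 0 < s \<and> s \<le> t k then transpose (G s) *v c k else 0)"
        using dyadic_step_tendsto[of "\<lambda>r. transpose (G r) *v c k" "t k" 0 s] t G
        by (simp only: add_0_right continuous_on_matrix_vector_mult continuous_on_transpose continuous_on_const)
    qed
    show "norm (f n s) \<le> (\<Sum>k\<in>K. B * norm (c k))" for n s
      unfolding f_def
    proof (intro sum_norm_le norm_dyadic_step_le)
      fix k and i :: nat assume "k \<in> K" "i < 2^n"
      then show "norm (v n k i) \<le> B * norm (c k)"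
        unfolding v_def using p01[of k i n] by (intro B) auto
    qed (use B t in auto)
    show "f n s = 0" if "s \<notin> {0..1}" for n s
    proof -
      have "\<not> (real i * t k / 2^n < s \<and> s \<le> real (Suc i) * t k / 2^n)" if "k \<in> K" "i < 2^n" for k i
        using t[OF that(1)] that \<open>s \<notin> {0..1}\<close> by (intro not_in_dyadic_cell) auto
      then show ?thesis unfolding f_def by (intro sum.neutral ballI) auto
    qed
  qed
  then have "(\<lambda>n. complex_of_real (exp (- (\<integral>s. (norm (f n s))\<^sup>2 \<partial>lborel) / 2))) \<longlonglongrightarrow>
     complex_of_real (exp (- (\<integral>s. (norm (\<Sum>k\<in>K. if 0 < s \<and> s \<le> t k then transpose (G s) *v c k else 0))\<^sup>2 \<partial>lborel) / 2))"
    by (rule tendsto_exp_neg_half)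
  then show ?thesis
    using lim1 unfolding cf by (rule LIMSEQ_unique[rotated])
qed

text \<open>A second limit on top of \<open>ito_charfun\<close>: at each stage \<open>n\<close> the
  combination involves finitely many stochastic integrals and its law is known exactly. Letting
  \<open>n\<close> grow, the combination converges almost surely and its integrand pointwise and
  boundedly.\<close>

lemma sde_solution_charfun:
  fixes \<alpha> :: "real \<Rightarrow> ((real, 'd::{finite,linorder}) vec, 'd) vec"
    and W :: "real \<Rightarrow> 'a \<Rightarrow> (real,'m::finite) vec"
  assumes flow: "linear_flow \<alpha> F" and W: "std_wiener M W" and sG: "continuous_on {0..1} sG"
    and sol: "sde_solution M \<alpha> sG W X" and T: "finite T" "T \<subseteq> {0..1}"
  shows "(CLINT \<omega>|M. iexp (\<Sum>t\<in>T. u t \<bullet> X t \<omega>))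
     = exp (- (\<integral>s. (norm (\<Sum>t\<in>T. if 0 < s \<and> s \<le> t then transpose (sG s) *v (transpose (F s t) *v u t) else 0))\<^sup>2 \<partial>lborel) / 2)"
proof -
  interpret linear_flow \<alpha> F by (rule flow)
  interpret prob_space M using W by (simp add: std_wiener_def)
  have "\<forall>t\<in>{0..1}. \<exists>I. is_ito_integral M sG W t I \<and> (AE \<omega> in M. X t \<omega> = integral {0..t} (\<lambda>s. \<alpha> s *v X s \<omega>) + I \<omega>)"
    using sol by (simp add: sde_solution_def)
  from bchoice[OF this] obtain I where
    I0: "\<forall>t\<in>{0..1}. is_ito_integral M sG W t (I t) \<and> (AE \<omega> in M. X t \<omega> = integral {0..t} (\<lambda>s. \<alpha> s *v X s \<omega>) + I t \<omega>)"
    by (elim exE)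
  then have I: "is_ito_integral M sG W t (I t)"
      "AE \<omega> in M. X t \<omega> = integral {0..t} (\<lambda>s. \<alpha> s *v X s \<omega>) + I t \<omega>" if "t \<in> {0..1}" for t
    using that by (simp_all only: Ball_def)
  have Im: "I t \<in> borel_measurable M" if "t \<in> {0..1}" for t
    using I(1)[OF that] by (simp add: is_ito_integral_def)
  have Xm: "X t \<in> borel_measurable M" if "t \<in> {0..1}" for t
    using sol that by (simp add: sde_solution_def)
  have t01: "t \<in> {0..1}" if "t \<in> T" for t using T that by auto
  have p01: "real i * t / 2^n \<in> {0..1}" if "t \<in> {0..1}" "i \<le> 2^n" for t and i n :: nat
  proof -
    have "real i \<le> real (2^n)" using that by (simp only: of_nat_le_iff)
    then have "real i * t \<le> 2^n * 1" using that(1) by (intro mult_mono) auto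
    then show ?thesis using that(1) by (simp add: divide_le_eq)
  qed
  define v where "v n t i = transpose (F (real (Suc i) * t / 2^n) t) *v u t" for n :: nat and t and i :: nat
  define Z where "Z n \<omega> = (\<Sum>t\<in>T. \<Sum>i<2^n. v n t i \<bullet> (I (real (Suc i) * t / 2^n) \<omega> - I (real i * t / 2^n) \<omega>))"
    for n :: nat and \<omega>
  define f where "f n s = (\<Sum>t\<in>T. transpose (sG s) *v (\<Sum>i<2^n. if real i * t / 2^n < s \<and> s \<le> real (Suc i) * t / 2^n then v n t i else 0))"
    for n :: nat and s
  define f' where "f' s = (\<Sum>t\<in>T. if 0 < s \<and> s \<le> t then transpose (sG s) *v (transpose (F s t) *v u t) else 0)" for s
  have Zm: "Z n \<in> borel_measurable M" for n
    unfolding Z_def[abs_def]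
  proof (intro borel_measurable_sum)
    fix t and i :: nat assume "t \<in> T" "i \<in> {..<2^n}"
    then have [measurable]: "I (real (Suc i) * t / 2^n) \<in> borel_measurable M" "I (real i * t / 2^n) \<in> borel_measurable M"
      using p01[OF t01, of t i n] p01[OF t01, of t "Suc i" n] by (auto intro!: Im)
    show "(\<lambda>\<omega>. v n t i \<bullet> (I (real (Suc i) * t / 2^n) \<omega> - I (real i * t / 2^n) \<omega>)) \<in> borel_measurable M"
      by measurable
  qed
  have cf: "(CLINT \<omega>|M. iexp (Z n \<omega>)) = exp (- (\<integral>s. (norm (f n s))\<^sup>2 \<partial>lborel) / 2)" for n
  proof -
    define q where "q = (\<lambda>(t,i,e). real (if e then Suc i else i) * t / 2^n)"
    define b where "b = (\<lambda>(t,i,e). if e then v n t i else - v n t i)"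
    let ?I = "T \<times> {..<2^n} \<times> (UNIV::bool set)"
    have q01: "q x \<in> {0..1}" if "x \<in> ?I" for x
      using that p01[OF t01, of "fst x" "fst (snd x)" n] p01[OF t01, of "fst x" "Suc (fst (snd x))" n]
      by (auto simp: q_def split: if_splits)
    have "Z n \<omega> = (\<Sum>x\<in>?I. b x \<bullet> I (q x) \<omega>)" for \<omega>
      unfolding Z_def dyadic_increments_eq[where Y = "\<lambda>s. I s \<omega>"] by (intro sum.cong) (auto simp: b_def q_def)
    moreover have "(CLINT \<omega>|M. iexp (\<Sum>x\<in>?I. b x \<bullet> I (q x) \<omega>))
        = exp (- (\<integral>s. (norm (\<Sum>x\<in>?I. if 0 < s \<and> s \<le> q x then transpose (sG s) *v b x else 0))\<^sup>2 \<partial>lborel) / 2)"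
      using T q01 I(1) by (intro ito_charfun[OF W sG]) auto
    moreover have "(\<Sum>x\<in>?I. if 0 < s \<and> s \<le> q x then transpose (sG s) *v b x else 0) = f n s" for s
    proof -
      have neg: "transpose (sG s) *v (- x) = - (transpose (sG s) *v x)" for x
        using matrix_vector_mult_diff_distrib[of "transpose (sG s)" 0 x] by (simp del: transpose_matrix_vector)
      have "(\<Sum>x\<in>?I. if 0 < s \<and> s \<le> q x then transpose (sG s) *v b x else 0)
         = (\<Sum>(t,i,e)\<in>?I. if 0 < s \<and> s \<le> real (if e then Suc i else i) * t / 2^n
            then transpose (sG s) *v (if e then v n t i else - v n t i) else 0)"
        by (intro sum.cong) (auto simp: b_def q_def)
      also have "\<dots> = (\<Sum>t\<in>T. \<Sum>i<2^n. if real i * t / 2^n < s \<and> s \<le> real (Suc i) * t / 2^n then transpose (sG s) *v v n t i else 0)"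
        using t01 by (intro dyadic_increments_step[where t = "\<lambda>t. t"] neg) auto
      also have "\<dots> = f n s"
        unfolding f_def linear_sum[OF matrix_vector_mul_linear]
        by (intro sum.cong refl) (simp del: transpose_matrix_vector)
      finally show ?thesis .
    qed
    ultimately show ?thesis by simp
  qed
  have ZX: "AE \<omega> in M. (\<lambda>n. Z n \<omega>) \<longlonglongrightarrow> (\<Sum>t\<in>T. u t \<bullet> X t \<omega>)"
  proof -
    \<comment> \<open>The null set of the integral equation depends on the time; only countably many
      grid points occur, so one null set covers them all.\<close>
    have "AE \<omega> in M. \<forall>t\<in>T. \<forall>n. \<forall>i\<in>{..2^n}. X (real i * t / 2^n) \<omega>
        = integral {0..real i * t / 2^n} (\<lambda>s. \<alpha> s *v X s \<omega>) + I (real i * t / 2^n) \<omega>"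
      using T(1) p01 t01
      by (intro AE_finite_allI) (auto simp: AE_all_countable intro!: AE_finite_allI I(2))
    moreover have "AE \<omega> in M. X 0 \<omega> = 0" "AE \<omega> in M. continuous_on {0..1} (\<lambda>t. X t \<omega>)"
      using sol by (simp_all add: sde_solution_def)
    ultimately show ?thesis
    proof eventually_elim
      case (elim \<omega>)
      \<comment> \<open>A version of the integral along this path that is defined at every time, as
        \<open>flow_path_tendsto\<close> requires; it agrees with \<open>I\<close> on the
        grids.\<close>
      define J where "J s = X s \<omega> - integral {0..s} (\<lambda>s. \<alpha> s *v X s \<omega>)" for s
      have JI: "I (real i * t / 2^n) \<omega> = J (real i * t / 2^n)" if "t \<in> T" "i \<le> 2^n" for t i n
        using elim(1) that by (auto simp: J_def)
      have "Z n \<omega> = (\<Sum>t\<in>T. u t \<bullet> (\<Sum>i<2^n. F (real (Suc i) * t / 2^n) t *v (J (real (Suc i) * t / 2^n) - J (real i * t / 2^n))))" for n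
        unfolding Z_def inner_sum_right inner_matrix_vector_mult v_def
        by (intro sum.cong refl) (simp only: JI lessThan_iff less_imp_le Suc_leI)
      then show ?case
        using elim t01 by (simp only:) (intro tendsto_sum tendsto_inner tendsto_const flow_path_tendsto, auto simp: J_def)
    qed
  qed
  have Sm: "(\<lambda>\<omega>. \<Sum>t\<in>T. u t \<bullet> X t \<omega>) \<in> borel_measurable M"
    using Xm t01 by (intro borel_measurable_sum borel_measurable_inner) auto
  have lim1: "(\<lambda>n. CLINT \<omega>|M. iexp (Z n \<omega>)) \<longlonglongrightarrow> (CLINT \<omega>|M. iexp (\<Sum>t\<in>T. u t \<bullet> X t \<omega>))"
    by (rule charfun_tendsto_AE[OF Zm Sm ZX])
  obtain B where B: "0 \<le> B" "\<And>r x. r \<in> {0..1} \<Longrightarrow> norm (transpose (sG r) *v x) \<le> B * norm x"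
    using continuous_on_bounded_matrix_vector_mult[OF continuous_on_transpose[OF sG]] by blast
  have "\<exists>C\<ge>0. \<forall>r\<in>{0..1}. norm (transpose (F r t) *v u t) \<le> C" if t: "t \<in> T" for t
  proof -
    obtain C where "0 \<le> C" "\<And>r x. r \<in> {0..1} \<Longrightarrow> norm (transpose (F r t) *v x) \<le> C * norm x"
      using continuous_on_bounded_matrix_vector_mult[OF continuous_on_transpose[OF flow_continuous_left[OF t01[OF t]]]] by blast
    then show ?thesis by (intro exI[of _ "C * norm (u t)"]) auto
  qed
  then obtain C where C: "\<And>t. t \<in> T \<Longrightarrow> 0 \<le> C t" "\<And>t r. t \<in> T \<Longrightarrow> r \<in> {0..1} \<Longrightarrow> norm (transpose (F r t) *v u t) \<le> C t"
    by metis
  have supp: "\<not> (real i * t / 2^n < s \<and> s \<le> real (Suc i) * t / 2^n)"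
    if "s \<notin> {0..1}" "t \<in> T" "i < 2^n" for s t i n
    using t01[OF that(2)] that by (intro not_in_dyadic_cell) auto
  have f0: "f n s = 0" if "s \<notin> {0..1}" for n s
  proof -
    have "(\<Sum>i<2^n. if real i * t / 2^n < s \<and> s \<le> real (Suc i) * t / 2^n then v n t i else 0) = 0" if "t \<in> T" for t
      using supp[OF \<open>s \<notin> {0..1}\<close> that] by (intro sum.neutral) auto
    then show ?thesis unfolding f_def by (intro sum.neutral) (simp del: transpose_matrix_vector)
  qed
  have "(\<lambda>n. \<integral>s. (norm (f n s))\<^sup>2 \<partial>lborel) \<longlonglongrightarrow> (\<integral>s. (norm (f' s))\<^sup>2 \<partial>lborel)"
  proof (rule integral_norm_sq_tendsto)
    show "f n \<in> borel_measurable borel" for n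
    proof -
      \<comment> \<open>Continuity of \<open>sG\<close> is known on \<open>{0..1}\<close> only, so
        measurability on the line goes through a cut-off; outside the interval the step function is
        zero anyway.\<close>
      have 1: "(\<lambda>s. indicator {0..1} s *\<^sub>R (transpose (sG s) *v x)) \<in> borel_measurable borel" for x
        by (intro borel_measurable_continuous_on_indicator continuous_intros sG) auto
      have "f n s = (\<Sum>t\<in>T. \<Sum>i<2^n. (if real i * t / 2^n < s \<and> s \<le> real (Suc i) * t / 2^n
          then 1 else 0) *\<^sub>R (indicator {0..1} s *\<^sub>R (transpose (sG s) *v v n t i)))" for s
      proof (cases "s \<in> {0..1}")
        case True
        then show ?thesis unfolding f_def linear_sum[OF matrix_vector_mul_linear]
          by (intro sum.cong refl) (simp del: transpose_matrix_vector)
      qed (simp add: f0)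
      then have "f n = (\<lambda>s. \<Sum>t\<in>T. \<Sum>i<2^n. (if real i * t / 2^n < s \<and> s \<le> real (Suc i) * t / 2^n
          then 1 else 0) *\<^sub>R (indicator {0..1} s *\<^sub>R (transpose (sG s) *v v n t i)))" by blast
      then show ?thesis
      proof (rule ssubst, intro borel_measurable_sum borel_measurable_scaleR[OF _ 1])
        show "(\<lambda>s. if real i * t / 2^n < s \<and> s \<le> real (Suc i) * t / 2^n then 1 else 0 :: real) \<in> borel_measurable borel" for i t
          by measurable
      qed
    qed
    show "(\<lambda>n. f n s) \<longlonglongrightarrow> f' s" for s
      unfolding f_def f'_def v_def
    proof (intro tendsto_sum)
      fix t assume t: "t \<in> T"
      have "(\<lambda>n. \<Sum>i<2^n. if real i * t / 2^n < s \<and> s \<le> real (Suc i) * t / 2^n then transpose (F (real (Suc i) * t / 2^n) t) *v u t else 0)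
        \<longlonglongrightarrow> (if 0 < s \<and> s \<le> t then transpose (F s t) *v u t else 0)"
        using dyadic_step_tendsto[of "\<lambda>r. transpose (F r t) *v u t" t 1 s] t01[OF t]
        by (simp only: Suc_eq_plus1[symmetric] le_refl flow_continuous_left continuous_on_matrix_vector_mult continuous_on_transpose continuous_on_const)
      then have "(\<lambda>n. transpose (sG s) *v (\<Sum>i<2^n. if real i * t / 2^n < s \<and> s \<le> real (Suc i) * t / 2^n then transpose (F (real (Suc i) * t / 2^n) t) *v u t else 0))
        \<longlonglongrightarrow> transpose (sG s) *v (if 0 < s \<and> s \<le> t then transpose (F s t) *v u t else 0)"
        by (intro bounded_bilinear.tendsto[OF bounded_bilinear_matrix_vector_mult] tendsto_const)
      then show "(\<lambda>n. transpose (sG s) *v (\<Sum>i<2^n. if real i * t / 2^n < s \<and> s \<le> real (Suc i) * t / 2^n then transpose (F (real (Suc i) * t / 2^n) t) *v u t else 0))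
        \<longlonglongrightarrow> (if 0 < s \<and> s \<le> t then transpose (sG s) *v (transpose (F s t) *v u t) else 0)"
        by (auto simp del: transpose_matrix_vector split: if_splits)
    qed
    show "norm (f n s) \<le> (\<Sum>t\<in>T. B * C t)" for n s
    proof (cases "s \<in> {0..1}")
      case True
      show ?thesis unfolding f_def
      proof (intro sum_norm_le)
        fix t assume t: "t \<in> T"
        have "norm (\<Sum>i<2^n. if real i * t / 2^n < s \<and> s \<le> real (Suc i) * t / 2^n then v n t i else 0) \<le> C t"
        proof (rule norm_dyadic_step_le)
          fix i :: nat assume "i < 2^n"
          then show "norm (v n t i) \<le> C t"
            unfolding v_def using p01[OF t01[OF t], of "Suc i" n] by (intro C t) auto
        qed (use C t t01[OF t] in auto)
        then show "norm (transpose (sG s) *v (\<Sum>i<2^n. if real i * t / 2^n < s \<and> s \<le> real (Suc i) * t / 2^n then v n t i else 0)) \<le> B * C t"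
          using B(2)[OF True] B(1) by (meson mult_left_mono order_trans)
      qed
    next
      case False
      then show ?thesis using B C by (simp add: f0 sum_nonneg)
    qed
    show "f n s = 0" if "s \<notin> {0..1}" for n s using that by (rule f0)
  qed
  then have "(\<lambda>n. complex_of_real (exp (- (\<integral>s. (norm (f n s))\<^sup>2 \<partial>lborel) / 2))) \<longlonglongrightarrow>
     complex_of_real (exp (- (\<integral>s. (norm (f' s))\<^sup>2 \<partial>lborel) / 2))"
    by (rule tendsto_exp_neg_half)
  then show ?thesis
    using lim1 unfolding cf f'_def by (rule LIMSEQ_unique[rotated])
qed

section \<open>Parallel sums and bridge kernels\<close>

lemmas matrix_distribs =
  bounded_bilinear.add_left[OF bounded_bilinear_matrix_matrix_mult]
  bounded_bilinear.add_right[OF bounded_bilinear_matrix_matrix_mult]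
  bounded_bilinear.diff_left[OF bounded_bilinear_matrix_matrix_mult]
  bounded_bilinear.diff_right[OF bounded_bilinear_matrix_matrix_mult]
  bounded_bilinear.zero_left[OF bounded_bilinear_matrix_matrix_mult]
  bounded_bilinear.zero_right[OF bounded_bilinear_matrix_matrix_mult]

lemma matrix_cancel:
  fixes A B :: "real^'n^'n" and X :: "real^'n^'m"
  assumes "A ** B = mat 1"
  shows "X ** A ** B = X"
  by (metis assms matrix_mul_assoc matrix_mul_rid)

lemma posdef_congruence:
  fixes A B P :: "((real, 'n::{finite,linorder}) vec, 'n) vec"
  assumes P: "posdef P" and AB: "A ** B = mat 1"
  shows "posdef (A ** P ** transpose A)"
  unfolding posdef_def
proof (intro conjI allI impI)
  show "transpose (A ** P ** transpose A) = A ** P ** transpose A"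
    using P by (simp add: posdef_def matrix_transpose_mul matrix_mul_assoc)
  fix x :: "(real, 'n) vec" assume "x \<noteq> 0"
  have "transpose B ** transpose A = mat 1"
    using AB by (simp add: matrix_transpose_mul[symmetric])
  then have "transpose B *v (transpose A *v x) = x"
    by (simp only: matrix_vector_mul_assoc matrix_vector_mul_lid)
  with \<open>x \<noteq> 0\<close> have "transpose A *v x \<noteq> 0"
    by (metis matrix_vector_mult_0_right)
  then have "0 < (transpose A *v x) \<bullet> (P *v (transpose A *v x))"
    using P unfolding posdef_def by blast
  also have "\<dots> = x \<bullet> (A *v (P *v (transpose A *v x)))"
    by (simp add: dot_lmul_matrix)
  also have "\<dots> = x \<bullet> ((A ** P ** transpose A) *v x)"
    by (simp only: matrix_vector_mul_assoc matrix_mul_assoc)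
  finally show "0 < x \<bullet> ((A ** P ** transpose A) *v x)" .
qed

lemma symmetric_inner:
  fixes A :: "real^'n^'n"
  assumes "transpose A = A"
  shows "x \<bullet> (A *v y) = (A *v x) \<bullet> y"
  by (metis assms dot_lmul_matrix transpose_matrix_vector)

text \<open>\<open>A (A + B)\<^sup>-\<^sup>1 B\<close> is the parallel sum of \<open>A\<close> and \<open>B\<close>; its quadratic form is the infimal
convolution of those of \<open>A\<close> and \<open>B\<close>, attained at \<open>w\<close>.\<close>
lemma parallel_sum:
  fixes A B :: "((real, 'n::{finite,linorder}) vec, 'n) vec"
  assumes A: "transpose A = A" and B: "transpose B = B" and P: "posdef (A + B)"
  defines "S \<equiv> A ** matrix_inv (A + B) ** B"
  shows "transpose S = S"
    and "w = matrix_inv (A + B) *v (A *v x) \<Longrightarrow> x \<bullet> (S *v x) = (x - w) \<bullet> (A *v (x - w)) + w \<bullet> (B *v w)"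
    and "x \<bullet> (S *v x) \<le> x \<bullet> (A *v x)"
proof -
  let ?P' = "matrix_inv (A + B)"
  note P' = posdef_matrix_inv[OF P]
  \<comment> \<open>This form makes the symmetry of \<open>S\<close>, hidden in its definition, and
    the comparison with \<open>A\<close> visible.\<close>
  have S: "S = A - A ** ?P' ** A"
  proof -
    have "A ** ?P' ** (A + B) = A" using P'(2) by (simp add: matrix_cancel)
    then show ?thesis unfolding S_def by (simp add: matrix_distribs eq_diff_eq add.commute)
  qed
  show "transpose S = S"
    using linear_diff[OF bounded_linear.linear[OF bounded_linear_transpose], of A "A ** ?P' ** A"]
    unfolding S by (simp add: A P'(3) matrix_transpose_mul matrix_mul_assoc)
  have Pw: "A *v (?P' *v (A *v x)) + B *v (?P' *v (A *v x)) = A *v x" for x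
  proof -
    have "(A + B) *v (?P' *v (A *v x)) = A *v x"
      by (simp only: matrix_vector_mul_assoc matrix_mul_assoc P'(1) matrix_mul_lid)
    then show ?thesis by (simp only: matrix_vector_mult_add_rdistrib)
  qed
  have Sx: "x \<bullet> (S *v x) = x \<bullet> (A *v x) - (?P' *v (A *v x)) \<bullet> (A *v x)" for x
  proof -
    have "x \<bullet> (A *v (?P' *v (A *v x))) = (A *v x) \<bullet> (?P' *v (A *v x))"
      by (rule symmetric_inner[OF A])
    then show ?thesis
      unfolding S by (simp add: matrix_vector_mult_diff_rdistrib inner_diff_right matrix_vector_mul_assoc[symmetric] inner_commute)
  qed
  show "x \<bullet> (S *v x) = (x - w) \<bullet> (A *v (x - w)) + w \<bullet> (B *v w)" if w: "w = ?P' *v (A *v x)"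
  proof -
    have "w \<bullet> (A *v x) = w \<bullet> (A *v w) + w \<bullet> (B *v w)"
      using Pw[of x] w by (metis inner_add_right)
    moreover have "x \<bullet> (A *v w) = w \<bullet> (A *v x)"
      by (simp only: symmetric_inner[OF A, of x w] inner_commute[of w])
    ultimately show ?thesis
      unfolding Sx w[symmetric] by (simp add: matrix_vector_mult_diff_distrib inner_diff_left inner_diff_right)
  qed
  have "0 \<le> (?P' *v (A *v x)) \<bullet> (A *v x)"
  proof -
    have "0 \<le> w \<bullet> ((A + B) *v w)" for w
      using P by (cases "w = 0") (auto simp: posdef_def less_imp_le)
    from this[of "?P' *v (A *v x)"] show ?thesis
      using Pw[of x] by (simp add: matrix_vector_mult_add_rdistrib)
  qed
  then show "x \<bullet> (S *v x) \<le> x \<bullet> (A *v x)" unfolding Sx by simp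
qed

text \<open>In the decomposition at the minimiser \<open>w\<close>, either \<open>w = 0\<close> and
  the term of \<open>A\<close> at \<open>x\<close> is positive, or the term of \<open>B\<close> at
  \<open>w\<close> is. This is what entitles \<open>Sig\<close> to a Cholesky factor.\<close>

lemma posdef_parallel_sum:
  assumes A: "posdef A" and B: "posdef B" and P: "posdef (A + B)"
  shows "posdef (A ** matrix_inv (A + B) ** B)"
proof -
  have sym: "transpose A = A" "transpose B = B" using A B by (auto simp: posdef_def)
  have A0: "0 \<le> x \<bullet> (A *v x)" and B0: "0 \<le> x \<bullet> (B *v x)" for x
    using A B by (cases "x = 0"; force simp: posdef_def less_imp_le)+
  have "0 < x \<bullet> ((A ** matrix_inv (A + B) ** B) *v x)" if "x \<noteq> 0" for x
  proof (cases "matrix_inv (A + B) *v (A *v x) = 0")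
    case True
    then show ?thesis
      using parallel_sum(2)[OF sym P refl, of x] A that by (simp add: posdef_def)
  next
    case False
    then have "0 < (matrix_inv (A + B) *v (A *v x)) \<bullet> (B *v (matrix_inv (A + B) *v (A *v x)))"
      using B unfolding posdef_def by blast
    then show ?thesis
      unfolding parallel_sum(2)[OF sym P refl, of x] by (intro add_nonneg_pos A0)
  qed
  then show ?thesis using parallel_sum(1)[OF sym P] by (simp add: posdef_def)
qed

text \<open>Here \<open>A\<close> or \<open>B\<close> may be degenerate, as happens when the time
  considered is an end point of its cell.\<close>

lemma parallel_sum_bounds:
  fixes A B :: "((real, 'n::{finite,linorder}) vec, 'n) vec"
  assumes A: "transpose A = A" "\<And>x. 0 \<le> x \<bullet> (A *v x)" and B: "transpose B = B" "\<And>x. 0 \<le> x \<bullet> (B *v x)"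
    and P: "posdef (A + B)"
  shows "0 \<le> x \<bullet> ((A ** matrix_inv (A + B) ** B) *v x)" "x \<bullet> ((A ** matrix_inv (A + B) ** B) *v x) \<le> x \<bullet> (A *v x)"
  using parallel_sum(2)[OF A(1) B(1) P refl, of x] parallel_sum(3)[OF A(1) B(1) P, of x] A(2) B(2)
  by (auto intro: add_nonneg_nonneg)

text \<open>The bridge on an interval splits at an interior point: \<open>A\<close> and \<open>B\<close> are the covariances of
the two halves, and the three identities treat \<open>s \<le> t\<close> both left of the split, on either
side of it, and both right of it.\<close>
lemma bridge_split:
  fixes A B :: "((real, 'n::{finite,linorder}) vec, 'n) vec"
  assumes A: "posdef A" and B: "posdef B" and P: "posdef (A + B)"
  defines "S \<equiv> A ** matrix_inv (A + B) ** B"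
  shows "b + c = A \<Longrightarrow> a ** matrix_inv (A + B) ** (c + B)
          = a ** matrix_inv A ** S ** (matrix_inv A ** b) + a ** matrix_inv A ** c"
    and "a ** matrix_inv (A + B) ** d = a ** matrix_inv A ** S ** (matrix_inv B ** d)"
    and "e + f = B \<Longrightarrow> (A + e) ** matrix_inv (A + B) ** d
          = f ** matrix_inv B ** S ** (matrix_inv B ** d) + e ** matrix_inv B ** d"
proof -
  note invs = posdef_matrix_inv(1,2)[OF A] posdef_matrix_inv(1,2)[OF B] posdef_matrix_inv(1,2)[OF P]
  note canc = invs invs[THEN matrix_cancel]
  let ?P' = "matrix_inv (A + B)"
  \<comment> \<open>Resolvent identities comparing the inverses of \<open>A\<close> and
    \<open>B\<close> with that of \<open>A + B\<close>; they absorb the left-over bridge on one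
    half.\<close>
  have 1: "matrix_inv A = ?P' + ?P' ** B ** matrix_inv A"
  proof -
    have "matrix_inv A = ?P' ** (A + B) ** matrix_inv A" by (simp add: canc)
    also have "\<dots> = ?P' + ?P' ** B ** matrix_inv A"
      by (simp only: matrix_distribs canc)
    finally show ?thesis .
  qed
  have 2: "matrix_inv B = ?P' + matrix_inv B ** A ** ?P'"
  proof -
    have "matrix_inv B = matrix_inv B ** (A + B) ** ?P'" by (simp only: canc)
    also have "\<dots> = ?P' + matrix_inv B ** A ** ?P'"
      by (simp only: matrix_distribs canc matrix_mul_lid add.commute)
    finally show ?thesis .
  qed
  show "a ** ?P' ** d = a ** matrix_inv A ** S ** (matrix_inv B ** d)"
    by (simp only: S_def matrix_mul_assoc canc)
  show "a ** ?P' ** (c + B) = a ** matrix_inv A ** S ** (matrix_inv A ** b) + a ** matrix_inv A ** c" if "b + c = A"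
  proof -
    have b: "b = A - c" using that by (simp add: eq_diff_eq)
    have "a ** matrix_inv A ** S ** (matrix_inv A ** b) + a ** matrix_inv A ** c
        = a ** ?P' ** B - a ** (?P' ** B ** matrix_inv A) ** c + a ** matrix_inv A ** c"
      unfolding b by (simp only: S_def matrix_mul_assoc canc matrix_distribs matrix_mul_rid)
    also have "\<dots> = a ** ?P' ** B - a ** (?P' ** B ** matrix_inv A) ** c + a ** (?P' + ?P' ** B ** matrix_inv A) ** c"
      using 1 by (simp only:)
    also have "\<dots> = a ** ?P' ** (c + B)"
      by (simp only: matrix_distribs matrix_mul_assoc) simp
    finally show ?thesis by simp
  qed
  show "(A + e) ** ?P' ** d = f ** matrix_inv B ** S ** (matrix_inv B ** d) + e ** matrix_inv B ** d" if "e + f = B"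
  proof -
    have f: "f = B - e" using that by (simp add: eq_diff_eq add.commute)
    have "f ** matrix_inv B ** S ** (matrix_inv B ** d) + e ** matrix_inv B ** d
        = A ** ?P' ** d - e ** (matrix_inv B ** A ** ?P') ** d + e ** matrix_inv B ** d"
      unfolding f by (simp only: S_def matrix_mul_assoc canc matrix_distribs matrix_mul_lid)
    also have "\<dots> = A ** ?P' ** d - e ** (matrix_inv B ** A ** ?P') ** d + e ** (?P' + matrix_inv B ** A ** ?P') ** d"
      using 2 by (simp only:)
    also have "\<dots> = (A + e) ** ?P' ** d"
      by (simp only: matrix_distribs matrix_mul_assoc) simp
    finally show ?thesis by simp
  qed
qed

section \<open>Covariances transported to time 0, and bridge kernels\<close>

lemma transpose_zero: "transpose (0 :: real^'n^'m) = 0"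
  by (simp add: vec_eq_iff transpose_def)

locale gauss_markov_flow = linear_flow \<alpha> F
  for \<alpha> :: "real \<Rightarrow> ((real, 'd::{finite,linorder}) vec, 'd) vec" and F +
  fixes sG :: "real \<Rightarrow> ((real,'m::finite) vec,'d) vec"
  assumes cont_sG: "continuous_on {0..1} sG"
    and nondeg: "\<And>u v. 0 \<le> u \<Longrightarrow> u < v \<Longrightarrow> v \<le> 1 \<Longrightarrow>
          posdef (F u v ** hu F sG u u v ** transpose (F u v))"
begin

text \<open>\<open>h a b\<close> is the covariance of the increment over \<open>[a, b]\<close> of
  the process transported to time 0 by \<open>F w 0\<close>, and \<open>D\<close> is its density;
  the transported increments carry no drift, whence additivity.\<close>

abbreviation "h \<equiv> hu F sG 0"
abbreviation "D \<equiv> \<lambda>w. F w 0 ** Gam sG w ** transpose (F w 0)"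

lemma flow_inverse:
  assumes "t \<in> {0..1}"
  shows "F t 0 ** F 0 t = mat 1" "F 0 t ** F t 0 = mat 1"
    "transpose (F 0 t) ** transpose (F t 0) = mat 1" "transpose (F t 0) ** transpose (F 0 t) = mat 1"
    "matrix_inv (F 0 t) = F t 0"
proof -
  show 1: "F t 0 ** F 0 t = mat 1" "F 0 t ** F t 0 = mat 1"
    using assms by (simp_all add: flow_mult flow_init)
  then show "transpose (F 0 t) ** transpose (F t 0) = mat 1" "transpose (F t 0) ** transpose (F 0 t) = mat 1"
    by (simp_all add: matrix_transpose_mul[symmetric])
  show "matrix_inv (F 0 t) = F t 0" by (rule matrix_inv_eq[OF 1(2)])
qed

lemma continuous_D: "continuous_on {0..1} D"
  unfolding Gam_def by (intro continuous_intros cont_sG flow_continuous_left) auto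

lemma D_integrable: "0 \<le> a \<Longrightarrow> b \<le> 1 \<Longrightarrow> D integrable_on {a..b}"
  by (rule integrable_continuous_real[OF continuous_on_subset[OF continuous_D]]) auto

lemma h_add: "0 \<le> a \<Longrightarrow> a \<le> b \<Longrightarrow> b \<le> c \<Longrightarrow> c \<le> 1 \<Longrightarrow> h a b + h b c = h a c"
  unfolding hu_def by (intro Henstock_Kurzweil_Integration.integral_combine D_integrable) auto

lemma h_self [simp]: "h a a = 0"
  by (simp add: hu_def)

text \<open>Since \<open>F w u = F 0 u ** F w 0\<close>, changing the base point is a congruence by
  \<open>F 0 u\<close>, and every \<open>hu\<close> reduces to \<open>h\<close>.\<close>

lemma hu_eq:
  assumes "u \<in> {0..1}" "0 \<le> s" "t \<le> 1"
  shows "hu F sG u s t = F 0 u ** h s t ** transpose (F 0 u)"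
proof -
  have "bounded_linear (\<lambda>X. F 0 u ** X ** transpose (F 0 u))"
    by (intro bounded_linear_compose[OF bounded_bilinear.bounded_linear_left[OF bounded_bilinear_matrix_matrix_mult]
          bounded_bilinear.bounded_linear_right[OF bounded_bilinear_matrix_matrix_mult]])
  from integral_linear[OF D_integrable[OF assms(2,3)] this]
  have "F 0 u ** h s t ** transpose (F 0 u) = integral {s..t} (\<lambda>w. F 0 u ** D w ** transpose (F 0 u))"
    by (simp add: hu_def o_def)
  also have "\<dots> = hu F sG u s t"
    unfolding hu_def
  proof (rule integral_cong)
    fix w assume "w \<in> {s..t}"
    then have "F w u = F 0 u ** F w 0" using assms by (simp add: flow_mult)
    then show "F 0 u ** D w ** transpose (F 0 u) = F w u ** Gam sG w ** transpose (F w u)"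
      by (simp add: matrix_transpose_mul matrix_mul_assoc)
  qed
  finally show ?thesis by simp
qed

lemma h_posdef:
  assumes "0 \<le> u" "u < v" "v \<le> 1"
  shows "posdef (h u v)"
proof -
  have u: "u \<in> {0..1}" and v: "v \<in> {0..1}" using assms by auto
  have "F u v ** hu F sG u u v ** transpose (F u v) = (F u v ** F 0 u) ** h u v ** transpose (F u v ** F 0 u)"
    by (simp only: hu_eq[OF u assms(1,3)] matrix_transpose_mul matrix_mul_assoc)
  also have "F u v ** F 0 u = F 0 v" using u v by (simp add: flow_mult)
  finally have "posdef (F 0 v ** h u v ** transpose (F 0 v))" using nondeg[OF assms] by simp
  from posdef_congruence[OF this flow_inverse(1)[OF v]]
  show ?thesis
    by (simp only: matrix_mul_assoc flow_inverse[OF v] flow_inverse(1-4)[OF v, THEN matrix_cancel] matrix_mul_lid)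
qed

lemma h_psd:
  assumes "0 \<le> u" "u \<le> v" "v \<le> 1"
  shows "transpose (h u v) = h u v" "0 \<le> x \<bullet> (h u v *v x)"
proof -
  have "posdef (h u v)" if "u \<noteq> v" using assms that by (intro h_posdef) auto
  then have *: "transpose (h u v) = h u v \<and> 0 \<le> x \<bullet> (h u v *v x)"
  proof (cases "u = v")
    case False
    with \<open>u \<noteq> v \<Longrightarrow> posdef (h u v)\<close> have "posdef (h u v)" .
    then show ?thesis by (cases "x = 0") (auto simp: posdef_def intro: less_imp_le)
  qed (simp add: transpose_zero)
  then show "transpose (h u v) = h u v" "0 \<le> x \<bullet> (h u v *v x)" by auto
qed

text \<open>The linear dependence on the length is what later makes the diagonal remainder decay
  like the cells.\<close>

lemma h_quadratic_bound:
  obtains C where "0 \<le> C" "\<And>a b x. 0 \<le> a \<Longrightarrow> a \<le> b \<Longrightarrow> b \<le> 1 \<Longrightarrow> x \<bullet> (h a b *v x) \<le> C * (b - a) * (norm x)\<^sup>2"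
proof -
  obtain K where K: "0 \<le> K" "\<And>t x. t \<in> {0..1} \<Longrightarrow> norm (D t *v x) \<le> K * norm x"
    using continuous_on_bounded_matrix_vector_mult[OF continuous_D] by blast
  have "x \<bullet> (h a b *v x) \<le> K * (b - a) * (norm x)\<^sup>2" if ab: "0 \<le> a" "a \<le> b" "b \<le> 1" for a b x
  proof -
    have "bounded_linear (\<lambda>A. A *v x)"
      by (rule bounded_bilinear.bounded_linear_left[OF bounded_bilinear_matrix_vector_mult])
    from integral_linear[OF D_integrable[OF ab(1,3)] this]
    have "h a b *v x = integral {a..b} (\<lambda>w. D w *v x)" by (simp add: hu_def o_def)
    moreover have "norm (integral {a..b} (\<lambda>w. D w *v x)) \<le> K * norm x * (b - a)"
      using ab by (intro integral_bound continuous_intros continuous_on_subset[OF continuous_D] K(2)) auto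
    ultimately have "norm x * norm (h a b *v x) \<le> norm x * (K * norm x * (b - a))"
      by (intro mult_left_mono) auto
    then have "x \<bullet> (h a b *v x) \<le> norm x * (K * norm x * (b - a))"
      using norm_cauchy_schwarz[of x "h a b *v x"] by linarith
    then show ?thesis by (simp add: power2_eq_square mult_ac)
  qed
  then show ?thesis using that K(1) by blast
qed

text \<open>Covariance kernel at \<open>(s, t)\<close>, \<open>s \<le> t\<close>, of the process conditioned on its values at \<open>l\<close> and \<open>r\<close>.\<close>
definition bridge :: "real \<Rightarrow> real \<Rightarrow> real \<Rightarrow> real \<Rightarrow> ((real, 'd) vec, 'd) vec" where
  "bridge l r s t = (if l \<le> s \<and> t \<le> r
     then F 0 s ** (h l s ** matrix_inv (h l r) ** h t r) ** transpose (F 0 t) else 0)"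

text \<open>All three factors are congruent to values of \<open>h\<close> through the same
  \<open>F 0 m\<close>, and the inner flow matrices cancel. As \<open>h l r = h l m + h m r\<close>,
  a parallel sum remains.\<close>

lemma Sig_eq:
  assumes "0 \<le> l" "l < m" "m < r" "r \<le> 1"
  shows "Sig F sG l m r = F 0 m ** (h l m ** matrix_inv (h l r) ** h m r) ** transpose (F 0 m)"
proof -
  have m: "m \<in> {0..1}" using assms by auto
  note inv = flow_inverse[OF m]
  have P: "posdef (h l r)" using assms by (intro h_posdef) auto
  note P' = posdef_matrix_inv[OF P]
  have "matrix_inv (hu F sG m l r) = transpose (F m 0) ** matrix_inv (h l r) ** F m 0"
  proof (rule matrix_inv_eq)
    show "hu F sG m l r ** (transpose (F m 0) ** matrix_inv (h l r) ** F m 0) = mat 1"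
      unfolding hu_eq[OF m assms(1,4)]
      by (simp only: matrix_mul_assoc inv inv(1-4)[THEN matrix_cancel] P' P'(1,2)[THEN matrix_cancel])
  qed
  moreover have "hu F sG m l m = F 0 m ** h l m ** transpose (F 0 m)" "hu F sG m m r = F 0 m ** h m r ** transpose (F 0 m)"
    using assms m by (intro hu_eq[OF m]; simp)+
  ultimately show ?thesis
    unfolding Sig_def by (simp only: matrix_mul_assoc inv(1-4)[THEN matrix_cancel])
qed

text \<open>The first term is the covariance explained by the value at time 1, the second what
  remains after pinning it; they add up because \<open>h 0 t + h t 1 = h 0 1\<close>.\<close>

lemma psi_root:
  assumes "0 \<le> s" "s \<le> t" "t \<le> 1"
  shows "psi F sG lp mp rp 0 k s ** transpose (psi F sG lp mp rp 0 k t) + bridge 0 1 s t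
      = F 0 s ** h 0 s ** transpose (F 0 t)"
proof -
  have inv: "F 1 0 ** F 0 1 = mat 1" "F 0 1 ** F 1 0 = mat 1" "transpose (F 0 1) ** transpose (F 1 0) = mat 1"
      "matrix_inv (F 0 1) = F 1 0"
    using flow_inverse[of 1] by auto
  have P: "posdef (h 0 1)" by (rule h_posdef) auto
  note P' = posdef_matrix_inv[OF P]
  define \<sigma> where "\<sigma> = chol (F 0 1 ** h 0 1 ** transpose (F 0 1))"
  have \<sigma>: "\<sigma> ** transpose \<sigma> = F 0 1 ** h 0 1 ** transpose (F 0 1)"
    unfolding \<sigma>_def by (intro chol_mult_transpose posdef_congruence[OF P inv(2)])
  have psi: "psi F sG lp mp rp 0 k r = F 0 r ** h 0 r ** matrix_inv (h 0 1) ** F 1 0 ** \<sigma>" for r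
    by (simp add: psi_def gfl_def Let_def inv \<sigma>_def matrix_mul_assoc)
  have h0t: "transpose (h 0 t) = h 0 t" using assms by (intro h_psd) auto
  have "psi F sG lp mp rp 0 k s ** transpose (psi F sG lp mp rp 0 k t)
      = F 0 s ** h 0 s ** matrix_inv (h 0 1) ** F 1 0 ** (\<sigma> ** transpose \<sigma>) ** transpose (F 1 0) ** matrix_inv (h 0 1) ** h 0 t ** transpose (F 0 t)"
    unfolding psi by (simp only: matrix_transpose_mul P'(3) h0t matrix_mul_assoc)
  also have "\<dots> = F 0 s ** h 0 s ** matrix_inv (h 0 1) ** h 0 t ** transpose (F 0 t)"
    unfolding \<sigma> by (simp only: matrix_mul_assoc inv(1-3)[THEN matrix_cancel] P'(1,2)[THEN matrix_cancel])
  also have "\<dots> + bridge 0 1 s t = F 0 s ** h 0 s ** matrix_inv (h 0 1) ** (h 0 t + h t 1) ** transpose (F 0 t)"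
    using assms by (simp add: bridge_def matrix_distribs matrix_mul_assoc)
  also have "h 0 t + h t 1 = h 0 1" using assms by (intro h_add) auto
  also have "F 0 s ** h 0 s ** matrix_inv (h 0 1) ** h 0 1 ** transpose (F 0 t) = F 0 s ** h 0 s ** transpose (F 0 t)"
    by (simp only: P'(1,2)[THEN matrix_cancel])
  finally show ?thesis .
qed

text \<open>Conditioning in addition on the value at the midpoint removes from the kernel exactly
  the covariance explained by that value, and leaves two bridges, independent by the Markov
  property.\<close>

lemma psi_split:
  assumes lmr: "0 \<le> lp n k" "lp n k < mp n k" "mp n k < rp n k" "rp n k \<le> 1" and n: "n \<noteq> 0"
    and st: "0 \<le> s" "s \<le> t" "t \<le> 1"
  shows "bridge (lp n k) (rp n k) s t = psi F sG lp mp rp n k s ** transpose (psi F sG lp mp rp n k t)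
      + (bridge (lp n k) (mp n k) s t + bridge (mp n k) (rp n k) s t)"
proof -
  define l m r where "l = lp n k" and "m = mp n k" and "r = rp n k"
  have lmr': "0 \<le> l" "l < m" "m < r" "r \<le> 1" using lmr by (simp_all add: l_def m_def r_def)
  have m: "m \<in> {0..1}" using lmr' by auto
  note inv = flow_inverse[OF m]
  have A: "posdef (h l m)" and B: "posdef (h m r)" and P: "posdef (h l m + h m r)"
    using lmr' h_add[of l m r] by (auto intro!: h_posdef)
  have P_eq: "h l r = h l m + h m r" using lmr' h_add[of l m r] by simp
  note A' = posdef_matrix_inv[OF A] and B' = posdef_matrix_inv[OF B]
  define S where "S = h l m ** matrix_inv (h l m + h m r) ** h m r"
  define \<sigma> where "\<sigma> = chol (Sig F sG l m r)"
  have \<sigma>: "\<sigma> ** transpose \<sigma> = F 0 m ** S ** transpose (F 0 m)"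
  proof -
    have "Sig F sG l m r = F 0 m ** S ** transpose (F 0 m)"
      using lmr' by (simp add: Sig_eq S_def P_eq)
    moreover have "posdef (F 0 m ** S ** transpose (F 0 m))"
      unfolding S_def by (intro posdef_congruence[OF posdef_parallel_sum[OF A B P] inv(2)])
    ultimately show ?thesis by (simp add: \<sigma>_def chol_mult_transpose)
  qed
  \<comment> \<open>The coefficient at time 0 of the regression on the midpoint value, taken from
    the end \<open>l\<close> on the left half and from \<open>r\<close> on the right half.\<close>
  define V where "V x = (if x \<le> m then h l x ** matrix_inv (h l m) else h x r ** matrix_inv (h m r))" for x
  have psi_in: "psi F sG lp mp rp n k x = F 0 x ** V x ** F m 0 ** \<sigma>" if "l \<le> x" "x \<le> r" for x
    using that n by (simp add: psi_def gfl_def Let_def l_def[symmetric] m_def[symmetric] r_def[symmetric] inv V_def \<sigma>_def[symmetric] matrix_mul_assoc)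
  have psi_out: "psi F sG lp mp rp n k x = 0" if "x < l \<or> r < x" for x
    using that n lmr' by (auto simp: psi_def gfl_def Let_def l_def[symmetric] m_def[symmetric] r_def[symmetric])
  have VR: "V x = h x r ** matrix_inv (h m r)" if "m \<le> x" for x
    using that A'(1) B'(1) by (cases "x = m") (auto simp: V_def)
  have transV: "transpose (V x) = (if x \<le> m then matrix_inv (h l m) ** h l x else matrix_inv (h m r) ** h x r)" if "l \<le> x" "x \<le> r" for x
    using that lmr' A'(3) B'(3) by (simp add: V_def matrix_transpose_mul h_psd(1))
  show ?thesis
  proof (cases "l \<le> s \<and> t \<le> r")
    case False
    then have "psi F sG lp mp rp n k s ** transpose (psi F sG lp mp rp n k t) = 0"
      using psi_out[of s] psi_out[of t]
      using st by (auto simp: matrix_distribs transpose_zero not_le)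
    with False lmr' show ?thesis
      by (auto simp: bridge_def l_def[symmetric] m_def[symmetric] r_def[symmetric])
  next
    case True
    have sr: "l \<le> s" "s \<le> r" "l \<le> t" "t \<le> r" using True st by auto
    have prod: "psi F sG lp mp rp n k s ** transpose (psi F sG lp mp rp n k t)
        = F 0 s ** (V s ** S ** transpose (V t)) ** transpose (F 0 t)"
    proof -
      have "psi F sG lp mp rp n k s ** transpose (psi F sG lp mp rp n k t)
        = F 0 s ** V s ** F m 0 ** (\<sigma> ** transpose \<sigma>) ** transpose (F m 0) ** transpose (V t) ** transpose (F 0 t)"
        using sr by (simp only: psi_in matrix_transpose_mul matrix_mul_assoc)
      then show ?thesis
        unfolding \<sigma> by (simp only: matrix_mul_assoc inv(1-4)[THEN matrix_cancel])
    qed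
    have kernel: "h l s ** matrix_inv (h l m + h m r) ** h t r = V s ** S ** transpose (V t)
        + ((if t \<le> m then h l s ** matrix_inv (h l m) ** h t m else 0)
         + (if m \<le> s then h m s ** matrix_inv (h m r) ** h t r else 0))"
    proof -
      consider "t \<le> m" | "s \<le> m" "m < t" | "m < s" by linarith
      then show ?thesis
      proof cases
        case 1
        have "h t r = h t m + h m r" "h l t + h t m = h l m"
          using 1 sr lmr' by (simp_all add: h_add)
        moreover have "V s = h l s ** matrix_inv (h l m)" using 1 st by (simp add: V_def)
        moreover have "transpose (V t) = matrix_inv (h l m) ** h l t" using transV[of t] 1 sr by simp
        \<comment> \<open>At \<open>s = m\<close> the condition holds, but then the kernel contains
          the factor \<open>h m m\<close>, which is zero.\<close>
        moreover have "(if m \<le> s then h m s ** matrix_inv (h m r) ** h t r else 0) = 0"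
          using 1 st by (cases "s = m") (auto simp: matrix_distribs)
        ultimately show ?thesis
          using 1 bridge_split(1)[OF A B P, of "h l t" "h t m" "h l s"] by (simp add: S_def)
      next
        case 2
        have "V s = h l s ** matrix_inv (h l m)" using 2 by (simp add: V_def)
        moreover have "transpose (V t) = matrix_inv (h m r) ** h t r" using transV[of t] 2 sr by simp
        moreover have "(if m \<le> s then h m s ** matrix_inv (h m r) ** h t r else 0) = 0"
          using 2 by (auto simp: matrix_distribs)
        ultimately show ?thesis
          using 2 bridge_split(2)[OF A B P, of "h l s" "h t r"] by (simp add: S_def)
      next
        case 3
        have "h l s = h l m + h m s" "h m s + h s r = h m r"
          using 3 sr lmr' by (simp_all add: h_add)
        moreover have "V s = h s r ** matrix_inv (h m r)" using 3 by (simp add: V_def)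
        moreover have "transpose (V t) = matrix_inv (h m r) ** h t r" using transV[of t] 3 st sr by simp
        ultimately show ?thesis
          using 3 st bridge_split(3)[OF A B P, of "h m s" "h s r" "h t r"] by (simp add: S_def)
      qed
    qed
    have "bridge l r s t = F 0 s ** (h l s ** matrix_inv (h l m + h m r) ** h t r) ** transpose (F 0 t)"
      using True by (simp add: bridge_def P_eq)
    also have "\<dots> = psi F sG lp mp rp n k s ** transpose (psi F sG lp mp rp n k t)
        + (bridge l m s t + bridge m r s t)"
      unfolding kernel prod using True by (simp add: bridge_def matrix_distribs)
    finally show ?thesis by (simp add: l_def m_def r_def)
  qed
qed

text \<open>Pinning the right end as well can only lower the variance, so the covariance from the
  left end bounds it. At \<open>t = l\<close> the bridge is zero, which permits the half-open
  condition and saves shared end points from being counted twice.\<close>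

lemma bridge_diagonal_bounds:
  assumes "0 \<le> l" "l < r" "r \<le> 1" and t: "t \<in> {0..1}"
  shows "0 \<le> u \<bullet> (bridge l r t t *v u)"
    and "u \<bullet> (bridge l r t t *v u) \<le> (if l < t \<and> t \<le> r then (transpose (F 0 t) *v u) \<bullet> (h l t *v (transpose (F 0 t) *v u)) else 0)"
proof -
  have *: "0 \<le> u \<bullet> (bridge l r t t *v u) \<and> u \<bullet> (bridge l r t t *v u) \<le> (transpose (F 0 t) *v u) \<bullet> (h l t *v (transpose (F 0 t) *v u))"
    if ltr: "l \<le> t" "t \<le> r"
  proof -
    have P: "h l t + h t r = h l r" using ltr assms by (intro h_add) auto
    have "posdef (h l t + h t r)" unfolding P using assms by (intro h_posdef) auto
    moreover have "transpose (h l t) = h l t" "0 \<le> x \<bullet> (h l t *v x)" "transpose (h t r) = h t r" "0 \<le> x \<bullet> (h t r *v x)" for x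
      using ltr assms by (auto intro!: h_psd)
    ultimately have b: "0 \<le> y \<bullet> ((h l t ** matrix_inv (h l r) ** h t r) *v y)"
        "y \<bullet> ((h l t ** matrix_inv (h l r) ** h t r) *v y) \<le> y \<bullet> (h l t *v y)" for y
      using parallel_sum_bounds[of "h l t" "h t r" y] unfolding P by auto
    have "u \<bullet> (bridge l r t t *v u) = u \<bullet> (F 0 t *v ((h l t ** matrix_inv (h l r) ** h t r) *v (transpose (F 0 t) *v u)))"
      using ltr by (simp only: bridge_def matrix_vector_mul_assoc matrix_mul_assoc if_True conj_absorb simp_thms)
    also have "\<dots> = (transpose (F 0 t) *v u) \<bullet> ((h l t ** matrix_inv (h l r) ** h t r) *v (transpose (F 0 t) *v u))"
      by (metis dot_lmul_matrix transpose_matrix_vector)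
    finally show ?thesis using b[of "transpose (F 0 t) *v u"] by (simp only: simp_thms)
  qed
  have zero: "bridge l r t t = 0" if "\<not> (l < t \<and> t \<le> r)"
    using that by (cases "t = l") (auto simp: bridge_def matrix_distribs)
  show "0 \<le> u \<bullet> (bridge l r t t *v u)"
    using * zero by (cases "l < t \<and> t \<le> r") auto
  show "u \<bullet> (bridge l r t t *v u) \<le> (if l < t \<and> t \<le> r then (transpose (F 0 t) *v u) \<bullet> (h l t *v (transpose (F 0 t) *v u)) else 0)"
    using * zero by (cases "l < t \<and> t \<le> r") (auto simp del: transpose_matrix_vector)
qed

end

section \<open>Summation over the nested partition\<close>

lemma sum_even_odd:
  fixes f :: "nat \<Rightarrow> 'v::comm_monoid_add"
  shows "(\<Sum>k<2 * m. f k) = (\<Sum>k<m. f (2 * k) + f (2 * k + 1))"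
  by (induction m) (simp_all add: add.assoc)

lemma IsetN_0: "IsetN 0 = {(0, 0)}"
  by (auto simp: IsetN_def)

lemma IsetN_Suc: "IsetN (Suc N) = IsetN N \<union> Pair (Suc N) ` {..<2^N}"
  by (auto simp: IsetN_def Iset_def le_Suc_eq)

lemma finite_IsetN: "finite (IsetN N)"
  by (induction N) (simp_all add: IsetN_0 IsetN_Suc)

lemma sum_IsetN_Suc:
  "(\<Sum>(n,k)\<in>IsetN (Suc N). f n k) = (\<Sum>(n,k)\<in>IsetN N. f n k) + (\<Sum>k<2^N. f (Suc N) k)"
proof -
  have "IsetN N \<inter> Pair (Suc N) ` {..<2^N} = {}"
    by (auto simp: IsetN_def)
  then show ?thesis
    unfolding IsetN_Suc by (subst sum.union_disjoint) (auto simp: finite_IsetN sum.reindex inj_on_def)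
qed

text \<open>Levels start at 1 and are written \<open>Suc N\<close>, so that a level has
  \<open>2^N\<close> cells without truncated subtraction.\<close>

locale dyadic_partition =
  fixes \<rho> :: real and lp mp rp :: "nat \<Rightarrow> nat \<Rightarrow> real"
  assumes rho: "0 < \<rho>" "\<rho> < 1"
    and part_order: "\<And>N k. k < 2^N \<Longrightarrow> lp (Suc N) k < mp (Suc N) k \<and> mp (Suc N) k < rp (Suc N) k"
    and part_root: "lp (Suc 0) 0 = 0" "rp (Suc 0) 0 = 1"
    and part_split: "\<And>N k. k < 2^N \<Longrightarrow>
          lp (Suc (Suc N)) (2*k) = lp (Suc N) k \<and> rp (Suc (Suc N)) (2*k) = mp (Suc N) k \<and>
          lp (Suc (Suc N)) (2*k+1) = mp (Suc N) k \<and> rp (Suc (Suc N)) (2*k+1) = rp (Suc N) k"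
    and part_ratio: "\<And>N k. k < 2^N \<Longrightarrow>
          max (rp (Suc N) k - mp (Suc N) k) (mp (Suc N) k - lp (Suc N) k) < \<rho> * (rp (Suc N) k - lp (Suc N) k)"
begin

lemma part_bounds:
  "k < 2^N \<Longrightarrow> 0 \<le> lp (Suc N) k \<and> rp (Suc N) k \<le> 1 \<and> rp (Suc N) k - lp (Suc N) k \<le> \<rho>^N"
proof (induction N arbitrary: k)
  case 0
  then show ?case by (simp add: part_root)
next
  case (Suc N)
  \<comment> \<open>The parent cell: even \<open>k\<close> is its left half, odd \<open>k\<close>
    its right half.\<close>
  define j where "j = k div 2"
  have j: "j < 2^N" using Suc.prems by (auto simp: j_def)
  have "\<rho> * (rp (Suc N) j - lp (Suc N) j) \<le> \<rho> * \<rho>^N"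
    using Suc.IH[OF j] rho by (intro mult_left_mono) auto
  moreover have "k = 2 * j \<or> k = 2 * j + 1" unfolding j_def by presburger
  ultimately show ?case
    using Suc.IH[OF j] part_split[OF j] part_order[OF j] part_ratio[OF j] by auto
qed

lemma sum_children:
  fixes f :: "real \<Rightarrow> real \<Rightarrow> 'v::comm_monoid_add"
  shows "(\<Sum>k<2^Suc N. f (lp (Suc (Suc N)) k) (rp (Suc (Suc N)) k))
     = (\<Sum>k<2^N. f (lp (Suc N) k) (mp (Suc N) k) + f (mp (Suc N) k) (rp (Suc N) k))"
  unfolding power_Suc sum_even_odd using part_split by (intro sum.cong) auto

text \<open>Splitting a half-open cell at its midpoint gives two disjoint half-open cells with the
  same union, so the count is the same at all levels.\<close>

lemma card_cells_containing:
  "(\<Sum>k<2^N. if lp (Suc N) k < t \<and> t \<le> rp (Suc N) k then 1 else 0 :: real) = (if 0 < t \<and> t \<le> 1 then 1 else 0)"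
proof (induction N)
  case 0
  then show ?case by (simp add: part_root)
next
  case (Suc N)
  have "(\<Sum>k<2^Suc N. if lp (Suc (Suc N)) k < t \<and> t \<le> rp (Suc (Suc N)) k then 1 else 0 :: real)
      = (\<Sum>k<2^N. (if lp (Suc N) k < t \<and> t \<le> mp (Suc N) k then 1 else 0) + (if mp (Suc N) k < t \<and> t \<le> rp (Suc N) k then 1 else 0))"
    by (rule sum_children[of "\<lambda>l r. if l < t \<and> t \<le> r then 1 else 0"])
  also have "\<dots> = (\<Sum>k<2^N. if lp (Suc N) k < t \<and> t \<le> rp (Suc N) k then 1 else 0)"
    by (intro sum.cong refl) (use part_order in force)
  finally show ?case using Suc.IH by simp
qed

end

locale gauss_markov_basis = gauss_markov_flow \<alpha> F sG + dyadic_partition \<rho> lp mp rp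
  for \<alpha> :: "real \<Rightarrow> ((real, 'd::{finite,linorder}) vec, 'd) vec" and F
    and sG :: "real \<Rightarrow> ((real,'m::finite) vec,'d) vec" and \<rho> lp mp rp
begin

abbreviation "\<psi> \<equiv> psi F sG lp mp rp"

text \<open>An invariant in \<open>N\<close>: passing to the next level replaces each bridge by its
  \<open>\<psi>\<close> term and the bridges of its two children.\<close>

lemma psi_kernel_sum:
  assumes "0 \<le> s" "s \<le> t" "t \<le> 1"
  shows "(\<Sum>(n,k)\<in>IsetN N. \<psi> n k s ** transpose (\<psi> n k t)) + (\<Sum>k<2^N. bridge (lp (Suc N) k) (rp (Suc N) k) s t)
     = F 0 s ** h 0 s ** transpose (F 0 t)"
proof (induction N)
  case 0
  then show ?case using psi_root[OF assms] by (simp add: IsetN_0 part_root)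
next
  case (Suc N)
  have "(\<Sum>k<2^N. \<psi> (Suc N) k s ** transpose (\<psi> (Suc N) k t)) + (\<Sum>k<2^Suc N. bridge (lp (Suc (Suc N)) k) (rp (Suc (Suc N)) k) s t)
     = (\<Sum>k<2^N. bridge (lp (Suc N) k) (rp (Suc N) k) s t)"
    unfolding sum_children[of "\<lambda>l r. bridge l r s t"] sum.distrib[symmetric]
    using part_bounds part_order assms by (intro sum.cong psi_split[symmetric]) auto
  then show ?case using Suc.IH unfolding sum_IsetN_Suc by (simp add: add.assoc)
qed

text \<open>Off the diagonal the remainder is eventually zero. On the diagonal only its quadratic
  form is estimated, which is why equal times must carry equal vectors.\<close>

lemma psi_inner_sum_le:
  assumes st: "0 \<le> s" "s \<le> t" "t \<le> 1" and xy: "s = t \<Longrightarrow> x = y"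
  shows "(\<lambda>N. \<Sum>(n,k)\<in>IsetN N. (transpose (\<psi> n k s) *v x) \<bullet> (transpose (\<psi> n k t) *v y))
     \<longlonglongrightarrow> (transpose (F 0 s) *v x) \<bullet> (h 0 s *v (transpose (F 0 t) *v y))"
proof -
  define c where "c = (transpose (F 0 s) *v x) \<bullet> (h 0 s *v (transpose (F 0 t) *v y))"
  define R where "R N = (\<Sum>k<2^N. x \<bullet> (bridge (lp (Suc N) k) (rp (Suc N) k) s t *v y))" for N
  have lin: "x \<bullet> ((\<Sum>i\<in>I. A i) *v y) = (\<Sum>i\<in>I. x \<bullet> (A i *v y))" for I and A :: "'z \<Rightarrow> ((real, 'd) vec, 'd) vec"
  proof -
    have "(\<Sum>i\<in>I. A i) *v y = (\<Sum>i\<in>I. A i *v y)"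
      by (rule bounded_bilinear.sum_left[OF bounded_bilinear_matrix_vector_mult])
    then show ?thesis by (simp add: inner_sum_right)
  qed
  have eq: "(\<Sum>(n,k)\<in>IsetN N. (transpose (\<psi> n k s) *v x) \<bullet> (transpose (\<psi> n k t) *v y)) = c - R N" for N
  proof -
    have mv: "x \<bullet> ((A ** transpose B) *v y) = (transpose A *v x) \<bullet> (transpose B *v y)" for A B :: "((real, 'd) vec, 'd) vec"
      by (simp only: matrix_vector_mul_assoc[symmetric] inner_matrix_vector_mult[of x A])
    have "x \<bullet> ((\<Sum>(n,k)\<in>IsetN N. \<psi> n k s ** transpose (\<psi> n k t)) *v y)
        = (\<Sum>(n,k)\<in>IsetN N. (transpose (\<psi> n k s) *v x) \<bullet> (transpose (\<psi> n k t) *v y))"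
      by (simp only: lin mv case_prod_unfold)
    moreover have "x \<bullet> ((\<Sum>k<2^N. bridge (lp (Suc N) k) (rp (Suc N) k) s t) *v y) = R N"
      by (simp only: lin R_def)
    moreover have "x \<bullet> ((F 0 s ** h 0 s ** transpose (F 0 t)) *v y) = c"
      unfolding c_def by (simp only: matrix_vector_mul_assoc[symmetric] inner_matrix_vector_mult[of x "F 0 s"])
    ultimately show ?thesis
      unfolding psi_kernel_sum[OF st, of N, symmetric]
      by (simp only: matrix_vector_mult_add_rdistrib inner_add_right add_diff_cancel_right')
  qed
  have "R \<longlonglongrightarrow> 0"
  proof (cases "s = t")
    case True
    obtain C where C: "0 \<le> C" "\<And>a b x. 0 \<le> a \<Longrightarrow> a \<le> b \<Longrightarrow> b \<le> 1 \<Longrightarrow> x \<bullet> (h a b *v x) \<le> C * (b - a) * (norm x)\<^sup>2"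
      by (rule h_quadratic_bound) blast
    define z where "z = transpose (F 0 t) *v x"
    have t: "t \<in> {0..1}" using st by auto
    \<comment> \<open>Of the \<open>2^N\<close> cell bounds at most one is nonzero, so their sum is
      of the order of a single cell length.\<close>
    have bd: "0 \<le> R N \<and> R N \<le> C * (norm z)\<^sup>2 * \<rho>^N" for N
    proof -
      have cell: "0 \<le> x \<bullet> (bridge (lp (Suc N) k) (rp (Suc N) k) t t *v x)"
          "x \<bullet> (bridge (lp (Suc N) k) (rp (Suc N) k) t t *v x)
           \<le> C * (norm z)\<^sup>2 * \<rho>^N * (if lp (Suc N) k < t \<and> t \<le> rp (Suc N) k then 1 else 0)" if k: "k < 2^N" for k
      proof -
        have lr: "0 \<le> lp (Suc N) k" "lp (Suc N) k < rp (Suc N) k" "rp (Suc N) k \<le> 1"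
          and len: "rp (Suc N) k - lp (Suc N) k \<le> \<rho>^N"
          using part_bounds[OF k] part_order[OF k] by auto
        note b = bridge_diagonal_bounds[OF lr t, of x, folded z_def]
        show "0 \<le> x \<bullet> (bridge (lp (Suc N) k) (rp (Suc N) k) t t *v x)" by (rule b)
        show "x \<bullet> (bridge (lp (Suc N) k) (rp (Suc N) k) t t *v x)
           \<le> C * (norm z)\<^sup>2 * \<rho>^N * (if lp (Suc N) k < t \<and> t \<le> rp (Suc N) k then 1 else 0)"
        proof (cases "lp (Suc N) k < t \<and> t \<le> rp (Suc N) k")
          case True
          have "z \<bullet> (h (lp (Suc N) k) t *v z) \<le> C * (t - lp (Suc N) k) * (norm z)\<^sup>2"
            using True lr by (intro C) auto
          also have "\<dots> \<le> C * \<rho>^N * (norm z)\<^sup>2"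
            using True len C(1) by (intro mult_right_mono mult_left_mono) auto
          finally show ?thesis using b(2) True by (simp add: mult_ac)
        qed (use b(2) in auto)
      qed
      have "R N \<le> (\<Sum>k<2^N. C * (norm z)\<^sup>2 * \<rho>^N * (if lp (Suc N) k < t \<and> t \<le> rp (Suc N) k then 1 else 0))"
        unfolding R_def True xy[OF True, symmetric] by (intro sum_mono cell) auto
      also have "\<dots> = C * (norm z)\<^sup>2 * \<rho>^N * (if 0 < t \<and> t \<le> 1 then 1 else 0)"
        by (simp only: sum_distrib_left[symmetric] card_cells_containing)
      also have "\<dots> \<le> C * (norm z)\<^sup>2 * \<rho>^N"
        using C(1) rho by auto
      finally have "R N \<le> C * (norm z)\<^sup>2 * \<rho>^N" .
      moreover have "0 \<le> R N"
        unfolding R_def True xy[OF True, symmetric] by (intro sum_nonneg cell) auto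
      ultimately show ?thesis by simp
    qed
    have "(\<lambda>N. C * (norm z)\<^sup>2 * \<rho>^N) \<longlonglongrightarrow> 0"
      using rho by (intro tendsto_mult_right_zero LIMSEQ_power_zero) auto
    then show ?thesis
      by (rule tendsto_sandwich[OF always_eventually always_eventually tendsto_const, rotated 2]) (use bd in auto)
  next
    case False
    \<comment> \<open>Once the cells are shorter than \<open>t - s\<close>, none contains both times
      and every bridge vanishes.\<close>
    then have "0 < t - s" using st by simp
    moreover have "(\<lambda>N. \<rho>^N) \<longlonglongrightarrow> 0" using rho by (intro LIMSEQ_power_zero) auto
    ultimately have "\<forall>\<^sub>F N in sequentially. \<rho>^N < t - s" by (rule order_tendstoD(2)[rotated])
    then have "\<forall>\<^sub>F N in sequentially. R N = 0"
    proof eventually_elim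
      case (elim N)
      have "bridge (lp (Suc N) k) (rp (Suc N) k) s t = 0" if "k < 2^N" for k
        using part_bounds[OF that] elim by (auto simp: bridge_def)
      then show ?case by (simp add: R_def)
    qed
    then show ?thesis by (rule tendsto_eventually)
  qed
  then have "(\<lambda>N. c - R N) \<longlonglongrightarrow> c - 0" by (intro tendsto_diff tendsto_const)
  then show ?thesis unfolding eq c_def[symmetric] by simp
qed

text \<open>Indexing the vectors by time guarantees equal vectors on the diagonal; the order of the
  two times is exchanged by symmetry of \<open>h\<close>.\<close>

lemma psi_inner_sum:
  assumes st: "s \<in> {0..1}" "t \<in> {0..1}"
  shows "(\<lambda>N. \<Sum>(n,k)\<in>IsetN N. (transpose (\<psi> n k s) *v u s) \<bullet> (transpose (\<psi> n k t) *v u t))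
     \<longlonglongrightarrow> (transpose (F 0 s) *v u s) \<bullet> (h 0 (min s t) *v (transpose (F 0 t) *v u t))"
proof (cases "s \<le> t")
  case True
  then show ?thesis using psi_inner_sum_le[of s t "u s" "u t"] st by (simp add: min_def del: transpose_matrix_vector)
next
  case False
  then have "(\<lambda>N. \<Sum>(n,k)\<in>IsetN N. (transpose (\<psi> n k t) *v u t) \<bullet> (transpose (\<psi> n k s) *v u s))
     \<longlonglongrightarrow> (transpose (F 0 t) *v u t) \<bullet> (h 0 t *v (transpose (F 0 s) *v u s))"
    using psi_inner_sum_le[of t s "u t" "u s"] st by (simp del: transpose_matrix_vector)
  moreover have "(transpose (F 0 t) *v u t) \<bullet> (h 0 t *v (transpose (F 0 s) *v u s))
      = (transpose (F 0 s) *v u s) \<bullet> (h 0 (min s t) *v (transpose (F 0 t) *v u t))"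
  proof -
    have "transpose (h 0 t) = h 0 t" using st by (intro h_psd) auto
    from symmetric_inner[OF this] show ?thesis
      using False by (simp add: min_def inner_commute del: transpose_matrix_vector)
  qed
  ultimately show ?thesis by (simp only: inner_commute[of "transpose (\<psi> _ _ t) *v u t"])
qed

end

section \<open>The variance of the solution as a covariance sum\<close>

context gauss_markov_flow
begin

text \<open>Factoring \<open>F w t\<close> as \<open>F 0 t ** F w 0\<close> moves the dependence on
  \<open>t\<close> into the vectors \<open>x t\<close>. Expanding the square then leaves the density
  \<open>D w\<close>, integrated over the times below both \<open>s\<close> and
  \<open>t\<close>.\<close>

lemma variance_eq_kernel_sum:
  assumes T: "finite T" "T \<subseteq> {0..1}"
  shows "(\<integral>w. (norm (\<Sum>t\<in>T. if 0 < w \<and> w \<le> t then transpose (sG w) *v (transpose (F w t) *v u t) else 0))\<^sup>2 \<partial>lborel)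
    = (\<Sum>s\<in>T. \<Sum>t\<in>T. (transpose (F 0 s) *v u s) \<bullet> (h 0 (min s t) *v (transpose (F 0 t) *v u t)))"
proof -
  define x where "x t = transpose (F 0 t) *v u t" for t
  define k where "k s t w = x s \<bullet> (D w *v x t)" for s t w
  have kcont: "continuous_on {0..1} (k s t)" for s t
    unfolding k_def by (intro continuous_intros continuous_D)
  have int: "((k s t) has_integral (x s \<bullet> (h 0 r *v x t))) {0..r}" if "r \<in> {0..1}" for s t r
  proof -
    have "bounded_linear (\<lambda>A. x s \<bullet> (A *v x t))"
      by (intro bounded_linear_compose[OF bounded_linear_inner_right]
          bounded_bilinear.bounded_linear_left[OF bounded_bilinear_matrix_vector_mult])
    from has_integral_linear[OF integrable_integral[OF D_integrable[of 0 r]] this] that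
    show ?thesis by (simp add: k_def[abs_def] o_def hu_def)
  qed
  have leb: "integrable lborel (\<lambda>w. indicator {0<..r} w *\<^sub>R k s t w)
      \<and> (\<integral>w. indicator {0<..r} w *\<^sub>R k s t w \<partial>lborel) = x s \<bullet> (h 0 r *v x t)" if r: "r \<in> {0..1}" for s t r
  proof -
    have si: "set_integrable lborel {0..r} (k s t)"
      using r by (intro borel_integrable_atLeastAtMost' continuous_on_subset[OF kcont]) auto
    then have closed: "integrable lborel (\<lambda>w. indicator {0..r} w *\<^sub>R k s t w)"
        "(\<integral>w. indicator {0..r} w *\<^sub>R k s t w \<partial>lborel) = x s \<bullet> (h 0 r *v x t)"
      using set_borel_integral_eq_integral(2)[OF si] int[OF r, of s t]
      by (simp_all add: set_integrable_def set_lebesgue_integral_def integral_unique)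
    have m: "(\<lambda>w. indicator {0<..r} w *\<^sub>R k s t w) \<in> borel_measurable lborel"
    proof -
      have "{0<..r} \<subseteq> {0..1}" using r by auto
      from borel_measurable_continuous_on_indicator[OF _ continuous_on_subset[OF kcont this], of s t]
      show ?thesis by simp
    qed
    \<comment> \<open>The integral in \<open>hu\<close> runs over a closed interval, the step
      functions over half-open ones; they differ in the null set containing 0.\<close>
    have ae: "AE w in lborel. indicator {0..r} w *\<^sub>R k s t w = indicator {0<..r} w *\<^sub>R k s t w"
      using AE_lborel_singleton[of 0] by eventually_elim (auto simp: indicator_def)
    show ?thesis
      using closed integrable_cong_AE_imp[OF closed(1) m] integral_cong_AE[OF _ m ae] ae by auto
  qed
  have pt: "(norm (\<Sum>t\<in>T. if 0 < w \<and> w \<le> t then transpose (sG w) *v (transpose (F w t) *v u t) else 0))\<^sup>2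
     = (\<Sum>s\<in>T. \<Sum>t\<in>T. indicator {0<..min s t} w *\<^sub>R k s t w)" for w
  proof -
    have "(if 0 < w \<and> w \<le> s then transpose (sG w) *v (transpose (F w s) *v u s) else 0) \<bullet>
        (if 0 < w \<and> w \<le> t then transpose (sG w) *v (transpose (F w t) *v u t) else 0)
        = indicator {0<..min s t} w *\<^sub>R k s t w" if "s \<in> T" "t \<in> T" for s t
    proof (cases "0 < w \<and> w \<le> s \<and> w \<le> t")
      case True
      have fl: "transpose (F w r) *v u r = transpose (F w 0) *v x r" if "r \<in> T" "w \<le> r" for r
      proof -
        have "F w r = F 0 r ** F w 0" using that T True by (subst flow_mult) auto
        then show ?thesis
          by (simp only: x_def matrix_transpose_mul matrix_vector_mul_assoc)
      qed
      have "(transpose (sG w) *v (transpose (F w 0) *v x s)) \<bullet> (transpose (sG w) *v (transpose (F w 0) *v x t)) = k s t w"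
      proof -
        have "p \<bullet> (A *v (B *v q)) = (transpose B *v (transpose A *v p)) \<bullet> q"
          for p :: "(real, 'd) vec" and A :: "((real, 'd) vec, 'd) vec" and B :: "((real, 'm) vec, 'd) vec" and q
          by (simp only: inner_matrix_vector_mult[of p A] inner_matrix_vector_mult[of _ B])
        then show ?thesis
          by (simp only: k_def Gam_def matrix_vector_mul_assoc[symmetric])
      qed
      then show ?thesis using True that by (simp only: fl) simp
    qed (auto simp: indicator_def)
    then show ?thesis
      by (simp only: power2_norm_eq_inner inner_sum_left inner_sum_right) (intro sum.cong refl; simp add: inner_commute)
  qed
  have "(\<integral>w. (norm (\<Sum>t\<in>T. if 0 < w \<and> w \<le> t then transpose (sG w) *v (transpose (F w t) *v u t) else 0))\<^sup>2 \<partial>lborel)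
      = (\<integral>w. (\<Sum>s\<in>T. \<Sum>t\<in>T. indicator {0<..min s t} w *\<^sub>R k s t w) \<partial>lborel)"
    by (simp only: pt)
  also have "\<dots> = (\<Sum>s\<in>T. \<Sum>t\<in>T. (\<integral>w. indicator {0<..min s t} w *\<^sub>R k s t w \<partial>lborel))"
  proof -
    have i: "integrable lborel (\<lambda>w. indicator {0<..min s t} w *\<^sub>R k s t w)" if "s \<in> T" "t \<in> T" for s t
      using leb[of "min s t" s t] that T by (auto simp: min_def)
    then have "(\<integral>w. (\<Sum>s\<in>T. \<Sum>t\<in>T. indicator {0<..min s t} w *\<^sub>R k s t w) \<partial>lborel)
        = (\<Sum>s\<in>T. \<integral>w. (\<Sum>t\<in>T. indicator {0<..min s t} w *\<^sub>R k s t w) \<partial>lborel)"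
      by (intro Bochner_Integration.integral_sum Bochner_Integration.integrable_sum)
    also have "\<dots> = (\<Sum>s\<in>T. \<Sum>t\<in>T. (\<integral>w. indicator {0<..min s t} w *\<^sub>R k s t w \<partial>lborel))"
      using i by (intro sum.cong refl Bochner_Integration.integral_sum)
    finally show ?thesis .
  qed
  also have "\<dots> = (\<Sum>s\<in>T. \<Sum>t\<in>T. x s \<bullet> (h 0 (min s t) *v x t))"
    using leb T by (intro sum.cong refl) (auto simp: min_def)
  finally show ?thesis by (simp only: x_def)
qed

end

section \<open>The law of the partial sums and of their limit\<close>

context gauss_markov_basis
begin

text \<open>Exchanging the sums collects one coefficient vector \<open>c i\<close> per basis index,
  and the components of the \<open>Xi\<close> are independent standard normals. The variance is then
  reordered with the basis sum innermost, so that its limit can be taken for each pair of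
  times.\<close>

lemma XN_charfun:
  fixes Xi :: "nat \<times> nat \<Rightarrow> 'b \<Rightarrow> (real, 'd) vec"
  assumes M': "prob_space M'"
    and indep: "prob_space.indep_vars M' (\<lambda>_. borel) (\<lambda>(i,j) \<omega>. Xi i \<omega> $ j) (Iset \<times> (UNIV :: 'd set))"
    and normal: "\<And>i j. i \<in> Iset \<Longrightarrow> distributed M' lborel (\<lambda>\<omega>. Xi i \<omega> $ j) (normal_density 0 1)"
    and T: "finite T"
  shows "(\<lambda>\<omega>. \<Sum>t\<in>T. u t \<bullet> XN F sG lp mp rp Xi N t \<omega>) \<in> borel_measurable M'"
    and "(CLINT \<omega>|M'. iexp (\<Sum>t\<in>T. u t \<bullet> XN F sG lp mp rp Xi N t \<omega>))
     = exp (- (\<Sum>s\<in>T. \<Sum>t\<in>T. \<Sum>(n,k)\<in>IsetN N. (transpose (\<psi> n k s) *v u s) \<bullet> (transpose (\<psi> n k t) *v u t)) / 2)"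
proof -
  interpret prob_space M' by (rule M')
  have sub: "IsetN N \<subseteq> Iset" by (auto simp: IsetN_def Iset_def)
  define c where "c i = (\<Sum>t\<in>T. transpose (\<psi> (fst i) (snd i) t) *v u t)" for i
  let ?I = "IsetN N \<times> (UNIV :: 'd set)"
  let ?Z = "\<lambda>(i,j) \<omega>. Xi i \<omega> $ j"
  have eq: "(\<Sum>t\<in>T. u t \<bullet> XN F sG lp mp rp Xi N t \<omega>) = (\<Sum>x\<in>?I. (c (fst x) $ snd x) * ?Z x \<omega>)" for \<omega>
  proof -
    have "(\<Sum>t\<in>T. u t \<bullet> XN F sG lp mp rp Xi N t \<omega>)
        = (\<Sum>t\<in>T. \<Sum>i\<in>IsetN N. (transpose (\<psi> (fst i) (snd i) t) *v u t) \<bullet> Xi i \<omega>)"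
      by (simp only: XN_def case_prod_unfold inner_sum_right inner_matrix_vector_mult prod.collapse)
    also have "\<dots> = (\<Sum>i\<in>IsetN N. c i \<bullet> Xi i \<omega>)"
      unfolding c_def inner_sum_left by (rule sum.swap)
    also have "\<dots> = (\<Sum>i\<in>IsetN N. \<Sum>j\<in>UNIV. (c i $ j) * (Xi i \<omega> $ j))"
      by (simp add: inner_vec_def)
    also have "\<dots> = (\<Sum>x\<in>?I. (c (fst x) $ snd x) * ?Z x \<omega>)"
      by (auto simp: sum.cartesian_product intro!: sum.cong)
    finally show ?thesis .
  qed
  have dist: "distributed M' lborel (?Z x) (normal_density 0 1)" if "x \<in> ?I" for x
    using normal[of "fst x" "snd x"] that sub by (auto simp: case_prod_unfold)
  then have Zm: "?Z x \<in> borel_measurable M'" if "x \<in> ?I" for x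
    using that by (auto simp: distributed_def)
  show "(\<lambda>\<omega>. \<Sum>t\<in>T. u t \<bullet> XN F sG lp mp rp Xi N t \<omega>) \<in> borel_measurable M'"
    unfolding eq using Zm by (intro borel_measurable_sum borel_measurable_times borel_measurable_const)
  have "(CLINT \<omega>|M'. iexp (\<Sum>t\<in>T. u t \<bullet> XN F sG lp mp rp Xi N t \<omega>))
      = exp (- (\<Sum>x\<in>?I. ((c (fst x) $ snd x) * 1)\<^sup>2) / 2)"
    unfolding eq
    by (rule charfun_sum_indep_normal[OF _ indep_vars_subset[OF indep]])
      (use sub dist in \<open>auto simp: finite_IsetN\<close>)
  also have "(\<Sum>x\<in>?I. ((c (fst x) $ snd x) * 1)\<^sup>2) = (\<Sum>i\<in>IsetN N. c i \<bullet> c i)"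
    by (auto simp: sum.cartesian_product inner_vec_def power2_eq_square intro!: sum.cong)
  also have "\<dots> = (\<Sum>i\<in>IsetN N. \<Sum>s\<in>T. \<Sum>t\<in>T. (transpose (\<psi> (fst i) (snd i) s) *v u s) \<bullet> (transpose (\<psi> (fst i) (snd i) t) *v u t))"
    unfolding c_def inner_sum_left inner_sum_right
    by (intro sum.cong refl) (rule inner_commute)
  also have "\<dots> = (\<Sum>s\<in>T. \<Sum>t\<in>T. \<Sum>i\<in>IsetN N. (transpose (\<psi> (fst i) (snd i) s) *v u s) \<bullet> (transpose (\<psi> (fst i) (snd i) t) *v u t))"
    by (subst sum.swap) (intro sum.cong refl sum.swap)
  finally show "(CLINT \<omega>|M'. iexp (\<Sum>t\<in>T. u t \<bullet> XN F sG lp mp rp Xi N t \<omega>))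
     = exp (- (\<Sum>s\<in>T. \<Sum>t\<in>T. \<Sum>(n,k)\<in>IsetN N. (transpose (\<psi> n k s) *v u s) \<bullet> (transpose (\<psi> n k t) *v u t)) / 2)"
    by (simp only: case_prod_unfold)
qed

lemma limit_charfun:
  fixes Xi :: "nat \<times> nat \<Rightarrow> 'b \<Rightarrow> (real, 'd) vec"
  assumes M': "prob_space M'"
    and indep: "prob_space.indep_vars M' (\<lambda>_. borel) (\<lambda>(i,j) \<omega>. Xi i \<omega> $ j) (Iset \<times> (UNIV :: 'd set))"
    and normal: "\<And>i j. i \<in> Iset \<Longrightarrow> distributed M' lborel (\<lambda>\<omega>. Xi i \<omega> $ j) (normal_density 0 1)"
    and Xinf: "\<And>t. t \<in> {0..1} \<Longrightarrow> Xinf t \<in> borel_measurable M'"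
    and lim: "AE \<omega> in M'. \<forall>t\<in>{0..1}. (\<lambda>N. XN F sG lp mp rp Xi N t \<omega>) \<longlonglongrightarrow> Xinf t \<omega>"
    and T: "finite T" "T \<subseteq> {0..1}"
  shows "(CLINT \<omega>|M'. iexp (\<Sum>t\<in>T. u t \<bullet> Xinf t \<omega>))
     = exp (- (\<Sum>s\<in>T. \<Sum>t\<in>T. (transpose (F 0 s) *v u s) \<bullet> (h 0 (min s t) *v (transpose (F 0 t) *v u t))) / 2)"
proof -
  interpret prob_space M' by (rule M')
  have XN: "(\<lambda>\<omega>. \<Sum>t\<in>T. u t \<bullet> XN F sG lp mp rp Xi N t \<omega>) \<in> borel_measurable M'"
    "(CLINT \<omega>|M'. iexp (\<Sum>t\<in>T. u t \<bullet> XN F sG lp mp rp Xi N t \<omega>))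
     = exp (- (\<Sum>s\<in>T. \<Sum>t\<in>T. \<Sum>(n,k)\<in>IsetN N. (transpose (\<psi> n k s) *v u s) \<bullet> (transpose (\<psi> n k t) *v u t)) / 2)" for N
    by (rule XN_charfun[OF M' indep _ T(1)], rule normal, assumption)+
  have "AE \<omega> in M'. (\<lambda>N. \<Sum>t\<in>T. u t \<bullet> XN F sG lp mp rp Xi N t \<omega>) \<longlonglongrightarrow> (\<Sum>t\<in>T. u t \<bullet> Xinf t \<omega>)"
    using lim by eventually_elim (use T in \<open>auto intro!: tendsto_sum tendsto_inner\<close>)
  moreover have "(\<lambda>\<omega>. \<Sum>t\<in>T. u t \<bullet> Xinf t \<omega>) \<in> borel_measurable M'"
    using Xinf T by (intro borel_measurable_sum borel_measurable_inner) auto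
  ultimately have "(\<lambda>N. CLINT \<omega>|M'. iexp (\<Sum>t\<in>T. u t \<bullet> XN F sG lp mp rp Xi N t \<omega>)) \<longlonglongrightarrow> (CLINT \<omega>|M'. iexp (\<Sum>t\<in>T. u t \<bullet> Xinf t \<omega>))"
    using XN(1) by (intro charfun_tendsto_AE) auto
  moreover have "(\<lambda>N. \<Sum>s\<in>T. \<Sum>t\<in>T. \<Sum>(n,k)\<in>IsetN N. (transpose (\<psi> n k s) *v u s) \<bullet> (transpose (\<psi> n k t) *v u t))
      \<longlonglongrightarrow> (\<Sum>s\<in>T. \<Sum>t\<in>T. (transpose (F 0 s) *v u s) \<bullet> (h 0 (min s t) *v (transpose (F 0 t) *v u t)))"
    using T by (intro tendsto_sum psi_inner_sum) auto
  from tendsto_exp_neg_half[OF this]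
  have "(\<lambda>N. CLINT \<omega>|M'. iexp (\<Sum>t\<in>T. u t \<bullet> XN F sG lp mp rp Xi N t \<omega>))
      \<longlonglongrightarrow> exp (- (\<Sum>s\<in>T. \<Sum>t\<in>T. (transpose (F 0 s) *v u s) \<bullet> (h 0 (min s t) *v (transpose (F 0 t) *v u t))) / 2)"
    unfolding XN(2) .
  ultimately show ?thesis by (rule LIMSEQ_unique)
qed

end

theorem theorem4:
  fixes \<alpha> :: "real \<Rightarrow> ((real, 'd::{finite,linorder}) vec, 'd) vec"
    and sG :: "real \<Rightarrow> ((real,'m::finite) vec,'d) vec"
    and F :: "real \<Rightarrow> real \<Rightarrow> ((real,'d) vec,'d) vec"
    and \<rho> :: real
    and lp mp rp :: "nat \<Rightarrow> nat \<Rightarrow> real"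
    and M :: "'a measure" and W :: "real \<Rightarrow> 'a \<Rightarrow> (real,'m) vec" and X :: "real \<Rightarrow> 'a \<Rightarrow> (real,'d) vec"
    and M' :: "'b measure" and Xi :: "nat \<times> nat \<Rightarrow> 'b \<Rightarrow> (real,'d) vec"
    and Xinf :: "real \<Rightarrow> 'b \<Rightarrow> (real,'d) vec"
  assumes cont_alpha: "continuous_on {0..1} \<alpha>"
    and cont_sG: "continuous_on {0..1} sG"
    and flow_init: "\<forall>s\<in>{0..1}. F s s = mat 1"
    and flow_ode: "\<forall>s\<in>{0..1}. \<forall>t\<in>{0..1}.
          ((\<lambda>t. F s t) has_vector_derivative (\<alpha> t ** F s t)) (at t within {0..1})"
    and nondeg: "\<forall>u v. 0 \<le> u \<and> u < v \<and> v \<le> 1 \<longrightarrow>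
          posdef (F u v ** hu F sG u u v ** transpose (F u v))"
    and rho: "0 < \<rho>" "\<rho> < 1"
    and part_order: "\<forall>n k. 1 \<le> n \<and> k < 2^(n-1) \<longrightarrow> lp n k < mp n k \<and> mp n k < rp n k"
    and part_root: "lp 1 0 = 0" "rp 1 0 = 1"
    and part_split: "\<forall>n k. 1 \<le> n \<and> k < 2^(n-1) \<longrightarrow>
          lp (n+1) (2*k) = lp n k \<and> rp (n+1) (2*k) = mp n k \<and>
          lp (n+1) (2*k+1) = mp n k \<and> rp (n+1) (2*k+1) = rp n k"
    and part_ratio: "\<forall>n k. 1 \<le> n \<and> k < 2^(n-1) \<longrightarrow>
          max (rp n k - mp n k) (mp n k - lp n k) < \<rho> * (rp n k - lp n k)"
    and wiener: "std_wiener M W"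
    and sol: "sde_solution M \<alpha> sG W X"
    and prob': "prob_space M'"
    and Xi_indep: "prob_space.indep_vars M' (\<lambda>_. borel) (\<lambda>(i,j) \<omega>. Xi i \<omega> $ j)
                     (Iset \<times> (UNIV :: 'd set))"
    and Xi_normal: "\<forall>i\<in>Iset. \<forall>j. distributed M' lborel (\<lambda>\<omega>. Xi i \<omega> $ j) (normal_density 0 1)"
    and Xinf_meas: "\<forall>t\<in>{0..1}. Xinf t \<in> borel_measurable M'"
    and Xinf_lim: "AE \<omega> in M'. \<forall>t\<in>{0..1}.
          (\<lambda>N. XN F sG lp mp rp Xi N t \<omega>) \<longlonglongrightarrow> Xinf t \<omega>"
  shows "proc_law M' Xinf = proc_law M X"
proof -
  interpret gauss_markov_basis \<alpha> F sG \<rho> lp mp rp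
  proof
    show "lp (Suc N) k < mp (Suc N) k \<and> mp (Suc N) k < rp (Suc N) k" if "k < 2^N" for N k
      using part_order that by (metis One_nat_def diff_Suc_1 le_add1 plus_1_eq_Suc)
    show "lp (Suc (Suc N)) (2*k) = lp (Suc N) k \<and> rp (Suc (Suc N)) (2*k) = mp (Suc N) k \<and>
          lp (Suc (Suc N)) (2*k+1) = mp (Suc N) k \<and> rp (Suc (Suc N)) (2*k+1) = rp (Suc N) k" if "k < 2^N" for N k
      using part_split[rule_format, of "Suc N" k] that by simp
    show "max (rp (Suc N) k - mp (Suc N) k) (mp (Suc N) k - lp (Suc N) k) < \<rho> * (rp (Suc N) k - lp (Suc N) k)"
      if "k < 2^N" for N k
      using part_ratio[rule_format, of "Suc N" k] that by simp
  qed (use cont_alpha cont_sG flow_init flow_ode nondeg rho part_root in auto)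
  have M: "prob_space M" using wiener by (simp add: std_wiener_def)
  show ?thesis
  proof (rule proc_law_eqI[OF prob' M])
    show "Xinf t \<in> borel_measurable M'" "X t \<in> borel_measurable M" if "t \<in> {0..1}" for t
      using Xinf_meas sol that by (simp_all add: sde_solution_def)
    fix T :: "real set" and u :: "real \<Rightarrow> (real, 'd) vec"
    assume T: "finite T" "T \<subseteq> {0..1}"
    have "(CLINT \<omega>|M'. iexp (\<Sum>t\<in>T. u t \<bullet> Xinf t \<omega>))
       = exp (- (\<Sum>s\<in>T. \<Sum>t\<in>T. (transpose (F 0 s) *v u s) \<bullet> (h 0 (min s t) *v (transpose (F 0 t) *v u t))) / 2)"
      using Xi_normal Xinf_meas by (intro limit_charfun[OF prob' Xi_indep _ _ Xinf_lim T]) auto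
    also have "\<dots> = (CLINT \<omega>|M. iexp (\<Sum>t\<in>T. u t \<bullet> X t \<omega>))"
      unfolding variance_eq_kernel_sum[OF T, symmetric]
      by (rule sde_solution_charfun[OF linear_flow_axioms wiener cont_sG sol T, symmetric])
    finally show "(CLINT \<omega>|M'. iexp (\<Sum>t\<in>T. u t \<bullet> Xinf t \<omega>)) = (CLINT \<omega>|M. iexp (\<Sum>t\<in>T. u t \<bullet> X t \<omega>))" .
  qed
qed

end
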